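(* Let $G$ and $\Gamma$ be any groups, $n\ge1$, $G_n=G\wr\mathfrak S_n$, and let $\theta:\Gamma\to G_n$ be a homomorphism. Let $P_\theta\to Z_\theta$ be the $\Gamma$-equivariant $G$-principal bundle associated with $\theta$, and for each finite index subgroup $H\subset \Gamma$ and each homomorphism $\rho:H\to G$ let $r(H,\rho)$ be the number of $\Gamma$-irreducible components of $P_\theta\to Z_\theta$ isomorphic to $P_\rho\to\Gamma/H$. Then the centralizer of the image of $\theta$ in $G_n$ is a direct product of wreath products: $$C_{G_n}(\theta)\cong\prod_{[H]}\prod_{[\rho]}\bigl\{\mathrm{Aut}_{\Gamma\text{-}G}(P_\rho)\wr\mathfrak S_{r(H,\rho)}\bigr\},$$ where $[H]$ runs over conjugacy classes of finite index subgroups of $\Gamma$, and $[\rho]\in\mathrm{Hom}(H,G)/(N_\Gamma(H)\times G)$ for a given class $[H]$. Moreover, the group $\mathrm{Aut}_{\Gamma\text{-}G}(P_\rho)$ of $\Gamma$-equivariant $G$-bundle automorphisms of $P_\rho$ fits into exact sequences of groups $$1\to C_G(\rho)\to\mathrm{Aut}_{\Gamma\text{-}G}(P_\rho)\to H\backslash N_\Gamma^\rho(H)\to1,$$ $$1\to H\to T_\rho\to\mathrm{Aut}_{\Gamma\text{-}G}(P_\rho)\to1.$$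
   Context: A $\Gamma$-equivariant $G$-principal bundle over a (left, discrete) $\Gamma$-set $Z$ is a set $P$ with a free right $G$-action, a map $\pi:P\to Z$ whose fibres are exactly the $G$-orbits (each nonempty), and a left $\Gamma$-action on $P$ commuting with the $G$-action and inducing the $\Gamma$-action on $Z$. Isomorphisms (automorphisms) are bijections of total spaces commuting with both actions; $\mathrm{Aut}_{\Gamma\text{-}G}(P)$ is the automorphism group. The bundle is $\Gamma$-irreducible if $Z$ is $\Gamma$-transitive; every such bundle is the disjoint union of its restrictions to the $\Gamma$-orbits of $Z$ (its $\Gamma$-irreducible components). $G\wr\mathfrak S_n=\mathrm{Map}(\{1,\dots,n\},G)\rtimes\mathfrak S_n$ with $(\sigma f)(k)=f(\sigma^{-1}(k))$; it acts on $\{1,\dots,n\}\times G$ by $(f,\sigma)\cdot(\ell,g)=(\sigma(\ell),f(\sigma(\ell))g)$, commuting with right multiplication by $G$. $P_\theta=\{1,\dots,n\}\times G$ with $\Gamma$ acting through $\theta$, and $Z_\theta=\{1,\dots,n\}$ with the induced $\Gamma$-action. $A\wr\mathfrak S_0$ is the trivial group. For $H\subset\Gamma$ and $\rho:H\to G$, $P_\rho=\Gamma\times_\rho G=(\Gamma\times G)/\bigl((u,g)\sim(uh,\rho(h)^{-1}g),\ h\in H\bigr)\to\Gamma/H$, with the obvious left $\Gamma$- and right $G$-actions. $C_G(\rho)$ is the centralizer of $\rho(H)$ in $G$. $N_\Gamma(H)$ is the normalizer, acting on $\mathrm{Hom}(H,G)$ through conjugation on $H$; $G$ acts by conjugation.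 $N_\Gamma^\rho(H)=\{u\in N_\Gamma(H)\mid h\mapsto\rho(uhu^{-1})\text{ is }G\text{-conjugate to }\rho\}$, the isotropy subgroup of the $N_\Gamma(H)$-action on $\mathrm{Hom}(H,G)/G$ at the class of $\rho$. Finally $$T_\rho=\{(u,g)\in N_\Gamma(H)\times G\mid g^{-1}\rho(uhu^{-1})g=\rho(h)\text{ for all }h\in H\}.$$ In the second sequence the map $H\to T_\rho$ is $h\mapsto(h,\rho(h))$ and $(u,g)\in T_\rho$ maps to the automorphism $[v,k]\mapsto[vu^{-1},gk]$; in the first, the subgroup $C_G(\rho)$ corresponds to the automorphisms inducing the identity on $\Gamma/H$. *)

theory Defs
  imports "HOL-Algebra.Algebra"
begin

section \<open>Wreath products and centralizers\<close>

text \<open>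
  The semidirect product for the action of \<open>\<sigma>\<close> on \<open>f\<close> by \<open>(\<sigma> f)(k) = f (\<sigma>\<^sup>-\<^sup>1 k)\<close>.
  For \<open>n = 0\<close> the carrier is a singleton.
\<close>

definition wreath :: "'a monoid \<Rightarrow> nat \<Rightarrow> ((nat \<Rightarrow> 'a) \<times> (nat \<Rightarrow> nat)) monoid"
  where "wreath A n =
    \<lparr>carrier = carrier (product_group {1..n} (\<lambda>_. A)) \<times> carrier (sym_group n),
     monoid.mult = (\<lambda>(f, \<sigma>) (f', \<sigma>').
       (f \<otimes>\<^bsub>product_group {1..n} (\<lambda>_. A)\<^esub> (\<lambda>k\<in>{1..n}. f' (inv' \<sigma> k)), \<sigma> \<otimes>\<^bsub>sym_group n\<^esub> \<sigma>')),
     one = (\<one>\<^bsub>product_group {1..n} (\<lambda>_. A)\<^esub>, \<one>\<^bsub>sym_group n\<^esub>)\<rparr>"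

definition centralizer :: "'a monoid \<Rightarrow> 'a set \<Rightarrow> 'a set"
  where "centralizer G S = {x \<in> carrier G. \<forall>s\<in>S. x \<otimes>\<^bsub>G\<^esub> s = s \<otimes>\<^bsub>G\<^esub> x}"

text \<open>The library's \<^const>\<open>short_exact_sequence\<close> forces all groups to have the same element type.\<close>

definition short_exact ::
    "'a monoid \<Rightarrow> 'b monoid \<Rightarrow> 'c monoid \<Rightarrow> ('a \<Rightarrow> 'b) \<Rightarrow> ('b \<Rightarrow> 'c) \<Rightarrow> bool"
  where "short_exact A B C i p \<longleftrightarrow>
    group A \<and> group B \<and> group C \<and> i \<in> mon A B \<and> p \<in> epi B C \<and> i ` carrier A = kernel B C p"


section \<open>Equivariant principal bundles\<close>

record ('p, 'z, 'u, 'g) gbundle =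
  total_space :: "'p set"
  base_space :: "'z set"
  proj :: "'p \<Rightarrow> 'z"
  ract :: "'p \<Rightarrow> 'g \<Rightarrow> 'p"
  lact :: "'u \<Rightarrow> 'p \<Rightarrow> 'p"
  bact :: "'u \<Rightarrow> 'z \<Rightarrow> 'z"

text \<open>
  The library's \<^locale>\<open>group_action\<close> expects extensional functions, whence the restrictions.
\<close>

locale equivariant_bundle =
  fixes \<Gamma> :: "'u monoid" and G :: "'g monoid" and P :: "('p, 'z, 'u, 'g) gbundle"
  assumes group_G: "group G"
    and left_action: "group_action \<Gamma> (total_space P) (\<lambda>u. restrict (lact P u) (total_space P))"
    and base_action: "group_action \<Gamma> (base_space P) (\<lambda>u. restrict (bact P u) (base_space P))"
    and ract_closed: "x \<in> total_space P \<Longrightarrow> g \<in> carrier G \<Longrightarrow> ract P x g \<in> total_space P"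
    and ract_one: "x \<in> total_space P \<Longrightarrow> ract P x \<one>\<^bsub>G\<^esub> = x"
    and ract_mult: "x \<in> total_space P \<Longrightarrow> g \<in> carrier G \<Longrightarrow> h \<in> carrier G \<Longrightarrow>
        ract P x (g \<otimes>\<^bsub>G\<^esub> h) = ract P (ract P x g) h"
    and ract_free: "x \<in> total_space P \<Longrightarrow> g \<in> carrier G \<Longrightarrow> ract P x g = x \<Longrightarrow> g = \<one>\<^bsub>G\<^esub>"
    and proj_surj: "proj P ` total_space P = base_space P"
    and fibre_iff: "x \<in> total_space P \<Longrightarrow> y \<in> total_space P \<Longrightarrow>
        proj P x = proj P y \<longleftrightarrow> (\<exists>g\<in>carrier G. y = ract P x g)"
    and actions_commute: "x \<in> total_space P \<Longrightarrow> u \<in> carrier \<Gamma> \<Longrightarrow> g \<in> carrier G \<Longrightarrow>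
        lact P u (ract P x g) = ract P (lact P u x) g"
    and proj_equivariant: "x \<in> total_space P \<Longrightarrow> u \<in> carrier \<Gamma> \<Longrightarrow>
        proj P (lact P u x) = bact P u (proj P x)"

definition bundle_iso ::
    "'u monoid \<Rightarrow> 'g monoid \<Rightarrow> ('p, 'z, 'u, 'g) gbundle \<Rightarrow> ('q, 'y, 'u, 'g) gbundle \<Rightarrow> ('p \<Rightarrow> 'q) set"
  where "bundle_iso \<Gamma> G P Q =
    {\<phi>. bij_betw \<phi> (total_space P) (total_space Q) \<and>
        (\<forall>x\<in>total_space P. \<forall>u\<in>carrier \<Gamma>. \<phi> (lact P u x) = lact Q u (\<phi> x)) \<and>
        (\<forall>x\<in>total_space P. \<forall>g\<in>carrier G. \<phi> (ract P x g) = ract Q (\<phi> x) g)}"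

definition bundle_isomorphic ::
    "'u monoid \<Rightarrow> 'g monoid \<Rightarrow> ('p, 'z, 'u, 'g) gbundle \<Rightarrow> ('q, 'y, 'u, 'g) gbundle \<Rightarrow> bool"
  where "bundle_isomorphic \<Gamma> G P Q \<longleftrightarrow> bundle_iso \<Gamma> G P Q \<noteq> {}"

definition bundle_Aut :: "'u monoid \<Rightarrow> 'g monoid \<Rightarrow> ('p, 'z, 'u, 'g) gbundle \<Rightarrow> ('p \<Rightarrow> 'p) monoid"
  where "bundle_Aut \<Gamma> G P =
    BijGroup (total_space P) \<lparr>carrier := bundle_iso \<Gamma> G P P \<inter> extensional (total_space P)\<rparr>"

definition bundle_restrict :: "('p, 'z, 'u, 'g) gbundle \<Rightarrow> 'z set \<Rightarrow> ('p, 'z, 'u, 'g) gbundle"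
  where "bundle_restrict P Z = P\<lparr>total_space := {x \<in> total_space P. proj P x \<in> Z}, base_space := Z\<rparr>"

definition irreducible_components ::
    "'u monoid \<Rightarrow> ('p, 'z, 'u, 'g) gbundle \<Rightarrow> ('p, 'z, 'u, 'g) gbundle set"
  where "irreducible_components \<Gamma> P = bundle_restrict P ` orbits \<Gamma> (base_space P) (bact P)"

definition component_count ::
    "'u monoid \<Rightarrow> 'g monoid \<Rightarrow> ('p, 'z, 'u, 'g) gbundle \<Rightarrow> ('q, 'y, 'u, 'g) gbundle \<Rightarrow> nat"
  where "component_count \<Gamma> G P Q =
    card {C \<in> irreducible_components \<Gamma> P. bundle_isomorphic \<Gamma> G C Q}"


section \<open>The bundle associated with a homomorphism to a wreath product\<close>

definition wreath_act :: "'g monoid \<Rightarrow> (nat \<Rightarrow> 'g) \<times> (nat \<Rightarrow> nat) \<Rightarrow> nat \<times> 'g \<Rightarrow> nat \<times> 'g"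
  where "wreath_act G = (\<lambda>(f, \<sigma>) (l, g). (\<sigma> l, f (\<sigma> l) \<otimes>\<^bsub>G\<^esub> g))"

definition assoc_bundle ::
    "'g monoid \<Rightarrow> nat \<Rightarrow> ('u \<Rightarrow> (nat \<Rightarrow> 'g) \<times> (nat \<Rightarrow> nat)) \<Rightarrow> (nat \<times> 'g, nat, 'u, 'g) gbundle"
  where "assoc_bundle G n \<theta> =
    \<lparr>total_space = {1..n} \<times> carrier G,
     base_space = {1..n},
     proj = fst,
     ract = (\<lambda>(l, g) g'. (l, g \<otimes>\<^bsub>G\<^esub> g')),
     lact = (\<lambda>u. wreath_act G (\<theta> u)),
     bact = (\<lambda>u. snd (\<theta> u))\<rparr>"


section \<open>The bundle induced from a homomorphism on a subgroup\<close>

definition ind_rel :: "'u monoid \<Rightarrow> 'g monoid \<Rightarrow> 'u set \<Rightarrow> ('u \<Rightarrow> 'g) \<Rightarrow> ('u \<times> 'g) rel"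
  where "ind_rel \<Gamma> G H \<rho> =
    {((u, g), (u \<otimes>\<^bsub>\<Gamma>\<^esub> h, inv\<^bsub>G\<^esub> (\<rho> h) \<otimes>\<^bsub>G\<^esub> g)) | u g h. u \<in> carrier \<Gamma> \<and> g \<in> carrier G \<and> h \<in> H}"

definition ind_class :: "'u monoid \<Rightarrow> 'g monoid \<Rightarrow> 'u set \<Rightarrow> ('u \<Rightarrow> 'g) \<Rightarrow> 'u \<Rightarrow> 'g \<Rightarrow> ('u \<times> 'g) set"
  where "ind_class \<Gamma> G H \<rho> v k = ind_rel \<Gamma> G H \<rho> `` {(v, k)}"

text \<open>
  The maps of representatives \<open>(v, k) \<mapsto> v\<close>, \<open>(v, k) \<mapsto> (v, k g)\<close> and \<open>(v, k) \<mapsto> (u v, k)\<close>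
  carry each class onto a coset of \<open>H\<close>, respectively onto a class, so that the induced maps are
  given by taking images; see \<open>ind_bundle_class\<close> below.
\<close>

definition ind_bundle ::
    "'u monoid \<Rightarrow> 'g monoid \<Rightarrow> 'u set \<Rightarrow> ('u \<Rightarrow> 'g) \<Rightarrow> (('u \<times> 'g) set, 'u set, 'u, 'g) gbundle"
  where "ind_bundle \<Gamma> G H \<rho> =
    \<lparr>total_space = (carrier \<Gamma> \<times> carrier G) // ind_rel \<Gamma> G H \<rho>,
     base_space = lcosets\<^bsub>\<Gamma>\<^esub> H,
     proj = (\<lambda>C. fst ` C),
     ract = (\<lambda>C g. (\<lambda>(v, k). (v, k \<otimes>\<^bsub>G\<^esub> g)) ` C),
     lact = (\<lambda>u C. (\<lambda>(v, k). (u \<otimes>\<^bsub>\<Gamma>\<^esub> v, k)) ` C),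
     bact = (\<lambda>u Z. u <#\<^bsub>\<Gamma>\<^esub> Z)\<rparr>"


section \<open>Conjugacy classes of subgroups and of homomorphisms\<close>

definition finite_index_subgroups :: "'u monoid \<Rightarrow> 'u set set"
  where "finite_index_subgroups \<Gamma> = {H. subgroup H \<Gamma> \<and> finite (lcosets\<^bsub>\<Gamma>\<^esub> H)}"

definition subgroup_classes :: "'u monoid \<Rightarrow> 'u set set set"
  where "subgroup_classes \<Gamma> =
    orbits \<Gamma> (finite_index_subgroups \<Gamma>) (\<lambda>u H. (u <#\<^bsub>\<Gamma>\<^esub> H) #>\<^bsub>\<Gamma>\<^esub> inv\<^bsub>\<Gamma>\<^esub> u)"

text \<open>Homomorphisms are made extensional so that equality of functions is equality on \<open>H\<close>.\<close>

definition Homs :: "'u monoid \<Rightarrow> 'g monoid \<Rightarrow> 'u set \<Rightarrow> ('u \<Rightarrow> 'g) set"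
  where "Homs \<Gamma> G H = hom (\<Gamma>\<lparr>carrier := H\<rparr>) G \<inter> extensional H"

definition hom_classes :: "'u monoid \<Rightarrow> 'g monoid \<Rightarrow> 'u set \<Rightarrow> ('u \<Rightarrow> 'g) set set"
  where "hom_classes \<Gamma> G H =
    orbits (\<Gamma>\<lparr>carrier := normalizer \<Gamma> H\<rparr> \<times>\<times> G) (Homs \<Gamma> G H)
      (\<lambda>(u, g) \<rho>. \<lambda>h\<in>H. g \<otimes>\<^bsub>G\<^esub> \<rho> (inv\<^bsub>\<Gamma>\<^esub> u \<otimes>\<^bsub>\<Gamma>\<^esub> h \<otimes>\<^bsub>\<Gamma>\<^esub> u) \<otimes>\<^bsub>G\<^esub> inv\<^bsub>G\<^esub> g)"

definition hom_normalizer :: "'u monoid \<Rightarrow> 'g monoid \<Rightarrow> 'u set \<Rightarrow> ('u \<Rightarrow> 'g) \<Rightarrow> 'u set"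
  where "hom_normalizer \<Gamma> G H \<rho> =
    {u \<in> normalizer \<Gamma> H. \<exists>g\<in>carrier G. \<forall>h\<in>H.
       \<rho> (u \<otimes>\<^bsub>\<Gamma>\<^esub> h \<otimes>\<^bsub>\<Gamma>\<^esub> inv\<^bsub>\<Gamma>\<^esub> u) = g \<otimes>\<^bsub>G\<^esub> \<rho> h \<otimes>\<^bsub>G\<^esub> inv\<^bsub>G\<^esub> g}"

definition twist_group :: "'u monoid \<Rightarrow> 'g monoid \<Rightarrow> 'u set \<Rightarrow> ('u \<Rightarrow> 'g) \<Rightarrow> ('u \<times> 'g) monoid"
  where "twist_group \<Gamma> G H \<rho> = (\<Gamma> \<times>\<times> G)\<lparr>carrier :=
    {(u, g). u \<in> normalizer \<Gamma> H \<and> g \<in> carrier G \<and>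
       (\<forall>h\<in>H. inv\<^bsub>G\<^esub> g \<otimes>\<^bsub>G\<^esub> \<rho> (u \<otimes>\<^bsub>\<Gamma>\<^esub> h \<otimes>\<^bsub>\<Gamma>\<^esub> inv\<^bsub>\<Gamma>\<^esub> u) \<otimes>\<^bsub>G\<^esub> g = \<rho> h)}\<rparr>"

text \<open>
  The automorphism \<open>[v, k] \<mapsto> [v u\<^sup>-\<^sup>1, g k]\<close>, again given by images of classes; see
  \<open>twist_aut_class\<close> below.
\<close>

definition twist_aut ::
    "'u monoid \<Rightarrow> 'g monoid \<Rightarrow> 'u set \<Rightarrow> ('u \<Rightarrow> 'g) \<Rightarrow> 'u \<times> 'g \<Rightarrow> ('u \<times> 'g) set \<Rightarrow> ('u \<times> 'g) set"
  where "twist_aut \<Gamma> G H \<rho> = (\<lambda>(u, g). \<lambda>C\<in>total_space (ind_bundle \<Gamma> G H \<rho>).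
    (\<lambda>(v, k). (v \<otimes>\<^bsub>\<Gamma>\<^esub> inv\<^bsub>\<Gamma>\<^esub> u, g \<otimes>\<^bsub>G\<^esub> k)) ` C)"

text \<open>
  For an automorphism \<open>\<phi>\<close>, the set of all \<open>u\<close> such that \<open>\<phi>\<close> induces \<open>v H \<mapsto> v u\<^sup>-\<^sup>1 H\<close> on the base.
  It is a right coset of \<open>H\<close>.
\<close>

definition base_coset ::
    "'u monoid \<Rightarrow> 'g monoid \<Rightarrow> 'u set \<Rightarrow> ('u \<Rightarrow> 'g) \<Rightarrow> (('u \<times> 'g) set \<Rightarrow> ('u \<times> 'g) set) \<Rightarrow> 'u set"
  where "base_coset \<Gamma> G H \<rho> \<phi> = {u \<in> carrier \<Gamma>. \<forall>v\<in>carrier \<Gamma>. \<forall>k\<in>carrier G.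
    proj (ind_bundle \<Gamma> G H \<rho>) (\<phi> (ind_class \<Gamma> G H \<rho> v k)) = (v \<otimes>\<^bsub>\<Gamma>\<^esub> inv\<^bsub>\<Gamma>\<^esub> u) <#\<^bsub>\<Gamma>\<^esub> H}"


section \<open>Well-definedness\<close>

lemma inv_permutes_mem: "\<sigma> permutes {1..n} \<Longrightarrow> k \<in> {1..n} \<Longrightarrow> inv' \<sigma> k \<in> {1..n::nat}"
  by (metis permutes_in_image permutes_inv)

lemma carrier_wreath:
  "(f, \<sigma>) \<in> carrier (wreath A n) \<longleftrightarrow> f \<in> {1..n} \<rightarrow>\<^sub>E carrier A \<and> \<sigma> permutes {1..n}"
  by (simp add: wreath_def sym_group_def)

lemma mult_wreath:
  assumes "\<sigma> permutes {1..n}"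
  shows "(f, \<sigma>) \<otimes>\<^bsub>wreath A n\<^esub> (f', \<sigma>') = (\<lambda>k\<in>{1..n}. f k \<otimes>\<^bsub>A\<^esub> f' (inv' \<sigma> k), \<sigma> \<circ> \<sigma>')"
  by (auto simp: wreath_def sym_group_def)

lemma one_wreath: "\<one>\<^bsub>wreath A n\<^esub> = (\<lambda>k\<in>{1..n}. \<one>\<^bsub>A\<^esub>, id)"
  by (simp add: wreath_def sym_group_def)

lemma group_wreath:
  assumes "group A"
  shows "group (wreath A n)"
proof (rule groupI)
  interpret group A by fact
  show "x \<otimes>\<^bsub>wreath A n\<^esub> y \<in> carrier (wreath A n)"
    if x: "x \<in> carrier (wreath A n)" and y: "y \<in> carrier (wreath A n)" for x y
  proof -
    obtain f s f' s' where e: "x = (f, s)" "y = (f', s')" by fastforce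
    note c = x[unfolded e carrier_wreath] y[unfolded e carrier_wreath]
    show ?thesis
      using c inv_permutes_mem[of s n] permutes_compose[of s' "{1..n}" s]
      by (auto simp: e mult_wreath carrier_wreath PiE_iff)
  qed
  show "\<one>\<^bsub>wreath A n\<^esub> \<in> carrier (wreath A n)"
    by (auto simp: one_wreath carrier_wreath permutes_id)
  show "x \<otimes>\<^bsub>wreath A n\<^esub> y \<otimes>\<^bsub>wreath A n\<^esub> z = x \<otimes>\<^bsub>wreath A n\<^esub> (y \<otimes>\<^bsub>wreath A n\<^esub> z)"
    if x: "x \<in> carrier (wreath A n)" and y: "y \<in> carrier (wreath A n)"
      and z: "z \<in> carrier (wreath A n)" for x y z
  proof -
    obtain f s f' s' f'' s'' where e: "x = (f, s)" "y = (f', s')" "z = (f'', s'')" by (metis surj_pair)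
    note c = x[unfolded e carrier_wreath] y[unfolded e carrier_wreath] z[unfolded e carrier_wreath]
    have inv: "inv' (s \<circ> s') k = inv' s' (inv' s k)" for k
      using c permutes_bij o_inv_distrib comp_apply by metis
    have ss: "s \<circ> s' permutes {1..n}"
      using c permutes_compose by blast
    have "f k \<otimes>\<^bsub>A\<^esub> f' (inv' s k) \<otimes>\<^bsub>A\<^esub> f'' (inv' s' (inv' s k)) =
        f k \<otimes>\<^bsub>A\<^esub> (f' (inv' s k) \<otimes>\<^bsub>A\<^esub> f'' (inv' s' (inv' s k)))" if k: "k \<in> {1..n}" for k
    proof -
      have k': "inv' s k \<in> {1..n}" "inv' s' (inv' s k) \<in> {1..n}"
        using c k inv_permutes_mem by blast+
      show ?thesis
        by (rule m_assoc) (use c k k' in \<open>blast intro: PiE_mem\<close>)+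
    qed
    then have "(\<lambda>k\<in>{1..n}. f k \<otimes>\<^bsub>A\<^esub> f' (inv' s k) \<otimes>\<^bsub>A\<^esub> f'' (inv' s' (inv' s k))) =
        (\<lambda>k\<in>{1..n}. f k \<otimes>\<^bsub>A\<^esub> (f' (inv' s k) \<otimes>\<^bsub>A\<^esub> f'' (inv' s' (inv' s k))))"
      by (rule restrict_ext)
    moreover have "x \<otimes>\<^bsub>wreath A n\<^esub> y \<otimes>\<^bsub>wreath A n\<^esub> z =
        (\<lambda>k\<in>{1..n}. f k \<otimes>\<^bsub>A\<^esub> f' (inv' s k) \<otimes>\<^bsub>A\<^esub> f'' (inv' s' (inv' s k)), s \<circ> s' \<circ> s'')"
      using c ss by (simp add: e mult_wreath inv cong: restrict_cong)
    moreover have "x \<otimes>\<^bsub>wreath A n\<^esub> (y \<otimes>\<^bsub>wreath A n\<^esub> z) =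
        (\<lambda>k\<in>{1..n}. f k \<otimes>\<^bsub>A\<^esub> (f' (inv' s k) \<otimes>\<^bsub>A\<^esub> f'' (inv' s' (inv' s k))), s \<circ> s' \<circ> s'')"
      using c inv_permutes_mem[of s n]
      by (simp add: e mult_wreath o_assoc cong: restrict_cong)
    ultimately show ?thesis by simp
  qed
  show "\<one>\<^bsub>wreath A n\<^esub> \<otimes>\<^bsub>wreath A n\<^esub> x = x" if x: "x \<in> carrier (wreath A n)" for x
  proof -
    obtain f s where e: "x = (f, s)" by fastforce
    show ?thesis
      using x[unfolded e carrier_wreath]
      by (auto simp: e one_wreath mult_wreath permutes_id PiE_iff fun_eq_iff extensional_def)
  qed
  show "\<exists>y\<in>carrier (wreath A n). y \<otimes>\<^bsub>wreath A n\<^esub> x = \<one>\<^bsub>wreath A n\<^esub>"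
    if x: "x \<in> carrier (wreath A n)" for x
  proof -
    obtain f s where e: "x = (f, s)" by fastforce
    note c = x[unfolded e carrier_wreath]
    let ?y = "(\<lambda>k\<in>{1..n}. inv\<^bsub>A\<^esub> (f (s k)), inv' s)"
    have s: "s k \<in> {1..n}" if "k \<in> {1..n}" for k using that c permutes_in_image by metis
    have i: "inv' s permutes {1..n}" using c permutes_inv by blast
    have "?y \<in> carrier (wreath A n)"
      using c s i by (auto simp: carrier_wreath PiE_iff)
    moreover have "?y \<otimes>\<^bsub>wreath A n\<^esub> x = \<one>\<^bsub>wreath A n\<^esub>"
      using c s i by (auto simp: e mult_wreath one_wreath PiE_iff permutes_inv_inv permutes_inv_o
          l_inv intro!: restrict_ext)
    ultimately show ?thesis by blast
  qed
qed

lemma group_action_restrictI: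
  assumes "group \<Gamma>"
    and closed: "\<And>u x. u \<in> carrier \<Gamma> \<Longrightarrow> x \<in> E \<Longrightarrow> a u x \<in> E"
    and one: "\<And>x. x \<in> E \<Longrightarrow> a \<one>\<^bsub>\<Gamma>\<^esub> x = x"
    and mult: "\<And>u v x. u \<in> carrier \<Gamma> \<Longrightarrow> v \<in> carrier \<Gamma> \<Longrightarrow> x \<in> E \<Longrightarrow> a (u \<otimes>\<^bsub>\<Gamma>\<^esub> v) x = a u (a v x)"
  shows "group_action \<Gamma> E (\<lambda>u. restrict (a u) E)"
proof -
  interpret group \<Gamma> by fact
  have bij: "bij_betw (a u) E E" if "u \<in> carrier \<Gamma>" for u
    by (rule bij_betw_byWitness[where f' = "a (inv\<^bsub>\<Gamma>\<^esub> u)"])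
      (use that closed in \<open>auto simp: mult[symmetric] one\<close>)
  then have b: "restrict (a u) E \<in> Bij E" if "u \<in> carrier \<Gamma>" for u
    using that by (simp add: Bij_def bij_betw_cong[of E "restrict (a u) E" "a u"])
  have "(\<lambda>u. restrict (a u) E) \<in> hom \<Gamma> (BijGroup E)"
    using b closed by (intro homI) (auto simp: BijGroup_def mult compose_def fun_eq_iff)
  then show ?thesis
    by (simp add: group_action_def group_hom_def group_hom_axioms_def group_BijGroup is_group)
qed

lemma wreath_act_mult:
  assumes "group G" "x \<in> carrier (wreath G n)" "y \<in> carrier (wreath G n)" "p \<in> {1..n} \<times> carrier G"
  shows "wreath_act G (x \<otimes>\<^bsub>wreath G n\<^esub> y) p = wreath_act G x (wreath_act G y p)"
proof -
  interpret group G by fact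
  obtain f s f' s' l g where e: "x = (f, s)" "y = (f', s')" "p = (l, g)" by (metis surj_pair)
  note c = assms(2)[unfolded e carrier_wreath] assms(3)[unfolded e carrier_wreath]
  have l: "l \<in> {1..n}" and g: "g \<in> carrier G" using assms(4) by (auto simp: e)
  have s': "s' l \<in> {1..n}" using l c permutes_in_image by metis
  then have s: "s (s' l) \<in> {1..n}" using c permutes_in_image by metis
  have "inv' s (s (s' l)) = s' l" using c permutes_inverses(2) by metis
  then show ?thesis
    using c s s' l g by (auto simp: e wreath_act_def mult_wreath PiE_iff m_assoc)
qed

lemma wreath_act_closed:
  assumes "group G" "x \<in> carrier (wreath G n)" "p \<in> {1..n} \<times> carrier G"
  shows "wreath_act G x p \<in> {1..n} \<times> carrier G"
proof -
  interpret group G by fact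
  obtain f s l g where e: "x = (f, s)" "p = (l, g)" by (metis surj_pair)
  note c = assms(2)[unfolded e carrier_wreath]
  have l: "l \<in> {1..n}" and g: "g \<in> carrier G" using assms(3) by (auto simp: e)
  have s: "s l \<in> {1..n}" using l c permutes_in_image by metis
  have "f (s l) \<in> carrier G" using s c by (auto simp: PiE_iff)
  then show ?thesis using s g by (auto simp: e wreath_act_def)
qed

lemma equivariant_bundle_assoc:
  assumes "group \<Gamma>" "group G" "\<theta> \<in> hom \<Gamma> (wreath G n)"
  shows "equivariant_bundle \<Gamma> G (assoc_bundle G n \<theta>)"
proof -
  interpret \<Gamma>: group \<Gamma> by fact
  interpret G: group G by fact
  interpret W: group "wreath G n" by (rule group_wreath) fact
  interpret T: group_hom \<Gamma> "wreath G n" \<theta>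
    using assms by unfold_locales
  have cl: "\<theta> u \<in> carrier (wreath G n)" if "u \<in> carrier \<Gamma>" for u using that by simp
  have perm: "snd (\<theta> u) permutes {1..n}" if "u \<in> carrier \<Gamma>" for u
    using cl[OF that] by (cases "\<theta> u") (simp add: carrier_wreath)
  have snd_mult: "snd (\<theta> (u \<otimes>\<^bsub>\<Gamma>\<^esub> v)) = snd (\<theta> u) \<circ> snd (\<theta> v)"
    if "u \<in> carrier \<Gamma>" "v \<in> carrier \<Gamma>" for u v
    using that perm[OF that(1)] by (cases "\<theta> u"; cases "\<theta> v") (simp add: mult_wreath)
  note closed = wreath_act_closed[OF assms(2) cl]
  have left: "group_action \<Gamma> ({1..n} \<times> carrier G)
      (\<lambda>u. restrict (wreath_act G (\<theta> u)) ({1..n} \<times> carrier G))"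
  proof (rule group_action_restrictI[OF assms(1)])
    show "wreath_act G (\<theta> u) x \<in> {1..n} \<times> carrier G"
      if "u \<in> carrier \<Gamma>" "x \<in> {1..n} \<times> carrier G" for u x
      by (rule closed[OF that])
    show "wreath_act G (\<theta> \<one>\<^bsub>\<Gamma>\<^esub>) x = x" if "x \<in> {1..n} \<times> carrier G" for x
      using that by (auto simp: one_wreath wreath_act_def)
    show "wreath_act G (\<theta> (u \<otimes>\<^bsub>\<Gamma>\<^esub> v)) x = wreath_act G (\<theta> u) (wreath_act G (\<theta> v) x)"
      if "u \<in> carrier \<Gamma>" "v \<in> carrier \<Gamma>" "x \<in> {1..n} \<times> carrier G" for u v x
      using that wreath_act_mult[OF assms(2) cl cl that(3)] by simp
  qed
  have bs: "group_action \<Gamma> {1..n} (\<lambda>u. restrict (snd (\<theta> u)) {1..n})"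
  proof (rule group_action_restrictI[OF assms(1)])
    show "snd (\<theta> u) l \<in> {1..n}" if "u \<in> carrier \<Gamma>" "l \<in> {1..n}" for u l
      using perm[OF that(1)] that(2) permutes_in_image by metis
    show "snd (\<theta> \<one>\<^bsub>\<Gamma>\<^esub>) l = l" for l
      by (simp add: one_wreath)
    show "snd (\<theta> (u \<otimes>\<^bsub>\<Gamma>\<^esub> v)) l = snd (\<theta> u) (snd (\<theta> v) l)"
      if "u \<in> carrier \<Gamma>" "v \<in> carrier \<Gamma>" for u v l
      by (simp only: snd_mult[OF that] comp_apply)
  qed
  show ?thesis
  proof (rule equivariant_bundle.intro)
    fix p q assume p: "p \<in> total_space (assoc_bundle G n \<theta>)" "q \<in> total_space (assoc_bundle G n \<theta>)"
    then obtain l g l' g' where e: "p = (l, g)" "q = (l', g')" and g: "g \<in> carrier G" "g' \<in> carrier G"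
      by (auto simp: assoc_bundle_def)
    have "g \<otimes>\<^bsub>G\<^esub> (inv\<^bsub>G\<^esub> g \<otimes>\<^bsub>G\<^esub> g') = g'" using g by (simp add: G.m_assoc[symmetric])
    then have "\<exists>x\<in>carrier G. g \<otimes>\<^bsub>G\<^esub> x = g'"
      using g G.inv_closed G.m_closed by blast
    then show "proj (assoc_bundle G n \<theta>) p = proj (assoc_bundle G n \<theta>) q \<longleftrightarrow>
        (\<exists>x\<in>carrier G. q = ract (assoc_bundle G n \<theta>) p x)"
      by (auto simp: assoc_bundle_def e)
  next
    fix p u h assume h: "p \<in> total_space (assoc_bundle G n \<theta>)" "u \<in> carrier \<Gamma>" "h \<in> carrier G"
    then obtain l g where e: "p = (l, g)" "l \<in> {1..n}" and g: "g \<in> carrier G"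
      by (auto simp: assoc_bundle_def)
    obtain f s where fs: "\<theta> u = (f, s)" by fastforce
    have "s l \<in> {1..n}" using perm[OF h(2)] e(2) permutes_in_image unfolding fs snd_conv by metis
    then have "f (s l) \<in> carrier G"
      using cl[OF h(2)] unfolding fs carrier_wreath by (auto simp: PiE_iff)
    then show "lact (assoc_bundle G n \<theta>) u (ract (assoc_bundle G n \<theta>) p h) =
        ract (assoc_bundle G n \<theta>) (lact (assoc_bundle G n \<theta>) u p) h"
      using g h(3) by (simp add: assoc_bundle_def e(1) wreath_act_def fs G.m_assoc)
  next
    show "group_action \<Gamma> (total_space (assoc_bundle G n \<theta>))
        (\<lambda>u. restrict (lact (assoc_bundle G n \<theta>) u) (total_space (assoc_bundle G n \<theta>)))"
      using left by (simp only: assoc_bundle_def gbundle.select_convs)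
    show "group_action \<Gamma> (base_space (assoc_bundle G n \<theta>))
        (\<lambda>u. restrict (bact (assoc_bundle G n \<theta>) u) (base_space (assoc_bundle G n \<theta>)))"
      using bs by (simp only: assoc_bundle_def gbundle.select_convs)
    show "proj (assoc_bundle G n \<theta>) ` total_space (assoc_bundle G n \<theta>) =
        base_space (assoc_bundle G n \<theta>)"
      using G.one_closed by (force simp: assoc_bundle_def)
    show "proj (assoc_bundle G n \<theta>) (lact (assoc_bundle G n \<theta>) u p) =
        bact (assoc_bundle G n \<theta>) u (proj (assoc_bundle G n \<theta>) p)" for u p
      by (simp add: assoc_bundle_def wreath_act_def case_prod_beta)
  qed (auto simp: assoc_bundle_def G.m_assoc assms(2))
qed

context
  fixes \<Gamma> :: "'u monoid" and G :: "'g monoid" and H :: "'u set" and \<rho> :: "'u \<Rightarrow> 'g"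
  assumes group_\<Gamma>: "group \<Gamma>" and group_G: "group G"
    and subgroup_H: "subgroup H \<Gamma>" and hom_\<rho>: "\<rho> \<in> hom (\<Gamma>\<lparr>carrier := H\<rparr>) G"
begin

interpretation \<Gamma>: group \<Gamma> by (rule group_\<Gamma>)
interpretation G: group G by (rule group_G)
interpretation H: subgroup H \<Gamma> by (rule subgroup_H)
interpretation \<rho>: group_hom "\<Gamma>\<lparr>carrier := H\<rparr>" G \<rho>
  using hom_\<rho> H.subgroup_is_group[OF group_\<Gamma>] group_G
  by (simp add: group_hom_def group_hom_axioms_def)

lemma \<rho>_closed: "h \<in> H \<Longrightarrow> \<rho> h \<in> carrier G"
  using \<rho>.hom_closed by simp

lemma \<rho>_mult: "h \<in> H \<Longrightarrow> h' \<in> H \<Longrightarrow> \<rho> (h \<otimes>\<^bsub>\<Gamma>\<^esub> h') = \<rho> h \<otimes>\<^bsub>G\<^esub> \<rho> h'"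
  using \<rho>.hom_mult by simp

lemma \<rho>_one: "\<rho> \<one>\<^bsub>\<Gamma>\<^esub> = \<one>\<^bsub>G\<^esub>"
  using \<rho>.hom_one by simp

lemma \<rho>_inv: "h \<in> H \<Longrightarrow> \<rho> (inv\<^bsub>\<Gamma>\<^esub> h) = inv\<^bsub>G\<^esub> (\<rho> h)"
  by (metis G.inv_unique' H.m_inv_closed H.mem_carrier \<Gamma>.r_inv \<Gamma>.l_inv \<rho>_closed \<rho>_mult \<rho>_one)

lemmas \<rho>_simps = \<rho>_closed \<rho>_mult \<rho>_one \<rho>_inv

lemma ind_class_eq:
  assumes "v \<in> carrier \<Gamma>" "k \<in> carrier G"
  shows "ind_class \<Gamma> G H \<rho> v k = (\<lambda>h. (v \<otimes>\<^bsub>\<Gamma>\<^esub> h, inv\<^bsub>G\<^esub> (\<rho> h) \<otimes>\<^bsub>G\<^esub> k)) ` H"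
  using assms by (auto simp: ind_class_def ind_rel_def)

lemma equiv_ind_rel: "equiv (carrier \<Gamma> \<times> carrier G) (ind_rel \<Gamma> G H \<rho>)"
proof (rule equivI)
  show "ind_rel \<Gamma> G H \<rho> \<subseteq> (carrier \<Gamma> \<times> carrier G) \<times> (carrier \<Gamma> \<times> carrier G)"
    by (auto simp: ind_rel_def \<rho>_closed)
  show "refl_on (carrier \<Gamma> \<times> carrier G) (ind_rel \<Gamma> G H \<rho>)"
    unfolding refl_on_def ind_rel_def
    by (force simp: \<rho>_one intro: exI[where x = "\<one>\<^bsub>\<Gamma>\<^esub>"])
  show "sym (ind_rel \<Gamma> G H \<rho>)"
  proof (rule symI)
    fix p q assume "(p, q) \<in> ind_rel \<Gamma> G H \<rho>"
    then obtain u g h where e: "p = (u, g)" "q = (u \<otimes>\<^bsub>\<Gamma>\<^esub> h, inv\<^bsub>G\<^esub> (\<rho> h) \<otimes>\<^bsub>G\<^esub> g)"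
      and c: "u \<in> carrier \<Gamma>" "g \<in> carrier G" "h \<in> H"
      by (auto simp: ind_rel_def)
    have "p = (u \<otimes>\<^bsub>\<Gamma>\<^esub> h \<otimes>\<^bsub>\<Gamma>\<^esub> inv\<^bsub>\<Gamma>\<^esub> h, inv\<^bsub>G\<^esub> (\<rho> (inv\<^bsub>\<Gamma>\<^esub> h)) \<otimes>\<^bsub>G\<^esub> (inv\<^bsub>G\<^esub> (\<rho> h) \<otimes>\<^bsub>G\<^esub> g))"
      using c by (simp add: e \<rho>_simps \<Gamma>.m_assoc G.m_assoc[symmetric])
    moreover have "u \<otimes>\<^bsub>\<Gamma>\<^esub> h \<in> carrier \<Gamma>" "inv\<^bsub>G\<^esub> (\<rho> h) \<otimes>\<^bsub>G\<^esub> g \<in> carrier G" "inv\<^bsub>\<Gamma>\<^esub> h \<in> H"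
      using c by (simp_all add: \<rho>_simps)
    ultimately show "(q, p) \<in> ind_rel \<Gamma> G H \<rho>"
      unfolding ind_rel_def e(2) by blast
  qed
  show "trans (ind_rel \<Gamma> G H \<rho>)"
  proof (rule transI)
    fix p q r assume "(p, q) \<in> ind_rel \<Gamma> G H \<rho>" "(q, r) \<in> ind_rel \<Gamma> G H \<rho>"
    then obtain u g h h' where e: "p = (u, g)"
        "r = (u \<otimes>\<^bsub>\<Gamma>\<^esub> h \<otimes>\<^bsub>\<Gamma>\<^esub> h', inv\<^bsub>G\<^esub> (\<rho> h') \<otimes>\<^bsub>G\<^esub> (inv\<^bsub>G\<^esub> (\<rho> h) \<otimes>\<^bsub>G\<^esub> g))"
      and c: "u \<in> carrier \<Gamma>" "g \<in> carrier G" "h \<in> H" "h' \<in> H"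
      by (auto simp: ind_rel_def)
    have "r = (u \<otimes>\<^bsub>\<Gamma>\<^esub> (h \<otimes>\<^bsub>\<Gamma>\<^esub> h'), inv\<^bsub>G\<^esub> (\<rho> (h \<otimes>\<^bsub>\<Gamma>\<^esub> h')) \<otimes>\<^bsub>G\<^esub> g)"
      using c by (simp add: e \<rho>_simps \<Gamma>.m_assoc G.m_assoc G.inv_mult_group)
    then show "(p, r) \<in> ind_rel \<Gamma> G H \<rho>"
      using c unfolding ind_rel_def e(1) by blast
  qed
qed

lemma ind_class_eq_iff:
  assumes "v \<in> carrier \<Gamma>" "k \<in> carrier G" "v' \<in> carrier \<Gamma>" "k' \<in> carrier G"
  shows "ind_class \<Gamma> G H \<rho> v k = ind_class \<Gamma> G H \<rho> v' k' \<longleftrightarrow>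
    (\<exists>h\<in>H. v' = v \<otimes>\<^bsub>\<Gamma>\<^esub> h \<and> k' = inv\<^bsub>G\<^esub> (\<rho> h) \<otimes>\<^bsub>G\<^esub> k)"
  using assms eq_equiv_class_iff[OF equiv_ind_rel, of "(v, k)" "(v', k')"]
  by (auto simp: ind_class_def ind_rel_def)

lemma total_space_ind_bundle:
  "total_space (ind_bundle \<Gamma> G H \<rho>) = {ind_class \<Gamma> G H \<rho> v k | v k. v \<in> carrier \<Gamma> \<and> k \<in> carrier G}"
  by (auto simp: ind_bundle_def quotient_def ind_class_def)

lemma ind_bundle_class:
  assumes "v \<in> carrier \<Gamma>" "k \<in> carrier G"
  shows "proj (ind_bundle \<Gamma> G H \<rho>) (ind_class \<Gamma> G H \<rho> v k) = v <#\<^bsub>\<Gamma>\<^esub> H"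
    and "g \<in> carrier G \<Longrightarrow> ract (ind_bundle \<Gamma> G H \<rho>) (ind_class \<Gamma> G H \<rho> v k) g =
      ind_class \<Gamma> G H \<rho> v (k \<otimes>\<^bsub>G\<^esub> g)"
    and "u \<in> carrier \<Gamma> \<Longrightarrow> lact (ind_bundle \<Gamma> G H \<rho>) u (ind_class \<Gamma> G H \<rho> v k) =
      ind_class \<Gamma> G H \<rho> (u \<otimes>\<^bsub>\<Gamma>\<^esub> v) k"
proof -
  show "proj (ind_bundle \<Gamma> G H \<rho>) (ind_class \<Gamma> G H \<rho> v k) = v <#\<^bsub>\<Gamma>\<^esub> H"
    using assms by (auto simp: ind_bundle_def ind_class_eq l_coset_def image_image)
  show "ract (ind_bundle \<Gamma> G H \<rho>) (ind_class \<Gamma> G H \<rho> v k) g =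
      ind_class \<Gamma> G H \<rho> v (k \<otimes>\<^bsub>G\<^esub> g)" if "g \<in> carrier G"
    using assms that
    by (auto simp: ind_bundle_def ind_class_eq image_image \<rho>_simps G.m_assoc intro!: image_cong)
  show "lact (ind_bundle \<Gamma> G H \<rho>) u (ind_class \<Gamma> G H \<rho> v k) =
      ind_class \<Gamma> G H \<rho> (u \<otimes>\<^bsub>\<Gamma>\<^esub> v) k" if "u \<in> carrier \<Gamma>"
    using assms that
    by (auto simp: ind_bundle_def ind_class_eq image_image \<Gamma>.m_assoc intro!: image_cong)
qed

lemma equivariant_bundle_ind: "equivariant_bundle \<Gamma> G (ind_bundle \<Gamma> G H \<rho>)"
proof -
  let ?P = "ind_bundle \<Gamma> G H \<rho>" and ?c = "ind_class \<Gamma> G H \<rho>"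
  have total_cases: thesis
    if "x \<in> total_space ?P"
      "\<And>v k. x = ?c v k \<Longrightarrow> v \<in> carrier \<Gamma> \<Longrightarrow> k \<in> carrier G \<Longrightarrow> thesis" for x thesis
    using that by (auto simp: total_space_ind_bundle)
  have class_in: "?c v k \<in> total_space ?P" if "v \<in> carrier \<Gamma>" "k \<in> carrier G" for v k
    using that by (auto simp: total_space_ind_bundle)
  have base: "base_space ?P = (\<lambda>v. v <#\<^bsub>\<Gamma>\<^esub> H) ` carrier \<Gamma>"
    by (auto simp: ind_bundle_def LCOSETS_def)
  have bact: "bact ?P u (v <#\<^bsub>\<Gamma>\<^esub> H) = (u \<otimes>\<^bsub>\<Gamma>\<^esub> v) <#\<^bsub>\<Gamma>\<^esub> H"
    if "u \<in> carrier \<Gamma>" "v \<in> carrier \<Gamma>" for u v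
    using that by (simp add: ind_bundle_def \<Gamma>.lcos_m_assoc H.subset)
  show ?thesis
  proof (rule equivariant_bundle.intro)
    show "group_action \<Gamma> (total_space ?P) (\<lambda>u. restrict (lact ?P u) (total_space ?P))"
      by (rule group_action_restrictI[OF group_\<Gamma>])
        (auto elim!: total_cases simp: ind_bundle_class class_in \<Gamma>.m_assoc)
    show "group_action \<Gamma> (base_space ?P) (\<lambda>u. restrict (bact ?P u) (base_space ?P))"
      by (rule group_action_restrictI[OF group_\<Gamma>]) (auto simp: base bact \<Gamma>.m_assoc)
    show "g = \<one>\<^bsub>G\<^esub>" if xg: "x \<in> total_space ?P" "g \<in> carrier G" "ract ?P x g = x" for x g
      using xg(1)
    proof (rule total_cases)
      fix v k assume x: "x = ?c v k" and vk: "v \<in> carrier \<Gamma>" "k \<in> carrier G"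
      have "?c v k = ?c v (k \<otimes>\<^bsub>G\<^esub> g)"
        using xg(3) by (simp add: x ind_bundle_class(2)[OF vk xg(2)])
      then obtain h where h: "h \<in> H" "v = v \<otimes>\<^bsub>\<Gamma>\<^esub> h" "k \<otimes>\<^bsub>G\<^esub> g = inv\<^bsub>G\<^esub> (\<rho> h) \<otimes>\<^bsub>G\<^esub> k"
        using ind_class_eq_iff[OF vk vk(1) G.m_closed[OF vk(2) xg(2)]] by blast
      have "h = \<one>\<^bsub>\<Gamma>\<^esub>" using \<Gamma>.l_cancel_one'[OF vk(1) H.mem_carrier[OF h(1)]] h(2) by blast
      then show "g = \<one>\<^bsub>G\<^esub>" using h(3) vk xg(2) by (simp add: \<rho>_one)
    qed
    show "proj ?P ` total_space ?P = base_space ?P"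
    proof
      show "proj ?P ` total_space ?P \<subseteq> base_space ?P"
        by (auto simp: base ind_bundle_class elim!: total_cases)
      show "base_space ?P \<subseteq> proj ?P ` total_space ?P"
      proof
        fix Z assume "Z \<in> base_space ?P"
        then obtain v where v: "v \<in> carrier \<Gamma>" "Z = proj ?P (?c v \<one>\<^bsub>G\<^esub>)"
          by (auto simp: base ind_bundle_class)
        then show "Z \<in> proj ?P ` total_space ?P"
          using class_in by blast
      qed
    qed
    show "proj ?P x = proj ?P y \<longleftrightarrow> (\<exists>g\<in>carrier G. y = ract ?P x g)"
      if "x \<in> total_space ?P" "y \<in> total_space ?P" for x y
      using that(1)
    proof (rule total_cases)
      fix v k assume x: "x = ?c v k" and vk: "v \<in> carrier \<Gamma>" "k \<in> carrier G"
      from that(2) show ?thesis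
      proof (rule total_cases)
        fix v' k' assume y: "y = ?c v' k'" and vk': "v' \<in> carrier \<Gamma>" "k' \<in> carrier G"
        show ?thesis
        proof
          assume "proj ?P x = proj ?P y"
          then have "v' \<in> v <#\<^bsub>\<Gamma>\<^esub> H"
            using vk vk' \<Gamma>.lcos_self[OF vk'(1) subgroup_H] by (simp add: x y ind_bundle_class)
          then obtain h where h: "h \<in> H" "v' = v \<otimes>\<^bsub>\<Gamma>\<^esub> h" by (auto simp: l_coset_def)
          let ?g = "inv\<^bsub>G\<^esub> k \<otimes>\<^bsub>G\<^esub> (\<rho> h \<otimes>\<^bsub>G\<^esub> k')"
          have "k' = inv\<^bsub>G\<^esub> (\<rho> h) \<otimes>\<^bsub>G\<^esub> (k \<otimes>\<^bsub>G\<^esub> ?g)"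
            using vk vk' h by (simp add: \<rho>_simps G.m_assoc[symmetric])
          moreover have g: "?g \<in> carrier G"
            using vk vk' h by (simp add: \<rho>_simps)
          ultimately have "?c v (k \<otimes>\<^bsub>G\<^esub> ?g) = ?c v' k'"
            using vk vk' h ind_class_eq_iff[of v "k \<otimes>\<^bsub>G\<^esub> ?g" v' k'] by blast
          then have "y = ract ?P x ?g"
            by (simp add: x y ind_bundle_class(2)[OF vk g])
          then show "\<exists>g\<in>carrier G. y = ract ?P x g"
            using g by blast
        next
          assume "\<exists>g\<in>carrier G. y = ract ?P x g"
          then show "proj ?P x = proj ?P y"
            using vk by (auto simp: x ind_bundle_class)
        qed
      qed
    qed
    show "ract ?P x g \<in> total_space ?P" if "x \<in> total_space ?P" "g \<in> carrier G" for x g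
      using that by (auto elim!: total_cases simp: ind_bundle_class class_in)
    show "ract ?P x \<one>\<^bsub>G\<^esub> = x" if "x \<in> total_space ?P" for x
      using that by (auto elim!: total_cases simp: ind_bundle_class)
    show "ract ?P x (g \<otimes>\<^bsub>G\<^esub> h) = ract ?P (ract ?P x g) h"
      if "x \<in> total_space ?P" "g \<in> carrier G" "h \<in> carrier G" for x g h
      using that by (auto elim!: total_cases simp: ind_bundle_class G.m_assoc)
    show "lact ?P u (ract ?P x g) = ract ?P (lact ?P u x) g"
      if "x \<in> total_space ?P" "u \<in> carrier \<Gamma>" "g \<in> carrier G" for x u g
      using that by (auto elim!: total_cases simp: ind_bundle_class)
    show "proj ?P (lact ?P u x) = bact ?P u (proj ?P x)"
      if "x \<in> total_space ?P" "u \<in> carrier \<Gamma>" for x u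
      using that by (auto elim!: total_cases simp: ind_bundle_class bact)
  qed (rule group_G)
qed

lemma twist_aut_class:
  assumes ug: "(u, g) \<in> carrier (twist_group \<Gamma> G H \<rho>)"
    and vk: "v \<in> carrier \<Gamma>" "k \<in> carrier G"
  shows "twist_aut \<Gamma> G H \<rho> (u, g) (ind_class \<Gamma> G H \<rho> v k) =
    ind_class \<Gamma> G H \<rho> (v \<otimes>\<^bsub>\<Gamma>\<^esub> inv\<^bsub>\<Gamma>\<^esub> u) (g \<otimes>\<^bsub>G\<^esub> k)"
proof -
  have u: "u \<in> carrier \<Gamma>" and g: "g \<in> carrier G"
    and conj: "(u <#\<^bsub>\<Gamma>\<^esub> H) #>\<^bsub>\<Gamma>\<^esub> inv\<^bsub>\<Gamma>\<^esub> u = H"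
    and tw: "\<And>h. h \<in> H \<Longrightarrow> inv\<^bsub>G\<^esub> g \<otimes>\<^bsub>G\<^esub> \<rho> (u \<otimes>\<^bsub>\<Gamma>\<^esub> h \<otimes>\<^bsub>\<Gamma>\<^esub> inv\<^bsub>\<Gamma>\<^esub> u) \<otimes>\<^bsub>G\<^esub> g = \<rho> h"
    using ug H.subset by (auto simp: twist_group_def normalizer_def stabilizer_def)
  have im: "(\<lambda>h. u \<otimes>\<^bsub>\<Gamma>\<^esub> h \<otimes>\<^bsub>\<Gamma>\<^esub> inv\<^bsub>\<Gamma>\<^esub> u) ` H = H"
    using conj by (auto simp: l_coset_def r_coset_def)
  have "(v \<otimes>\<^bsub>\<Gamma>\<^esub> h \<otimes>\<^bsub>\<Gamma>\<^esub> inv\<^bsub>\<Gamma>\<^esub> u, g \<otimes>\<^bsub>G\<^esub> (inv\<^bsub>G\<^esub> (\<rho> h) \<otimes>\<^bsub>G\<^esub> k)) =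
      (\<lambda>h. (v \<otimes>\<^bsub>\<Gamma>\<^esub> inv\<^bsub>\<Gamma>\<^esub> u \<otimes>\<^bsub>\<Gamma>\<^esub> h, inv\<^bsub>G\<^esub> (\<rho> h) \<otimes>\<^bsub>G\<^esub> (g \<otimes>\<^bsub>G\<^esub> k)))
        (u \<otimes>\<^bsub>\<Gamma>\<^esub> h \<otimes>\<^bsub>\<Gamma>\<^esub> inv\<^bsub>\<Gamma>\<^esub> u)" if h: "h \<in> H" for h
  proof -
    have uh: "u \<otimes>\<^bsub>\<Gamma>\<^esub> h \<otimes>\<^bsub>\<Gamma>\<^esub> inv\<^bsub>\<Gamma>\<^esub> u \<in> H" using im h by blast
    have a: "v \<otimes>\<^bsub>\<Gamma>\<^esub> inv\<^bsub>\<Gamma>\<^esub> u \<otimes>\<^bsub>\<Gamma>\<^esub> (u \<otimes>\<^bsub>\<Gamma>\<^esub> h \<otimes>\<^bsub>\<Gamma>\<^esub> inv\<^bsub>\<Gamma>\<^esub> u) = v \<otimes>\<^bsub>\<Gamma>\<^esub> h \<otimes>\<^bsub>\<Gamma>\<^esub> inv\<^bsub>\<Gamma>\<^esub> u"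
      using vk u h by (simp add: \<Gamma>.m_assoc \<Gamma>.inv_solve_left')
    let ?r = "\<rho> (u \<otimes>\<^bsub>\<Gamma>\<^esub> h \<otimes>\<^bsub>\<Gamma>\<^esub> inv\<^bsub>\<Gamma>\<^esub> u)"
    have r: "?r \<in> carrier G" using uh by (rule \<rho>_closed)
    have "inv\<^bsub>G\<^esub> (\<rho> h) = inv\<^bsub>G\<^esub> g \<otimes>\<^bsub>G\<^esub> inv\<^bsub>G\<^esub> ?r \<otimes>\<^bsub>G\<^esub> g"
      using g r by (simp add: tw[OF h, symmetric] G.inv_mult_group G.m_assoc)
    then have "g \<otimes>\<^bsub>G\<^esub> (inv\<^bsub>G\<^esub> (\<rho> h) \<otimes>\<^bsub>G\<^esub> k) = inv\<^bsub>G\<^esub> ?r \<otimes>\<^bsub>G\<^esub> (g \<otimes>\<^bsub>G\<^esub> k)"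
      using g r vk by (simp add: G.m_assoc[symmetric])
    then show ?thesis using a by simp
  qed
  then have "(\<lambda>h. (v \<otimes>\<^bsub>\<Gamma>\<^esub> h \<otimes>\<^bsub>\<Gamma>\<^esub> inv\<^bsub>\<Gamma>\<^esub> u, g \<otimes>\<^bsub>G\<^esub> (inv\<^bsub>G\<^esub> (\<rho> h) \<otimes>\<^bsub>G\<^esub> k))) ` H =
      (\<lambda>h. (v \<otimes>\<^bsub>\<Gamma>\<^esub> inv\<^bsub>\<Gamma>\<^esub> u \<otimes>\<^bsub>\<Gamma>\<^esub> h, inv\<^bsub>G\<^esub> (\<rho> h) \<otimes>\<^bsub>G\<^esub> (g \<otimes>\<^bsub>G\<^esub> k))) `
        (\<lambda>h. u \<otimes>\<^bsub>\<Gamma>\<^esub> h \<otimes>\<^bsub>\<Gamma>\<^esub> inv\<^bsub>\<Gamma>\<^esub> u) ` H"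
    by (simp add: image_image)
  moreover have "ind_class \<Gamma> G H \<rho> v k \<in> total_space (ind_bundle \<Gamma> G H \<rho>)"
    using vk by (auto simp: total_space_ind_bundle)
  ultimately show ?thesis
    using vk u g by (simp add: twist_aut_def ind_class_eq image_image im)
qed

end


end

theory Submission
  imports Defs
begin

text \<open>
  An element of the wreath product that commutes with \<open>\<theta>\<close> is the same thing as an automorphism of
  \<open>P\<^sub>\<theta>\<close>: the wreath product acts faithfully on \<open>{1..n} \<times> G\<close>, and it acts by exactly those bijections
  that commute with the right action of \<open>G\<close> (\<open>centralizer_iso_Aut\<close>). So the centralizer is
  \<open>Aut(P\<^sub>\<theta>)\<close>, and the theorem concerns automorphisms of a bundle over a finite base.

  The tool for these is the notion of a frame of type \<open>(H, \<rho>)\<close>: a point \<open>x\<close> over a base point with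
  isotropy group \<open>H\<close>, such that \<open>h x = x \<rho>(h)\<close> for \<open>h \<in> H\<close>. The class \<open>[1, 1]\<close> is such a frame in
  \<open>P\<^sub>\<rho>\<close>, and a frame \<open>x\<close> in any bundle spreads to an isomorphism \<open>[v, k] \<mapsto> v x k\<close> from \<open>P\<^sub>\<rho>\<close> to the
  component of \<open>x\<close> (\<open>frame_iso\<close>). Replacing \<open>x\<close> by \<open>w x g\<close> conjugates the type (\<open>frame_move\<close>). Three
  consequences carry the proof.

  Applied to \<open>P\<^sub>\<rho>\<close> itself, automorphisms correspond to frames \<open>[u\<^sup>-\<^sup>1, g]\<close> of type \<open>(H, \<rho>)\<close>, and
  \<open>(u, g)\<close> gives such a frame iff it lies in \<open>T\<^sub>\<rho>\<close>. This makes \<open>T\<^sub>\<rho> \<rightarrow> Aut(P\<^sub>\<rho>)\<close> surjective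
  (\<open>twist_surj\<close>), and both exact sequences follow by computing when an element of \<open>T\<^sub>\<rho>\<close> acts trivially
  on \<open>P\<^sub>\<rho>\<close> or on its base.

  Applied to a component, the types of its frames form one class under conjugation. So every
  component is isomorphic to \<open>P\<^sub>\<rho>\<close> for exactly one pair of representatives
  (\<open>class_frame_exists\<close>, \<open>class_frame_unique\<close>).

  Finally, an automorphism maps frames to frames of the same type, so it permutes the components of
  each isomorphism type. A bundle that is a disjoint union of \<open>r\<^sub>i\<close> copies of bundles \<open>Q\<^sub>i\<close>, with
  automorphisms permuting the copies of each \<open>Q\<^sub>i\<close>, has as automorphism group the product of
  the wreath products of \<open>Aut(Q\<^sub>i)\<close> with the symmetric group on \<open>r\<^sub>i\<close> letters (\<open>Aut_iso\<close>).
\<close>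

section \<open>Equivariant bundles and their automorphism groups\<close>

context equivariant_bundle
begin

lemma group_Gamma: "group \<Gamma>"
  using left_action by (simp add: group_action_def group_hom_def)

lemma lact_closed: "x \<in> total_space P \<Longrightarrow> u \<in> carrier \<Gamma> \<Longrightarrow> lact P u x \<in> total_space P"
  using group_action.element_image[OF left_action, of u x] by simp

lemma lact_one: "x \<in> total_space P \<Longrightarrow> lact P \<one>\<^bsub>\<Gamma>\<^esub> x = x"
  using fun_cong[OF group_action.id_eq_one[OF left_action], of x] by simp

lemma lact_mult:
  "x \<in> total_space P \<Longrightarrow> u \<in> carrier \<Gamma> \<Longrightarrow> v \<in> carrier \<Gamma> \<Longrightarrow>
    lact P (u \<otimes>\<^bsub>\<Gamma>\<^esub> v) x = lact P u (lact P v x)"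
  using group_action.composition_rule[OF left_action, of x u v] by (simp add: lact_closed)

lemma bact_closed: "z \<in> base_space P \<Longrightarrow> u \<in> carrier \<Gamma> \<Longrightarrow> bact P u z \<in> base_space P"
  using group_action.element_image[OF base_action, of u z] by simp

lemma bact_one: "z \<in> base_space P \<Longrightarrow> bact P \<one>\<^bsub>\<Gamma>\<^esub> z = z"
  using fun_cong[OF group_action.id_eq_one[OF base_action], of z] by simp

lemma bact_mult:
  "z \<in> base_space P \<Longrightarrow> u \<in> carrier \<Gamma> \<Longrightarrow> v \<in> carrier \<Gamma> \<Longrightarrow>
    bact P (u \<otimes>\<^bsub>\<Gamma>\<^esub> v) z = bact P u (bact P v z)"
  using group_action.composition_rule[OF base_action, of z u v] by (simp add: bact_closed)

lemma proj_closed: "x \<in> total_space P \<Longrightarrow> proj P x \<in> base_space P"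
  using proj_surj by blast

lemma proj_ract: "x \<in> total_space P \<Longrightarrow> g \<in> carrier G \<Longrightarrow> proj P (ract P x g) = proj P x"
  using fibre_iff[of x "ract P x g"] by (auto simp: ract_closed)

lemma ract_cancel:
  assumes "x \<in> total_space P" "g \<in> carrier G" "h \<in> carrier G" "ract P x g = ract P x h"
  shows "g = h"
proof -
  interpret G: group G by (rule group_G)
  have "ract P x (g \<otimes>\<^bsub>G\<^esub> inv\<^bsub>G\<^esub> h) = ract P x (h \<otimes>\<^bsub>G\<^esub> inv\<^bsub>G\<^esub> h)"
    using assms by (simp only: ract_mult G.inv_closed)
  then have "g \<otimes>\<^bsub>G\<^esub> inv\<^bsub>G\<^esub> h = \<one>\<^bsub>G\<^esub>"
    using assms by (intro ract_free[of x]) (auto simp: ract_one)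
  then show ?thesis
    using assms by (metis G.inv_closed G.inv_equality G.inv_inv)
qed

end

lemma bundle_isoD:
  assumes "\<phi> \<in> bundle_iso \<Gamma> G P Q"
  shows "bij_betw \<phi> (total_space P) (total_space Q)"
    and "x \<in> total_space P \<Longrightarrow> \<phi> x \<in> total_space Q"
    and "x \<in> total_space P \<Longrightarrow> u \<in> carrier \<Gamma> \<Longrightarrow> \<phi> (lact P u x) = lact Q u (\<phi> x)"
    and "x \<in> total_space P \<Longrightarrow> g \<in> carrier G \<Longrightarrow> \<phi> (ract P x g) = ract Q (\<phi> x) g"
  using assms by (auto simp: bundle_iso_def bij_betw_def)

lemma bundle_iso_comp:
  assumes "\<phi> \<in> bundle_iso \<Gamma> G P Q" "\<chi> \<in> bundle_iso \<Gamma> G Q R"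
  shows "\<chi> \<circ> \<phi> \<in> bundle_iso \<Gamma> G P R"
  using bij_betw_trans[OF bundle_isoD(1)[OF assms(1)] bundle_isoD(1)[OF assms(2)]]
    bundle_isoD[OF assms(1)] bundle_isoD[OF assms(2)]
  by (simp add: bundle_iso_def)

text \<open>
  Closure of the source under the two actions is what makes the inverse equivariant. It is a
  hypothesis here so that the lemma covers the restriction of a bundle to an orbit of its base.
\<close>

lemma bundle_iso_inv:
  assumes "\<phi> \<in> bundle_iso \<Gamma> G P Q"
    and "\<And>x u. x \<in> total_space P \<Longrightarrow> u \<in> carrier \<Gamma> \<Longrightarrow> lact P u x \<in> total_space P"
    and "\<And>x g. x \<in> total_space P \<Longrightarrow> g \<in> carrier G \<Longrightarrow> ract P x g \<in> total_space P"
  shows "inv_into (total_space P) \<phi> \<in> bundle_iso \<Gamma> G Q P"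
proof -
  let ?j = "inv_into (total_space P) \<phi>"
  note D = bundle_isoD[OF assms(1)]
  have inj: "inj_on \<phi> (total_space P)" and im: "\<phi> ` total_space P = total_space Q"
    using D(1) by (auto simp: bij_betw_def)
  have j: "?j y \<in> total_space P" "\<phi> (?j y) = y" if "y \<in> total_space Q" for y
    using that im by (auto intro: inv_into_into f_inv_into_f)
  have "?j (lact Q u y) = lact P u (?j y)" if y: "y \<in> total_space Q" and u: "u \<in> carrier \<Gamma>" for y u
    using inv_into_f_f[OF inj assms(2)[OF j(1)[OF y] u]] D(3)[OF j(1)[OF y] u] j(2)[OF y] by simp
  moreover have "?j (ract Q y g) = ract P (?j y) g"
    if y: "y \<in> total_space Q" and g: "g \<in> carrier G" for y g
    using inv_into_f_f[OF inj assms(3)[OF j(1)[OF y] g]] D(4)[OF j(1)[OF y] g] j(2)[OF y] by simp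
  ultimately show ?thesis
    using bij_betw_inv_into[OF D(1)] by (simp add: bundle_iso_def)
qed

lemma bundle_iso_cong:
  assumes "\<phi> \<in> bundle_iso \<Gamma> G P Q"
    and "\<And>x u. x \<in> total_space P \<Longrightarrow> u \<in> carrier \<Gamma> \<Longrightarrow> lact P u x \<in> total_space P"
    and "\<And>x g. x \<in> total_space P \<Longrightarrow> g \<in> carrier G \<Longrightarrow> ract P x g \<in> total_space P"
    and "\<And>x. x \<in> total_space P \<Longrightarrow> \<chi> x = \<phi> x"
  shows "\<chi> \<in> bundle_iso \<Gamma> G P Q"
  using bundle_isoD[OF assms(1)] assms(2-)
  by (simp add: bundle_iso_def bij_betw_cong[of _ \<chi> \<phi>])

lemma carrier_bundle_Aut:
  "\<phi> \<in> carrier (bundle_Aut \<Gamma> G P) \<longleftrightarrow> \<phi> \<in> bundle_iso \<Gamma> G P P \<and> \<phi> \<in> extensional (total_space P)"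
  by (simp add: bundle_Aut_def)

lemma one_bundle_Aut: "\<one>\<^bsub>bundle_Aut \<Gamma> G P\<^esub> = (\<lambda>x\<in>total_space P. x)"
  by (simp add: bundle_Aut_def BijGroup_def)

lemma mult_bundle_Aut:
  assumes "\<phi> \<in> carrier (bundle_Aut \<Gamma> G P)" "\<chi> \<in> carrier (bundle_Aut \<Gamma> G P)"
  shows "\<phi> \<otimes>\<^bsub>bundle_Aut \<Gamma> G P\<^esub> \<chi> = (\<lambda>x\<in>total_space P. \<phi> (\<chi> x))"
proof -
  have "\<phi> \<in> Bij (total_space P)" "\<chi> \<in> Bij (total_space P)"
    using assms by (auto simp: carrier_bundle_Aut Bij_def dest: bundle_isoD(1))
  then show ?thesis
    by (simp add: bundle_Aut_def BijGroup_def compose_def)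
qed

context equivariant_bundle
begin

lemma restrict_bundle_Aut:
  "\<phi> \<in> bundle_iso \<Gamma> G P P \<Longrightarrow> restrict \<phi> (total_space P) \<in> carrier (bundle_Aut \<Gamma> G P)"
  by (auto simp: carrier_bundle_Aut ract_closed lact_closed intro: bundle_iso_cong)

lemma group_bundle_Aut: "group (bundle_Aut \<Gamma> G P)"
proof -
  have Bij: "\<phi> \<in> Bij (total_space P)" if "\<phi> \<in> carrier (bundle_Aut \<Gamma> G P)" for \<phi>
    using that by (auto simp: carrier_bundle_Aut Bij_def dest: bundle_isoD(1))
  have "subgroup (bundle_iso \<Gamma> G P P \<inter> extensional (total_space P)) (BijGroup (total_space P))"
  proof (rule group.subgroupI[OF group_BijGroup])
    show "bundle_iso \<Gamma> G P P \<inter> extensional (total_space P) \<subseteq> carrier (BijGroup (total_space P))"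
      using Bij by (auto simp: carrier_bundle_Aut BijGroup_def)
    have "restrict id (total_space P) \<in> bundle_iso \<Gamma> G P P \<inter> extensional (total_space P)"
      using restrict_bundle_Aut[of id] by (simp add: carrier_bundle_Aut bundle_iso_def)
    then show "bundle_iso \<Gamma> G P P \<inter> extensional (total_space P) \<noteq> {}" by blast
  next
    fix \<phi> assume \<phi>: "\<phi> \<in> bundle_iso \<Gamma> G P P \<inter> extensional (total_space P)"
    then have "inv_into (total_space P) \<phi> \<in> bundle_iso \<Gamma> G P P"
      by (auto intro: bundle_iso_inv simp: lact_closed ract_closed)
    from restrict_bundle_Aut[OF this]
    show "inv\<^bsub>BijGroup (total_space P)\<^esub> \<phi> \<in> bundle_iso \<Gamma> G P P \<inter> extensional (total_space P)"
      using \<phi> Bij by (simp add: carrier_bundle_Aut inv_BijGroup)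
  next
    fix \<phi> \<chi>
    assume \<phi>: "\<phi> \<in> bundle_iso \<Gamma> G P P \<inter> extensional (total_space P)"
      and \<chi>: "\<chi> \<in> bundle_iso \<Gamma> G P P \<inter> extensional (total_space P)"
    have "\<phi> \<otimes>\<^bsub>BijGroup (total_space P)\<^esub> \<chi> = restrict (\<phi> \<circ> \<chi>) (total_space P)"
      using \<phi> \<chi> Bij by (simp add: carrier_bundle_Aut BijGroup_def compose_def comp_def)
    then show "\<phi> \<otimes>\<^bsub>BijGroup (total_space P)\<^esub> \<chi> \<in> bundle_iso \<Gamma> G P P \<inter> extensional (total_space P)"
      using restrict_bundle_Aut[OF bundle_iso_comp, of \<chi> P \<phi>] \<phi> \<chi>
      by (simp add: carrier_bundle_Aut)
  qed
  then show ?thesis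
    using subgroup.subgroup_is_group group_BijGroup unfolding bundle_Aut_def by blast
qed

end

section \<open>Frames\<close>

text \<open>
  If \<open>H\<close> is the isotropy group of \<open>proj P x\<close>, every \<open>h \<in> H\<close> moves \<open>x\<close> inside its fibre, hence
  \<open>h x = x \<rho>(h)\<close> for exactly one \<open>\<rho>(h)\<close>. A frame of type \<open>(H, \<rho>)\<close> is a point for which this is the
  given \<open>\<rho>\<close>. Frames play the role of base points: they are the possible images of \<open>[1, 1]\<close> under
  injective equivariant maps from \<open>P\<^sub>\<rho>\<close>.
\<close>

definition frame ::
    "'u monoid \<Rightarrow> ('p, 'z, 'u, 'g) gbundle \<Rightarrow> 'u set \<Rightarrow> ('u \<Rightarrow> 'g) \<Rightarrow> 'p \<Rightarrow> bool"
  where "frame \<Gamma> P H \<rho> x \<longleftrightarrow> x \<in> total_space P \<and>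
    H = {u \<in> carrier \<Gamma>. proj P (lact P u x) = proj P x} \<and>
    (\<forall>h\<in>H. lact P h x = ract P x (\<rho> h))"

lemma frameD:
  assumes "frame \<Gamma> P H \<rho> x"
  shows "x \<in> total_space P" and "H = {u \<in> carrier \<Gamma>. proj P (lact P u x) = proj P x}"
    and "h \<in> H \<Longrightarrow> lact P h x = ract P x (\<rho> h)"
  using assms unfolding frame_def by blast+

context equivariant_bundle
begin

text \<open>
  The map \<open>\<rho>\<close> is multiplicative because left and right actions commute:
  \<open>h k x = h (x \<rho>(k)) = (h x) \<rho>(k) = x \<rho>(h) \<rho>(k)\<close>.
\<close>

lemma frame_exists:
  assumes x: "x \<in> total_space P" and H: "H = {u \<in> carrier \<Gamma>. proj P (lact P u x) = proj P x}"
  obtains \<rho> where "subgroup H \<Gamma>" "\<rho> \<in> hom (\<Gamma>\<lparr>carrier := H\<rparr>) G" "frame \<Gamma> P H \<rho> x"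
proof -
  interpret \<Gamma>: group \<Gamma> by (rule group_Gamma)
  interpret G: group G by (rule group_G)
  have "\<exists>g\<in>carrier G. lact P h x = ract P x g" if "h \<in> H" for h
    using that fibre_iff[of x "lact P h x"] x lact_closed by (auto simp: H)
  then obtain \<rho> where \<rho>: "\<And>h. h \<in> H \<Longrightarrow> \<rho> h \<in> carrier G \<and> lact P h x = ract P x (\<rho> h)"
    by metis
  have mem: "h \<in> carrier \<Gamma> \<and> bact P h (proj P x) = proj P x" if "h \<in> H" for h
    using that x proj_equivariant[OF x, of h] by (auto simp: H)
  have z: "proj P x \<in> base_space P" by (rule proj_closed[OF x])
  have sub: "subgroup H \<Gamma>"
  proof (rule \<Gamma>.subgroupI)
    show "H \<subseteq> carrier \<Gamma>" by (auto simp: H)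
    show "H \<noteq> {}" using x by (auto simp: H lact_one intro!: exI[of _ "\<one>\<^bsub>\<Gamma>\<^esub>"])
    show "a \<otimes>\<^bsub>\<Gamma>\<^esub> b \<in> H" if "a \<in> H" "b \<in> H" for a b
      using mem[OF that(1)] mem[OF that(2)] x z by (simp add: H proj_equivariant bact_mult)
    show "inv\<^bsub>\<Gamma>\<^esub> a \<in> H" if "a \<in> H" for a
    proof -
      have "bact P (inv\<^bsub>\<Gamma>\<^esub> a) (bact P a (proj P x)) = proj P x"
        using mem[OF that] bact_mult[OF z, of "inv\<^bsub>\<Gamma>\<^esub> a" a] bact_one[OF z] \<Gamma>.l_inv[of a] by simp
      then show ?thesis
        using mem[OF that] x by (simp add: H proj_equivariant)
    qed
  qed
  have "\<rho> \<in> hom (\<Gamma>\<lparr>carrier := H\<rparr>) G"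
  proof (rule homI; simp)
    show "\<rho> h \<in> carrier G" if "h \<in> H" for h using \<rho>[OF that] by blast
    fix h k assume h: "h \<in> H" and k: "k \<in> H"
    have hk: "h \<otimes>\<^bsub>\<Gamma>\<^esub> k \<in> H" using sub h k by (rule subgroup.m_closed)
    have "ract P x (\<rho> (h \<otimes>\<^bsub>\<Gamma>\<^esub> k)) = lact P h (lact P k x)"
      using \<rho>[OF hk] mem[OF h] mem[OF k] x by (simp add: lact_mult)
    also have "\<dots> = ract P (ract P x (\<rho> h)) (\<rho> k)"
      using \<rho>[OF h] \<rho>[OF k] mem[OF h] x by (simp add: actions_commute)
    also have "\<dots> = ract P x (\<rho> h \<otimes>\<^bsub>G\<^esub> \<rho> k)"
      using \<rho>[OF h] \<rho>[OF k] x by (simp add: ract_mult)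
    finally show "\<rho> (h \<otimes>\<^bsub>\<Gamma>\<^esub> k) = \<rho> h \<otimes>\<^bsub>G\<^esub> \<rho> k"
      using \<rho>[OF hk] \<rho>[OF h] \<rho>[OF k] x by (intro ract_cancel[of x]) auto
  qed
  moreover have "frame \<Gamma> P H \<rho> x"
    using x \<rho> H by (auto simp: frame_def)
  ultimately show thesis using that sub by blast
qed

text \<open>
  An element \<open>h\<close> of \<open>w H w\<^sup>-\<^sup>1\<close> acts on \<open>w x g\<close> through the action of \<open>w\<^sup>-\<^sup>1 h w\<close> on \<open>x\<close>. Thus moving the
  point conjugates the type, and the types of frames over one orbit of the base form a single class.
\<close>

lemma frame_move:
  assumes fr: "frame \<Gamma> P H \<rho> x" and \<rho>: "\<And>h. h \<in> H \<Longrightarrow> \<rho> h \<in> carrier G"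
    and w: "w \<in> carrier \<Gamma>" and g: "g \<in> carrier G"
  shows "frame \<Gamma> P ((w <#\<^bsub>\<Gamma>\<^esub> H) #>\<^bsub>\<Gamma>\<^esub> inv\<^bsub>\<Gamma>\<^esub> w)
    (\<lambda>h. inv\<^bsub>G\<^esub> g \<otimes>\<^bsub>G\<^esub> \<rho> (inv\<^bsub>\<Gamma>\<^esub> w \<otimes>\<^bsub>\<Gamma>\<^esub> h \<otimes>\<^bsub>\<Gamma>\<^esub> w) \<otimes>\<^bsub>G\<^esub> g) (ract P (lact P w x) g)"
    (is "frame \<Gamma> P ?H' ?\<rho>' ?y")
proof -
  interpret \<Gamma>: group \<Gamma> by (rule group_Gamma)
  interpret G: group G by (rule group_G)
  have x: "x \<in> total_space P" and H: "H = {u \<in> carrier \<Gamma>. proj P (lact P u x) = proj P x}"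
    and act: "\<And>h. h \<in> H \<Longrightarrow> lact P h x = ract P x (\<rho> h)"
    by (rule frameD[OF fr])+
  have z: "proj P x \<in> base_space P" by (rule proj_closed[OF x])
  have y: "?y \<in> total_space P" and py: "proj P ?y = bact P w (proj P x)"
    using x w g by (auto simp: ract_closed lact_closed proj_ract proj_equivariant)
  have inH: "h \<in> ?H' \<longleftrightarrow> h \<in> carrier \<Gamma> \<and> inv\<^bsub>\<Gamma>\<^esub> w \<otimes>\<^bsub>\<Gamma>\<^esub> h \<otimes>\<^bsub>\<Gamma>\<^esub> w \<in> H" for h
  proof
    assume "h \<in> ?H'"
    then obtain k where k: "k \<in> H" "h = w \<otimes>\<^bsub>\<Gamma>\<^esub> k \<otimes>\<^bsub>\<Gamma>\<^esub> inv\<^bsub>\<Gamma>\<^esub> w"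
      by (auto simp: l_coset_def r_coset_def)
    moreover have "k \<in> carrier \<Gamma>" using k H by blast
    ultimately show "h \<in> carrier \<Gamma> \<and> inv\<^bsub>\<Gamma>\<^esub> w \<otimes>\<^bsub>\<Gamma>\<^esub> h \<otimes>\<^bsub>\<Gamma>\<^esub> w \<in> H"
      using w by (simp add: \<Gamma>.m_assoc) (simp add: \<Gamma>.m_assoc[symmetric])
  next
    assume h: "h \<in> carrier \<Gamma> \<and> inv\<^bsub>\<Gamma>\<^esub> w \<otimes>\<^bsub>\<Gamma>\<^esub> h \<otimes>\<^bsub>\<Gamma>\<^esub> w \<in> H"
    then have "h = w \<otimes>\<^bsub>\<Gamma>\<^esub> (inv\<^bsub>\<Gamma>\<^esub> w \<otimes>\<^bsub>\<Gamma>\<^esub> h \<otimes>\<^bsub>\<Gamma>\<^esub> w) \<otimes>\<^bsub>\<Gamma>\<^esub> inv\<^bsub>\<Gamma>\<^esub> w"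
      using w by (simp add: \<Gamma>.m_assoc) (simp add: \<Gamma>.m_assoc[symmetric])
    then show "h \<in> ?H'" using h by (auto simp: l_coset_def r_coset_def)
  qed
  have "proj P (lact P h ?y) = proj P ?y \<longleftrightarrow> inv\<^bsub>\<Gamma>\<^esub> w \<otimes>\<^bsub>\<Gamma>\<^esub> h \<otimes>\<^bsub>\<Gamma>\<^esub> w \<in> H" if h: "h \<in> carrier \<Gamma>" for h
  proof -
    have "inv\<^bsub>\<Gamma>\<^esub> w \<otimes>\<^bsub>\<Gamma>\<^esub> h \<otimes>\<^bsub>\<Gamma>\<^esub> w \<in> H \<longleftrightarrow> bact P (inv\<^bsub>\<Gamma>\<^esub> w) (bact P h (bact P w (proj P x))) = proj P x"
      using h w x z by (simp add: H proj_equivariant bact_mult bact_closed)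
    also have "\<dots> \<longleftrightarrow> bact P h (bact P w (proj P x)) = bact P w (proj P x)"
      using h w z bact_mult[of "bact P h (bact P w (proj P x))" w "inv\<^bsub>\<Gamma>\<^esub> w"]
        bact_mult[of "proj P x" "inv\<^bsub>\<Gamma>\<^esub> w" w] bact_closed bact_one by auto
    finally show ?thesis
      using h w x g y by (simp add: proj_equivariant py)
  qed
  then have "?H' = {u \<in> carrier \<Gamma>. proj P (lact P u ?y) = proj P ?y}"
    using inH by blast
  moreover have "lact P h ?y = ract P ?y (?\<rho>' h)" if "h \<in> ?H'" for h
  proof -
    let ?k = "inv\<^bsub>\<Gamma>\<^esub> w \<otimes>\<^bsub>\<Gamma>\<^esub> h \<otimes>\<^bsub>\<Gamma>\<^esub> w"
    have h: "h \<in> carrier \<Gamma>" and k: "?k \<in> H" using that inH by blast+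
    have rk: "\<rho> ?k \<in> carrier G" by (rule \<rho>[OF k])
    have kc: "?k \<in> carrier \<Gamma>" using h w by simp
    have hw: "h \<otimes>\<^bsub>\<Gamma>\<^esub> w = w \<otimes>\<^bsub>\<Gamma>\<^esub> ?k"
      using h w by (simp add: \<Gamma>.m_assoc[symmetric])
    have "lact P h ?y = ract P (lact P (h \<otimes>\<^bsub>\<Gamma>\<^esub> w) x) g"
      using h w g x by (simp add: actions_commute lact_mult lact_closed)
    also have "\<dots> = ract P (lact P w (ract P x (\<rho> ?k))) g"
      using h w x by (simp only: hw lact_mult[OF x w kc] act[OF k])
    also have "\<dots> = ract P (lact P w x) (\<rho> ?k \<otimes>\<^bsub>G\<^esub> g)"
      using w g x rk by (simp add: actions_commute ract_mult lact_closed)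
    also have "\<rho> ?k \<otimes>\<^bsub>G\<^esub> g = g \<otimes>\<^bsub>G\<^esub> ?\<rho>' h"
      using g rk by (simp add: G.m_assoc[symmetric])
    also have "ract P (lact P w x) (g \<otimes>\<^bsub>G\<^esub> ?\<rho>' h) = ract P ?y (?\<rho>' h)"
      using w g x rk by (simp add: ract_mult lact_closed)
    finally show ?thesis .
  qed
  ultimately show ?thesis
    using y unfolding frame_def by blast
qed

lemma frame_unique:
  assumes "frame \<Gamma> P H \<rho> x" "frame \<Gamma> P H' \<rho>' x"
    and "\<And>h. h \<in> H \<Longrightarrow> \<rho> h \<in> carrier G" "\<And>h. h \<in> H \<Longrightarrow> \<rho>' h \<in> carrier G"
  shows "H' = H" and "h \<in> H \<Longrightarrow> \<rho>' h = \<rho> h"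
proof -
  show HH: "H' = H"
    by (rule trans[OF frameD(2)[OF assms(2)] frameD(2)[OF assms(1), symmetric]])
  show "\<rho>' h = \<rho> h" if h: "h \<in> H"
    using frameD(3)[OF assms(1) h] frameD(3)[OF assms(2), unfolded HH, OF h]
    by (intro ract_cancel[OF frameD(1)[OF assms(1)]] assms(3,4) h) simp
qed

text \<open>
  Two points lie in one fibre iff they differ by an element of \<open>G\<close>. An injective equivariant map
  preserves and reflects this relation, so it preserves isotropy groups of base points.
\<close>

lemma frame_transport:
  assumes Q: "equivariant_bundle \<Gamma> G Q" and fr: "frame \<Gamma> P H \<rho> x"
    and \<rho>: "\<And>h. h \<in> H \<Longrightarrow> \<rho> h \<in> carrier G"
    and closed: "\<And>y. y \<in> total_space P \<Longrightarrow> \<phi> y \<in> total_space Q"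
    and inj: "inj_on \<phi> (total_space P)"
    and lact: "\<And>y u. y \<in> total_space P \<Longrightarrow> u \<in> carrier \<Gamma> \<Longrightarrow> \<phi> (lact P u y) = lact Q u (\<phi> y)"
    and ract: "\<And>y g. y \<in> total_space P \<Longrightarrow> g \<in> carrier G \<Longrightarrow> \<phi> (ract P y g) = ract Q (\<phi> y) g"
  shows "frame \<Gamma> Q H \<rho> (\<phi> x)"
proof -
  have x: "x \<in> total_space P" and H: "H = {u \<in> carrier \<Gamma>. proj P (lact P u x) = proj P x}"
    and act: "\<And>h. h \<in> H \<Longrightarrow> lact P h x = ract P x (\<rho> h)"
    by (rule frameD[OF fr])+
  have "proj Q (\<phi> y) = proj Q (\<phi> y') \<longleftrightarrow> proj P y = proj P y'"
    if y: "y \<in> total_space P" "y' \<in> total_space P" for y y'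
  proof -
    have "\<phi> y' = ract Q (\<phi> y) g \<longleftrightarrow> y' = ract P y g" if "g \<in> carrier G" for g
      using y that inj_onD[OF inj, of y' "ract P y g"] by (auto simp: ract_closed simp flip: ract)
    then show ?thesis
      using equivariant_bundle.fibre_iff[OF Q, of "\<phi> y" "\<phi> y'"] fibre_iff[OF y] closed y by auto
  qed
  then have "H = {u \<in> carrier \<Gamma>. proj Q (lact Q u (\<phi> x)) = proj Q (\<phi> x)}"
    using x H by (auto simp: lact_closed simp flip: lact)
  moreover have "lact Q h (\<phi> x) = ract Q (\<phi> x) (\<rho> h)" if "h \<in> H" for h
    using act[OF that] that x \<rho> by (simp add: H lact[symmetric] ract[symmetric])
  ultimately show ?thesis
    using x closed by (simp add: frame_def)
qed

end

section \<open>Automorphisms of an induced bundle\<close>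

context group
begin

lemma conj_eq_iff:
  assumes "g \<in> carrier G" "a \<in> carrier G" "b \<in> carrier G"
  shows "inv g \<otimes> a \<otimes> g = b \<longleftrightarrow> a = g \<otimes> b \<otimes> inv g"
proof
  show "a = g \<otimes> b \<otimes> inv g" if "inv g \<otimes> a \<otimes> g = b"
    unfolding that[symmetric] using assms by (simp add: m_assoc) (simp add: m_assoc[symmetric])
  show "inv g \<otimes> a \<otimes> g = b" if "a = g \<otimes> b \<otimes> inv g"
    unfolding that using assms by (simp add: m_assoc) (simp add: m_assoc[symmetric])
qed

lemma conj_set_conj_set:
  assumes "u \<in> carrier G" "v \<in> carrier G" "H \<subseteq> carrier G"
  shows "(u <# ((v <# H) #> inv v)) #> inv u = ((u \<otimes> v) <# H) #> inv (u \<otimes> v)"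
  using assms
  by (simp add: coset_assoc[symmetric] lcos_m_assoc coset_mult_assoc inv_mult_group l_coset_subset_G
      r_coset_subset_G)

lemma normalizer_iff:
  "H \<subseteq> carrier G \<Longrightarrow> u \<in> normalizer G H \<longleftrightarrow> u \<in> carrier G \<and> (u <# H) #> inv u = H"
  by (auto simp: normalizer_def stabilizer_def)

lemma normalizer_conj_closed:
  assumes "H \<subseteq> carrier G" "u \<in> normalizer G H" "h \<in> H"
  shows "u \<otimes> h \<otimes> inv u \<in> H"
proof -
  have "u \<otimes> h \<otimes> inv u \<in> (u <# H) #> inv u"
    using assms(3) by (auto simp: l_coset_def r_coset_def)
  then show ?thesis using assms(2) normalizer_iff[OF assms(1)] by simp
qed

lemma normalizer_inv:
  assumes "H \<subseteq> carrier G" "u \<in> normalizer G H"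
  shows "inv u \<in> normalizer G H"
  using subgroup.m_inv_closed[OF normalizer_imp_subgroup[OF assms(1)] assms(2)] .

end

locale subgroup_hom = \<Gamma>: group \<Gamma> + G: group G + H: subgroup H \<Gamma>
  for \<Gamma> :: "'u monoid" and G :: "'g monoid" and H :: "'u set" +
  fixes \<rho> :: "'u \<Rightarrow> 'g"
  assumes hom: "\<rho> \<in> hom (\<Gamma>\<lparr>carrier := H\<rparr>) G"
begin

lemmas setting = \<Gamma>.is_group G.is_group H.subgroup_axioms hom

abbreviation P\<rho> where "P\<rho> \<equiv> ind_bundle \<Gamma> G H \<rho>"
abbreviation cls where "cls \<equiv> ind_class \<Gamma> G H \<rho>"
abbreviation Auts where "Auts \<equiv> bundle_Aut \<Gamma> G P\<rho>"
abbreviation twists where "twists \<equiv> twist_group \<Gamma> G H \<rho>"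
abbreviation twist where "twist \<equiv> twist_aut \<Gamma> G H \<rho>"

sublocale ind: equivariant_bundle \<Gamma> G P\<rho>
  by (rule equivariant_bundle_ind[OF setting])

lemmas hom_closed = \<rho>_closed[OF setting]
lemmas hom_mult = \<rho>_mult[OF setting]
lemmas hom_one = \<rho>_one[OF setting]
lemmas cls_eq_iff = ind_class_eq_iff[OF setting]
lemmas cls_simps = ind_bundle_class[OF setting]
lemmas twist_cls = twist_aut_class[OF setting]

lemma cls_closed: "v \<in> carrier \<Gamma> \<Longrightarrow> k \<in> carrier G \<Longrightarrow> cls v k \<in> total_space P\<rho>"
  by (auto simp: total_space_ind_bundle[OF setting])

lemma cls_cases:
  assumes "x \<in> total_space P\<rho>"
  obtains v k where "v \<in> carrier \<Gamma>" "k \<in> carrier G" "x = cls v k"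
  using assms by (auto simp: total_space_ind_bundle[OF setting])

lemma cls_from_one:
  "v \<in> carrier \<Gamma> \<Longrightarrow> k \<in> carrier G \<Longrightarrow> cls v k = ract P\<rho> (lact P\<rho> v (cls \<one>\<^bsub>\<Gamma>\<^esub> \<one>\<^bsub>G\<^esub>)) k"
  by (simp add: cls_simps)

lemma lcos_eq_iff:
  assumes "v \<in> carrier \<Gamma>" "w \<in> carrier \<Gamma>"
  shows "v <#\<^bsub>\<Gamma>\<^esub> H = w <#\<^bsub>\<Gamma>\<^esub> H \<longleftrightarrow> inv\<^bsub>\<Gamma>\<^esub> v \<otimes>\<^bsub>\<Gamma>\<^esub> w \<in> H"
proof
  assume "v <#\<^bsub>\<Gamma>\<^esub> H = w <#\<^bsub>\<Gamma>\<^esub> H"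
  then have "w \<in> v <#\<^bsub>\<Gamma>\<^esub> H"
    using \<Gamma>.lcos_self[OF assms(2) H.subgroup_axioms] by simp
  then obtain h where "h \<in> H" "w = v \<otimes>\<^bsub>\<Gamma>\<^esub> h" by (auto simp: l_coset_def)
  then show "inv\<^bsub>\<Gamma>\<^esub> v \<otimes>\<^bsub>\<Gamma>\<^esub> w \<in> H"
    using assms by (simp add: \<Gamma>.m_assoc[symmetric])
next
  assume "inv\<^bsub>\<Gamma>\<^esub> v \<otimes>\<^bsub>\<Gamma>\<^esub> w \<in> H"
  moreover have "w = v \<otimes>\<^bsub>\<Gamma>\<^esub> (inv\<^bsub>\<Gamma>\<^esub> v \<otimes>\<^bsub>\<Gamma>\<^esub> w)"
    using assms by (simp add: \<Gamma>.m_assoc[symmetric])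
  ultimately have "w \<in> v <#\<^bsub>\<Gamma>\<^esub> H" by (auto simp: l_coset_def)
  then show "v <#\<^bsub>\<Gamma>\<^esub> H = w <#\<^bsub>\<Gamma>\<^esub> H"
    by (rule \<Gamma>.l_repr_independence) (use assms H.subgroup_axioms in auto)
qed

lemma frame_one: "frame \<Gamma> P\<rho> H \<rho> (cls \<one>\<^bsub>\<Gamma>\<^esub> \<one>\<^bsub>G\<^esub>)"
proof -
  have "u <#\<^bsub>\<Gamma>\<^esub> H = \<one>\<^bsub>\<Gamma>\<^esub> <#\<^bsub>\<Gamma>\<^esub> H \<longleftrightarrow> u \<in> H" if "u \<in> carrier \<Gamma>" for u
    using that lcos_eq_iff[of "\<one>\<^bsub>\<Gamma>\<^esub>" u] by auto
  then have "u \<in> H \<longleftrightarrow> u \<in> carrier \<Gamma> \<and>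
      proj P\<rho> (lact P\<rho> u (cls \<one>\<^bsub>\<Gamma>\<^esub> \<one>\<^bsub>G\<^esub>)) = proj P\<rho> (cls \<one>\<^bsub>\<Gamma>\<^esub> \<one>\<^bsub>G\<^esub>)" for u
    using cls_simps(1)[of u "\<one>\<^bsub>G\<^esub>"] cls_simps(1)[of "\<one>\<^bsub>\<Gamma>\<^esub>" "\<one>\<^bsub>G\<^esub>"]
      cls_simps(3)[of "\<one>\<^bsub>\<Gamma>\<^esub>" "\<one>\<^bsub>G\<^esub>" u] H.mem_carrier[of u]
    by (cases "u \<in> carrier \<Gamma>") (simp, blast)
  then have "H = {u \<in> carrier \<Gamma>. proj P\<rho> (lact P\<rho> u (cls \<one>\<^bsub>\<Gamma>\<^esub> \<one>\<^bsub>G\<^esub>)) =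
      proj P\<rho> (cls \<one>\<^bsub>\<Gamma>\<^esub> \<one>\<^bsub>G\<^esub>)}"
    by blast
  moreover have "lact P\<rho> h (cls \<one>\<^bsub>\<Gamma>\<^esub> \<one>\<^bsub>G\<^esub>) = ract P\<rho> (cls \<one>\<^bsub>\<Gamma>\<^esub> \<one>\<^bsub>G\<^esub>) (\<rho> h)" if h: "h \<in> H" for h
  proof -
    have "cls \<one>\<^bsub>\<Gamma>\<^esub> (\<rho> h) = cls h \<one>\<^bsub>G\<^esub>"
      using h by (subst cls_eq_iff) (auto simp: hom_closed intro!: bexI[of _ h])
    then show ?thesis using h by (simp add: cls_simps hom_closed)
  qed
  ultimately show ?thesis
    unfolding frame_def using cls_closed by blast
qed

text \<open>
  The isomorphism is \<open>[v, k] \<mapsto> v x k\<close>. If \<open>v x k = v' x k'\<close>, projecting to the base shows that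
  \<open>h = v\<^sup>-\<^sup>1 v'\<close> lies in \<open>H\<close>, and freeness then gives \<open>k = \<rho>(h) k'\<close>; this is precisely the relation that
  defines the classes, so that the map is well defined and injective at the same time.
\<close>

lemma frame_iso:
  assumes Q: "equivariant_bundle \<Gamma> G Q" and fr: "frame \<Gamma> Q H \<rho> x"
  obtains \<psi> where "\<psi> \<in> bundle_iso \<Gamma> G P\<rho> (bundle_restrict Q (orbit \<Gamma> (bact Q) (proj Q x)))"
proof -
  interpret Q: equivariant_bundle \<Gamma> G Q by (rule Q)
  note x = frameD(1)[OF fr] and act = frameD(3)[OF fr]
  have inH: "u \<in> H \<longleftrightarrow> u \<in> carrier \<Gamma> \<and> proj Q (lact Q u x) = proj Q x" for u
    using arg_cong[OF frameD(2)[OF fr], of "\<lambda>S. u \<in> S"] by simp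
  let ?f = "\<lambda>v k. ract Q (lact Q v x) k"
  have f_shift: "?f (v \<otimes>\<^bsub>\<Gamma>\<^esub> h) k = ?f v (\<rho> h \<otimes>\<^bsub>G\<^esub> k)"
    if "v \<in> carrier \<Gamma>" "h \<in> H" "k \<in> carrier G" for v h k
    using that x by (simp add: Q.lact_mult act Q.actions_commute Q.ract_mult Q.lact_closed hom_closed)
  have key: "cls v k = cls v' k' \<longleftrightarrow> ?f v k = ?f v' k'"
    if vk: "v \<in> carrier \<Gamma>" "k \<in> carrier G" "v' \<in> carrier \<Gamma>" "k' \<in> carrier G" for v k v' k'
  proof
    assume "cls v k = cls v' k'"
    then obtain h where h: "h \<in> H" "v' = v \<otimes>\<^bsub>\<Gamma>\<^esub> h" "k' = inv\<^bsub>G\<^esub> (\<rho> h) \<otimes>\<^bsub>G\<^esub> k"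
      using cls_eq_iff[OF vk] by blast
    have "\<rho> h \<otimes>\<^bsub>G\<^esub> k' = k"
      using h vk by (simp add: hom_closed G.m_assoc[symmetric])
    then show "?f v k = ?f v' k'" using f_shift[OF vk(1) h(1) vk(4)] h(2) by simp
  next
    assume eq: "?f v k = ?f v' k'"
    let ?h = "inv\<^bsub>\<Gamma>\<^esub> v \<otimes>\<^bsub>\<Gamma>\<^esub> v'"
    have "proj Q (lact Q v x) = proj Q (lact Q v' x)"
      using arg_cong[OF eq, of "proj Q"] vk x by (simp add: Q.proj_ract Q.lact_closed)
    then have "bact Q v (proj Q x) = bact Q v' (proj Q x)"
      using vk x by (simp add: Q.proj_equivariant)
    then have "bact Q (inv\<^bsub>\<Gamma>\<^esub> v) (bact Q v (proj Q x)) = bact Q (inv\<^bsub>\<Gamma>\<^esub> v) (bact Q v' (proj Q x))"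
      by simp
    then have "proj Q (lact Q ?h x) = proj Q x"
      using vk x by (simp add: Q.proj_equivariant Q.bact_one Q.proj_closed flip: Q.bact_mult)
    then have h: "?h \<in> H" using vk by (simp add: inH)
    have v': "v' = v \<otimes>\<^bsub>\<Gamma>\<^esub> ?h" using vk by (simp add: \<Gamma>.m_assoc[symmetric])
    have "?f v k = ?f v (\<rho> ?h \<otimes>\<^bsub>G\<^esub> k')"
      using eq f_shift[OF vk(1) h vk(4)] v' by simp
    then have "k = \<rho> ?h \<otimes>\<^bsub>G\<^esub> k'"
      using vk x hom_closed[OF h] by (intro Q.ract_cancel[of "lact Q v x"]) (auto simp: Q.lact_closed)
    then have "k' = inv\<^bsub>G\<^esub> (\<rho> ?h) \<otimes>\<^bsub>G\<^esub> k"
      using vk hom_closed[OF h] by (simp add: G.m_assoc[symmetric])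
    then show "cls v k = cls v' k'"
      using cls_eq_iff[OF vk] h v' by blast
  qed
  \<comment> \<open>the value on a class, computed from an arbitrary representative\<close>
  define \<psi> where "\<psi> C = (case SOME p. p \<in> carrier \<Gamma> \<times> carrier G \<and> C = cls (fst p) (snd p) of (v, k) \<Rightarrow> ?f v k)" for C
  have \<psi>: "\<psi> (cls v k) = ?f v k" if vk: "v \<in> carrier \<Gamma>" "k \<in> carrier G" for v k
  proof -
    let ?S = "\<lambda>p. p \<in> carrier \<Gamma> \<times> carrier G \<and> cls v k = cls (fst p) (snd p)"
    have "?S (SOME p. ?S p)" by (rule someI[of ?S "(v, k)"]) (use vk in simp)
    then show ?thesis
      using key[OF vk] unfolding \<psi>_def by (auto simp: case_prod_beta mem_Times_iff)
  qed
  let ?C = "bundle_restrict Q (orbit \<Gamma> (bact Q) (proj Q x))"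
  have "inj_on \<psi> (total_space P\<rho>)"
    by (rule inj_onI, elim cls_cases) (simp add: \<psi> key)
  moreover have "\<psi> ` total_space P\<rho> = total_space ?C"
  proof
    show "\<psi> ` total_space P\<rho> \<subseteq> total_space ?C"
      using x by (auto elim!: cls_cases simp: \<psi> bundle_restrict_def orbit_def Q.ract_closed Q.lact_closed
          Q.proj_ract Q.proj_equivariant)
    show "total_space ?C \<subseteq> \<psi> ` total_space P\<rho>"
    proof
      fix y assume "y \<in> total_space ?C"
      then obtain u where y: "y \<in> total_space Q" and u: "u \<in> carrier \<Gamma>" "proj Q y = bact Q u (proj Q x)"
        by (auto simp: bundle_restrict_def orbit_def)
      then have "proj Q (lact Q u x) = proj Q y" using x by (simp add: Q.proj_equivariant)
      then obtain g where "g \<in> carrier G" "y = ?f u g"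
        using Q.fibre_iff[of "lact Q u x" y] x u y by (auto simp: Q.lact_closed)
      then show "y \<in> \<psi> ` total_space P\<rho>"
        using u cls_closed \<psi> by (intro image_eqI[of _ _ "cls u g"]) auto
    qed
  qed
  moreover have "\<psi> (lact P\<rho> u y) = lact ?C u (\<psi> y)"
    if "y \<in> total_space P\<rho>" "u \<in> carrier \<Gamma>" for y u
    using that x by (auto elim!: cls_cases simp: cls_simps \<psi> bundle_restrict_def Q.lact_mult
        Q.actions_commute Q.lact_closed)
  moreover have "\<psi> (ract P\<rho> y g) = ract ?C (\<psi> y) g"
    if "y \<in> total_space P\<rho>" "g \<in> carrier G" for y g
    using that x by (auto elim!: cls_cases simp: cls_simps \<psi> bundle_restrict_def Q.ract_mult Q.lact_closed)
  ultimately show thesis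
    by (intro that[of \<psi>]) (simp add: bundle_iso_def bij_betw_def)
qed

text \<open>
  The point \<open>[u\<^sup>-\<^sup>1, g] = u\<^sup>-\<^sup>1 [1, 1] g\<close> is a frame for the conjugate of \<open>(H, \<rho>)\<close> by \<open>(u\<^sup>-\<^sup>1, g)\<close>, and the
  elements of \<open>T\<^sub>\<rho>\<close> are those for which this conjugate is \<open>(H, \<rho>)\<close> itself. Since an automorphism is
  determined by the image of \<open>[1, 1]\<close>, the surjectivity of \<open>T\<^sub>\<rho> \<rightarrow> Aut(P\<^sub>\<rho>)\<close> becomes a statement on frames.
\<close>

lemma twists_iff_frame:
  "(u, g) \<in> carrier twists \<longleftrightarrow>
    u \<in> carrier \<Gamma> \<and> g \<in> carrier G \<and> frame \<Gamma> P\<rho> H \<rho> (cls (inv\<^bsub>\<Gamma>\<^esub> u) g)"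
proof (cases "u \<in> carrier \<Gamma> \<and> g \<in> carrier G")
  case True
  then have u: "u \<in> carrier \<Gamma>" and g: "g \<in> carrier G" by auto
  \<comment> \<open>the type of the frame \<open>[u\<^sup>-\<^sup>1, g]\<close>, as \<open>frame_move\<close> computes it\<close>
  let ?\<rho>' = "\<lambda>h. inv\<^bsub>G\<^esub> g \<otimes>\<^bsub>G\<^esub> \<rho> (u \<otimes>\<^bsub>\<Gamma>\<^esub> h \<otimes>\<^bsub>\<Gamma>\<^esub> inv\<^bsub>\<Gamma>\<^esub> u) \<otimes>\<^bsub>G\<^esub> g"
  let ?H' = "(inv\<^bsub>\<Gamma>\<^esub> u <#\<^bsub>\<Gamma>\<^esub> H) #>\<^bsub>\<Gamma>\<^esub> inv\<^bsub>\<Gamma>\<^esub> (inv\<^bsub>\<Gamma>\<^esub> u)"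
  have fr: "frame \<Gamma> P\<rho> ?H' ?\<rho>' (cls (inv\<^bsub>\<Gamma>\<^esub> u) g)"
    using ind.frame_move[OF frame_one hom_closed, of "inv\<^bsub>\<Gamma>\<^esub> u" g] u g
    by (simp add: cls_from_one[symmetric])
  have N: "u \<in> normalizer \<Gamma> H \<longleftrightarrow> ?H' = H"
    using u \<Gamma>.normalizer_inv[OF H.subset, of u] \<Gamma>.normalizer_inv[OF H.subset, of "inv\<^bsub>\<Gamma>\<^esub> u"]
    by (auto simp: \<Gamma>.normalizer_iff[OF H.subset])
  show ?thesis
  proof
    assume "(u, g) \<in> carrier twists"
    then have "u \<in> normalizer \<Gamma> H" and \<rho>': "\<And>h. h \<in> H \<Longrightarrow> ?\<rho>' h = \<rho> h"
      by (auto simp: twist_group_def)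
    then have "frame \<Gamma> P\<rho> H ?\<rho>' (cls (inv\<^bsub>\<Gamma>\<^esub> u) g)" using fr N by simp
    then have "frame \<Gamma> P\<rho> H \<rho> (cls (inv\<^bsub>\<Gamma>\<^esub> u) g)"
      using \<rho>' unfolding frame_def by simp
    then show "u \<in> carrier \<Gamma> \<and> g \<in> carrier G \<and> frame \<Gamma> P\<rho> H \<rho> (cls (inv\<^bsub>\<Gamma>\<^esub> u) g)"
      using u g by blast
  next
    assume a: "u \<in> carrier \<Gamma> \<and> g \<in> carrier G \<and> frame \<Gamma> P\<rho> H \<rho> (cls (inv\<^bsub>\<Gamma>\<^esub> u) g)"
    then have f: "frame \<Gamma> P\<rho> H \<rho> (cls (inv\<^bsub>\<Gamma>\<^esub> u) g)" by blast
    have HH: "?H' = H"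
      by (rule trans[OF frameD(2)[OF fr] frameD(2)[OF f, symmetric]])
    then have uN: "u \<in> normalizer \<Gamma> H" using N by blast
    have "?\<rho>' h = \<rho> h" if h: "h \<in> H" for h
      using ind.frame_unique(2)[OF f fr[unfolded HH] hom_closed _ h] u g
        hom_closed \<Gamma>.normalizer_conj_closed[OF H.subset uN] by auto
    then show "(u, g) \<in> carrier twists"
      using uN g by (auto simp: twist_group_def)
  qed
next
  case False
  then show ?thesis
    by (auto simp: twist_group_def \<Gamma>.normalizer_iff[OF H.subset])
qed

text \<open>
  The second form of the defining condition, which separates the two coordinates and makes the
  group laws of \<open>T\<^sub>\<rho>\<close> a computation.
\<close>

lemma twists_iff:
  "(u, g) \<in> carrier twists \<longleftrightarrow> u \<in> normalizer \<Gamma> H \<and> g \<in> carrier G \<and>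
    (\<forall>h\<in>H. \<rho> (u \<otimes>\<^bsub>\<Gamma>\<^esub> h \<otimes>\<^bsub>\<Gamma>\<^esub> inv\<^bsub>\<Gamma>\<^esub> u) = g \<otimes>\<^bsub>G\<^esub> \<rho> h \<otimes>\<^bsub>G\<^esub> inv\<^bsub>G\<^esub> g)"
proof -
  have "inv\<^bsub>G\<^esub> g \<otimes>\<^bsub>G\<^esub> \<rho> (u \<otimes>\<^bsub>\<Gamma>\<^esub> h \<otimes>\<^bsub>\<Gamma>\<^esub> inv\<^bsub>\<Gamma>\<^esub> u) \<otimes>\<^bsub>G\<^esub> g = \<rho> h \<longleftrightarrow>
      \<rho> (u \<otimes>\<^bsub>\<Gamma>\<^esub> h \<otimes>\<^bsub>\<Gamma>\<^esub> inv\<^bsub>\<Gamma>\<^esub> u) = g \<otimes>\<^bsub>G\<^esub> \<rho> h \<otimes>\<^bsub>G\<^esub> inv\<^bsub>G\<^esub> g"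
    if "u \<in> normalizer \<Gamma> H" "g \<in> carrier G" "h \<in> H" for h
    using that hom_closed \<Gamma>.normalizer_conj_closed[OF H.subset] by (intro G.conj_eq_iff) auto
  then show ?thesis by (auto simp: twist_group_def)
qed

lemma twists_carrier: "(u, g) \<in> carrier twists \<Longrightarrow> u \<in> carrier \<Gamma> \<and> g \<in> carrier G"
  by (simp add: twists_iff_frame)

lemma subgroup_twists: "subgroup (carrier twists) (\<Gamma> \<times>\<times> G)"
proof (rule group.subgroupI[OF DirProd_group[OF \<Gamma>.is_group G.is_group]])
  note N = \<Gamma>.normalizer_imp_subgroup[OF H.subset]
  note Nc = \<Gamma>.normalizer_conj_closed[OF H.subset]
  show "carrier twists \<subseteq> carrier (\<Gamma> \<times>\<times> G)"
    using twists_carrier by auto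
  have "(\<one>\<^bsub>\<Gamma>\<^esub>, \<one>\<^bsub>G\<^esub>) \<in> carrier twists"
    using frame_one by (simp add: twists_iff_frame)
  then show "carrier twists \<noteq> {}" by blast
  show "inv\<^bsub>\<Gamma> \<times>\<times> G\<^esub> a \<in> carrier twists" if a: "a \<in> carrier twists" for a
  proof -
    obtain u g where e: "a = (u, g)" by fastforce
    then have u: "u \<in> carrier \<Gamma>" "u \<in> normalizer \<Gamma> H" and g: "g \<in> carrier G"
      and \<rho>: "\<And>h. h \<in> H \<Longrightarrow> \<rho> (u \<otimes>\<^bsub>\<Gamma>\<^esub> h \<otimes>\<^bsub>\<Gamma>\<^esub> inv\<^bsub>\<Gamma>\<^esub> u) = g \<otimes>\<^bsub>G\<^esub> \<rho> h \<otimes>\<^bsub>G\<^esub> inv\<^bsub>G\<^esub> g"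
      using a twists_carrier twists_iff by auto
    have iu: "inv\<^bsub>\<Gamma>\<^esub> u \<in> normalizer \<Gamma> H" by (rule \<Gamma>.normalizer_inv[OF H.subset u(2)])
    have "\<rho> (inv\<^bsub>\<Gamma>\<^esub> u \<otimes>\<^bsub>\<Gamma>\<^esub> h \<otimes>\<^bsub>\<Gamma>\<^esub> u) = inv\<^bsub>G\<^esub> g \<otimes>\<^bsub>G\<^esub> \<rho> h \<otimes>\<^bsub>G\<^esub> g" if h: "h \<in> H" for h
    proof -
      let ?k = "inv\<^bsub>\<Gamma>\<^esub> u \<otimes>\<^bsub>\<Gamma>\<^esub> h \<otimes>\<^bsub>\<Gamma>\<^esub> u"
      have k: "?k \<in> H" using Nc[OF iu h] u by simp
      have "u \<otimes>\<^bsub>\<Gamma>\<^esub> ?k \<otimes>\<^bsub>\<Gamma>\<^esub> inv\<^bsub>\<Gamma>\<^esub> u = h"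
        using u h by (simp add: \<Gamma>.m_assoc) (simp add: \<Gamma>.m_assoc[symmetric])
      then have "\<rho> h = g \<otimes>\<^bsub>G\<^esub> \<rho> ?k \<otimes>\<^bsub>G\<^esub> inv\<^bsub>G\<^esub> g" using \<rho>[OF k] by simp
      then show ?thesis using G.conj_eq_iff[OF g hom_closed[OF h] hom_closed[OF k]] by simp
    qed
    then show ?thesis
      using iu u g by (simp add: e twists_iff inv_DirProd \<Gamma>.is_group G.is_group)
  qed
  show "a \<otimes>\<^bsub>\<Gamma> \<times>\<times> G\<^esub> b \<in> carrier twists" if a: "a \<in> carrier twists" and b: "b \<in> carrier twists" for a b
  proof -
    obtain u g where ea: "a = (u, g)" by fastforce
    then have u: "u \<in> carrier \<Gamma>" "u \<in> normalizer \<Gamma> H" and g: "g \<in> carrier G"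
      and \<rho>: "\<And>h. h \<in> H \<Longrightarrow> \<rho> (u \<otimes>\<^bsub>\<Gamma>\<^esub> h \<otimes>\<^bsub>\<Gamma>\<^esub> inv\<^bsub>\<Gamma>\<^esub> u) = g \<otimes>\<^bsub>G\<^esub> \<rho> h \<otimes>\<^bsub>G\<^esub> inv\<^bsub>G\<^esub> g"
      using a twists_carrier twists_iff by auto
    obtain v k where eb: "b = (v, k)" by fastforce
    then have v: "v \<in> carrier \<Gamma>" "v \<in> normalizer \<Gamma> H" and k: "k \<in> carrier G"
      and \<sigma>: "\<And>h. h \<in> H \<Longrightarrow> \<rho> (v \<otimes>\<^bsub>\<Gamma>\<^esub> h \<otimes>\<^bsub>\<Gamma>\<^esub> inv\<^bsub>\<Gamma>\<^esub> v) = k \<otimes>\<^bsub>G\<^esub> \<rho> h \<otimes>\<^bsub>G\<^esub> inv\<^bsub>G\<^esub> k"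
      using b twists_carrier twists_iff by auto
    have "\<rho> (u \<otimes>\<^bsub>\<Gamma>\<^esub> v \<otimes>\<^bsub>\<Gamma>\<^esub> h \<otimes>\<^bsub>\<Gamma>\<^esub> inv\<^bsub>\<Gamma>\<^esub> (u \<otimes>\<^bsub>\<Gamma>\<^esub> v)) =
        g \<otimes>\<^bsub>G\<^esub> k \<otimes>\<^bsub>G\<^esub> \<rho> h \<otimes>\<^bsub>G\<^esub> inv\<^bsub>G\<^esub> (g \<otimes>\<^bsub>G\<^esub> k)" if h: "h \<in> H" for h
    proof -
      have "u \<otimes>\<^bsub>\<Gamma>\<^esub> v \<otimes>\<^bsub>\<Gamma>\<^esub> h \<otimes>\<^bsub>\<Gamma>\<^esub> inv\<^bsub>\<Gamma>\<^esub> (u \<otimes>\<^bsub>\<Gamma>\<^esub> v) =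
          u \<otimes>\<^bsub>\<Gamma>\<^esub> (v \<otimes>\<^bsub>\<Gamma>\<^esub> h \<otimes>\<^bsub>\<Gamma>\<^esub> inv\<^bsub>\<Gamma>\<^esub> v) \<otimes>\<^bsub>\<Gamma>\<^esub> inv\<^bsub>\<Gamma>\<^esub> u"
        using u v h by (simp add: \<Gamma>.inv_mult_group \<Gamma>.m_assoc)
      then show ?thesis
        using \<rho>[OF Nc[OF v(2) h]] \<sigma>[OF h] g k hom_closed[OF h] by (simp add: G.inv_mult_group G.m_assoc)
    qed
    then show ?thesis
      using subgroup.m_closed[OF N u(2) v(2)] g k by (simp add: ea eb twists_iff)
  qed
qed

lemma twists_eq: "twists = (\<Gamma> \<times>\<times> G)\<lparr>carrier := carrier twists\<rparr>"
  by (simp add: twist_group_def)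

lemma group_twists: "group twists"
  using subgroup.subgroup_is_group[OF subgroup_twists DirProd_group[OF \<Gamma>.is_group G.is_group]]
  by (subst twists_eq)

lemma mult_twists: "(u, g) \<otimes>\<^bsub>twists\<^esub> (v, k) = (u \<otimes>\<^bsub>\<Gamma>\<^esub> v, g \<otimes>\<^bsub>G\<^esub> k)"
  by (simp add: twist_group_def)

lemma twist_closed: "p \<in> carrier twists \<Longrightarrow> x \<in> total_space P\<rho> \<Longrightarrow> twist p x \<in> total_space P\<rho>"
  by (cases p) (auto elim!: cls_cases simp: twist_cls cls_closed twists_carrier)

lemma twist_mult:
  assumes "p \<in> carrier twists" "q \<in> carrier twists" "x \<in> total_space P\<rho>"
  shows "twist (p \<otimes>\<^bsub>twists\<^esub> q) x = twist p (twist q x)"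
proof -
  obtain u g w l where e: "p = (u, g)" "q = (w, l)" by fastforce
  have pq: "(u \<otimes>\<^bsub>\<Gamma>\<^esub> w, g \<otimes>\<^bsub>G\<^esub> l) \<in> carrier twists"
    using monoid.m_closed[OF group.is_monoid[OF group_twists] assms(1,2)] by (simp add: e mult_twists)
  obtain v k where vk: "v \<in> carrier \<Gamma>" "k \<in> carrier G" "x = cls v k"
    using assms(3) by (rule cls_cases)
  show ?thesis
    using assms(1,2) pq vk twists_carrier[of u g] twists_carrier[of w l]
    by (simp add: e mult_twists twist_cls \<Gamma>.inv_mult_group \<Gamma>.m_assoc G.m_assoc)
qed

lemma twist_one: "x \<in> total_space P\<rho> \<Longrightarrow> twist \<one>\<^bsub>twists\<^esub> x = x"
proof (erule cls_cases)
  fix v k assume "v \<in> carrier \<Gamma>" "k \<in> carrier G" "x = cls v k"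
  then show ?thesis
    using twist_cls[of "\<one>\<^bsub>\<Gamma>\<^esub>" "\<one>\<^bsub>G\<^esub>" v k] monoid.one_closed[OF group.is_monoid[OF group_twists]]
    by (simp add: twist_group_def)
qed

lemma twist_in_Auts:
  assumes p: "p \<in> carrier twists"
  shows "twist p \<in> carrier Auts"
proof -
  obtain u g where e: "p = (u, g)" by fastforce
  let ?q = "inv\<^bsub>twists\<^esub> p"
  have q: "?q \<in> carrier twists" by (rule group.inv_closed[OF group_twists p])
  have inv: "twist ?q (twist p x) = x" "twist p (twist ?q x) = x" if "x \<in> total_space P\<rho>" for x
    using twist_mult[OF q p that] twist_mult[OF p q that]
    unfolding group.l_inv[OF group_twists p] group.r_inv[OF group_twists p] twist_one[OF that] by simp_all
  have "bij_betw (twist p) (total_space P\<rho>) (total_space P\<rho>)"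
    by (rule bij_betw_byWitness[where f' = "twist ?q"])
      (use inv in \<open>blast intro: twist_closed p q\<close>)+
  moreover have "twist p (lact P\<rho> w x) = lact P\<rho> w (twist p x)"
    if "x \<in> total_space P\<rho>" "w \<in> carrier \<Gamma>" for x w
    using that p twists_carrier[of u g]
    by (auto elim!: cls_cases simp: e cls_simps twist_cls \<Gamma>.m_assoc)
  moreover have "twist p (ract P\<rho> x k) = ract P\<rho> (twist p x) k"
    if "x \<in> total_space P\<rho>" "k \<in> carrier G" for x k
    using that p twists_carrier[of u g]
    by (auto elim!: cls_cases simp: e cls_simps twist_cls G.m_assoc)
  moreover have "twist p \<in> extensional (total_space P\<rho>)"
    by (simp add: e twist_aut_def)
  ultimately show ?thesis
    by (simp add: carrier_bundle_Aut bundle_iso_def)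
qed

lemma twist_hom: "twist \<in> hom twists Auts"
proof (rule homI)
  show "twist p \<in> carrier Auts" if "p \<in> carrier twists" for p
    by (rule twist_in_Auts[OF that])
  fix p q assume p: "p \<in> carrier twists" and q: "q \<in> carrier twists"
  have pq: "p \<otimes>\<^bsub>twists\<^esub> q \<in> carrier twists"
    by (rule monoid.m_closed[OF group.is_monoid[OF group_twists] p q])
  show "twist (p \<otimes>\<^bsub>twists\<^esub> q) = twist p \<otimes>\<^bsub>Auts\<^esub> twist q"
    unfolding mult_bundle_Aut[OF twist_in_Auts[OF p] twist_in_Auts[OF q]]
    by (rule extensionalityI[of _ "total_space P\<rho>"])
      (use twist_in_Auts[OF pq] in \<open>auto simp: carrier_bundle_Aut twist_mult p q\<close>)
qed

text \<open>
  Every point of \<open>P\<^sub>\<rho>\<close> is \<open>[v, k] = v [1, 1] k\<close>.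
\<close>

lemma Auts_determined:
  assumes "\<phi> \<in> carrier Auts" "\<chi> \<in> carrier Auts" "\<phi> (cls \<one>\<^bsub>\<Gamma>\<^esub> \<one>\<^bsub>G\<^esub>) = \<chi> (cls \<one>\<^bsub>\<Gamma>\<^esub> \<one>\<^bsub>G\<^esub>)"
  shows "\<phi> = \<chi>"
proof (rule extensionalityI[of _ "total_space P\<rho>"])
  show "\<phi> \<in> extensional (total_space P\<rho>)" "\<chi> \<in> extensional (total_space P\<rho>)"
    using assms by (auto simp: carrier_bundle_Aut)
  have eq: "\<alpha> (cls v k) = ract P\<rho> (lact P\<rho> v (\<alpha> (cls \<one>\<^bsub>\<Gamma>\<^esub> \<one>\<^bsub>G\<^esub>))) k"
    if "\<alpha> \<in> carrier Auts" "v \<in> carrier \<Gamma>" "k \<in> carrier G" for \<alpha> v k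
    unfolding cls_from_one[OF that(2,3)]
    using that by (simp add: bundle_isoD(3,4)[of \<alpha> \<Gamma> G P\<rho> P\<rho>] carrier_bundle_Aut ind.lact_closed cls_closed)
  show "\<phi> x = \<chi> x" if "x \<in> total_space P\<rho>" for x
    using that
  proof (rule cls_cases)
    fix v k assume vk: "v \<in> carrier \<Gamma>" "k \<in> carrier G" and x: "x = cls v k"
    show ?thesis unfolding x eq[OF assms(1) vk] eq[OF assms(2) vk] assms(3) ..
  qed
qed

text \<open>
  An automorphism sends the frame \<open>[1, 1]\<close> to a frame \<open>[w, g]\<close> of the same type, so \<open>(w\<^sup>-\<^sup>1, g)\<close> is in
  \<open>T\<^sub>\<rho>\<close> and induces an automorphism with the same value at \<open>[1, 1]\<close>.
\<close>

lemma twist_surj: "twist ` carrier twists = carrier Auts"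
proof
  show "twist ` carrier twists \<subseteq> carrier Auts" using twist_in_Auts by blast
  show "carrier Auts \<subseteq> twist ` carrier twists"
  proof
    fix \<phi> assume \<phi>: "\<phi> \<in> carrier Auts"
    then have iso: "\<phi> \<in> bundle_iso \<Gamma> G P\<rho> P\<rho>" by (simp add: carrier_bundle_Aut)
    let ?x = "cls \<one>\<^bsub>\<Gamma>\<^esub> \<one>\<^bsub>G\<^esub>"
    obtain w g where wg: "w \<in> carrier \<Gamma>" "g \<in> carrier G" "\<phi> ?x = cls w g"
      using bundle_isoD(2)[OF iso, of ?x] by (auto simp: cls_closed elim: cls_cases)
    have "frame \<Gamma> P\<rho> H \<rho> (\<phi> ?x)"
      by (rule ind.frame_transport[OF ind.equivariant_bundle_axioms frame_one])
        (use bundle_isoD[OF iso] in \<open>auto simp: hom_closed bij_betw_def\<close>)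
    then have T: "(inv\<^bsub>\<Gamma>\<^esub> w, g) \<in> carrier twists"
      using wg by (simp add: twists_iff_frame)
    have "\<phi> = twist (inv\<^bsub>\<Gamma>\<^esub> w, g)"
      by (rule Auts_determined[OF \<phi> twist_in_Auts[OF T]]) (use wg T in \<open>simp add: twist_cls\<close>)
    then show "\<phi> \<in> twist ` carrier twists" using T by blast
  qed
qed

end

section \<open>The two exact sequences\<close>

context subgroup_hom
begin

text \<open>
  It is enough to look at \<open>[1, 1]\<close>, which goes to \<open>[u\<^sup>-\<^sup>1, g]\<close>; the two classes agree iff
  \<open>u \<in> H\<close> and \<open>g = \<rho>(u)\<close>.
\<close>

lemma twist_eq_one_iff:
  assumes "(u, g) \<in> carrier twists"
  shows "twist (u, g) = \<one>\<^bsub>Auts\<^esub> \<longleftrightarrow> u \<in> H \<and> g = \<rho> u"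
proof -
  have ug: "u \<in> carrier \<Gamma>" "g \<in> carrier G" using twists_carrier[OF assms] by auto
  have "twist (u, g) = \<one>\<^bsub>Auts\<^esub> \<longleftrightarrow> twist (u, g) (cls \<one>\<^bsub>\<Gamma>\<^esub> \<one>\<^bsub>G\<^esub>) = cls \<one>\<^bsub>\<Gamma>\<^esub> \<one>\<^bsub>G\<^esub>"
    using Auts_determined[OF twist_in_Auts[OF assms] monoid.one_closed[OF group.is_monoid[OF ind.group_bundle_Aut]]]
    by (auto simp: one_bundle_Aut cls_closed)
  also have "\<dots> \<longleftrightarrow> cls (inv\<^bsub>\<Gamma>\<^esub> u) g = cls \<one>\<^bsub>\<Gamma>\<^esub> \<one>\<^bsub>G\<^esub>"
    using ug by (simp add: twist_cls[OF assms])
  also have "\<dots> \<longleftrightarrow> (\<exists>h\<in>H. \<one>\<^bsub>\<Gamma>\<^esub> = inv\<^bsub>\<Gamma>\<^esub> u \<otimes>\<^bsub>\<Gamma>\<^esub> h \<and> \<one>\<^bsub>G\<^esub> = inv\<^bsub>G\<^esub> (\<rho> h) \<otimes>\<^bsub>G\<^esub> g)"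
    using ug by (intro cls_eq_iff) auto
  also have "\<dots> \<longleftrightarrow> (\<exists>h\<in>H. h = u \<and> g = \<rho> h)"
  proof (rule bex_cong[OF refl])
    fix h assume h: "h \<in> H"
    have "\<one>\<^bsub>\<Gamma>\<^esub> = inv\<^bsub>\<Gamma>\<^esub> u \<otimes>\<^bsub>\<Gamma>\<^esub> h \<longleftrightarrow> h = u"
      using \<Gamma>.inv_solve_left[of "\<one>\<^bsub>\<Gamma>\<^esub>" u h] ug h by auto
    moreover have "\<one>\<^bsub>G\<^esub> = inv\<^bsub>G\<^esub> (\<rho> h) \<otimes>\<^bsub>G\<^esub> g \<longleftrightarrow> g = \<rho> h"
      using G.inv_solve_left[of "\<one>\<^bsub>G\<^esub>" "\<rho> h" g] ug hom_closed[OF h] by auto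
    ultimately show "(\<one>\<^bsub>\<Gamma>\<^esub> = inv\<^bsub>\<Gamma>\<^esub> u \<otimes>\<^bsub>\<Gamma>\<^esub> h \<and> \<one>\<^bsub>G\<^esub> = inv\<^bsub>G\<^esub> (\<rho> h) \<otimes>\<^bsub>G\<^esub> g) \<longleftrightarrow> (h = u \<and> g = \<rho> h)"
      by blast
  qed
  finally show ?thesis by blast
qed

lemma graph_in_twists: "h \<in> H \<Longrightarrow> (h, \<rho> h) \<in> carrier twists"
proof -
  assume h: "h \<in> H"
  have N: "h \<in> normalizer \<Gamma> H"
    using subgroup.subset[OF normal.axioms(1)[OF \<Gamma>.subgroup_in_normalizer[OF H.subgroup_axioms]]] h by auto
  have "\<rho> (h \<otimes>\<^bsub>\<Gamma>\<^esub> k \<otimes>\<^bsub>\<Gamma>\<^esub> inv\<^bsub>\<Gamma>\<^esub> h) = \<rho> h \<otimes>\<^bsub>G\<^esub> \<rho> k \<otimes>\<^bsub>G\<^esub> inv\<^bsub>G\<^esub> (\<rho> h)" if "k \<in> H" for k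
    using h that by (simp add: hom_mult \<rho>_inv[OF setting])
  then show ?thesis using N h hom_closed by (simp add: twists_iff)
qed

theorem exact_twists:
  "short_exact (\<Gamma>\<lparr>carrier := H\<rparr>) twists Auts (\<lambda>h. (h, \<rho> h)) twist"
  unfolding short_exact_def
proof (intro conjI)
  show "group (\<Gamma>\<lparr>carrier := H\<rparr>)" by (rule H.subgroup_is_group[OF \<Gamma>.is_group])
  show "group twists" by (rule group_twists)
  show "group Auts" by (rule ind.group_bundle_Aut)
  show "(\<lambda>h. (h, \<rho> h)) \<in> mon (\<Gamma>\<lparr>carrier := H\<rparr>) twists"
    by (simp add: mon_def hom_def graph_in_twists mult_twists hom_mult inj_on_def)
  show "twist \<in> epi twists Auts"
    using twist_hom twist_surj by (simp add: epi_def)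
  show "(\<lambda>h. (h, \<rho> h)) ` carrier (\<Gamma>\<lparr>carrier := H\<rparr>) = kernel twists Auts twist"
  proof -
    have "p \<in> kernel twists Auts twist \<longleftrightarrow> fst p \<in> H \<and> snd p = \<rho> (fst p)" for p
      using graph_in_twists[of "fst p"] twist_eq_one_iff[of "fst p" "snd p"]
      by (cases p) (fastforce simp: kernel_def)
    then show ?thesis by (force simp: image_iff)
  qed
qed

lemma hom_normalizer_eq: "hom_normalizer \<Gamma> G H \<rho> = fst ` carrier twists"
proof (rule Set.set_eqI)
  fix u
  have "u \<in> hom_normalizer \<Gamma> G H \<rho> \<longleftrightarrow> (\<exists>g. (u, g) \<in> carrier twists)"
    unfolding hom_normalizer_def twists_iff by blast
  then show "u \<in> hom_normalizer \<Gamma> G H \<rho> \<longleftrightarrow> u \<in> fst ` carrier twists"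
    by force
qed

lemma subgroup_hom_normalizer: "subgroup (hom_normalizer \<Gamma> G H \<rho>) \<Gamma>"
proof -
  have "fst \<in> hom twists \<Gamma>"
    by (auto simp: hom_def twists_carrier mult_twists)
  then interpret f: group_hom twists \<Gamma> fst
    using group_twists \<Gamma>.is_group by (simp add: group_hom_def group_hom_axioms_def)
  show ?thesis
    unfolding hom_normalizer_eq by (rule f.img_is_subgroup)
qed

lemma normal_in_hom_normalizer: "H \<lhd> \<Gamma>\<lparr>carrier := hom_normalizer \<Gamma> G H \<rho>\<rparr>"
proof -
  note S = subgroup_hom_normalizer
  have sub: "H \<subseteq> hom_normalizer \<Gamma> G H \<rho>"
    unfolding hom_normalizer_eq using graph_in_twists by force
  show ?thesis
  proof (rule group.normal_invI)
    show "group (\<Gamma>\<lparr>carrier := hom_normalizer \<Gamma> G H \<rho>\<rparr>)"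
      by (rule subgroup.subgroup_is_group[OF S \<Gamma>.is_group])
    show "subgroup H (\<Gamma>\<lparr>carrier := hom_normalizer \<Gamma> G H \<rho>\<rparr>)"
      by (rule \<Gamma>.subgroup_incl[OF H.subgroup_axioms S sub])
    show "x \<otimes>\<^bsub>\<Gamma>\<lparr>carrier := hom_normalizer \<Gamma> G H \<rho>\<rparr>\<^esub> h
        \<otimes>\<^bsub>\<Gamma>\<lparr>carrier := hom_normalizer \<Gamma> G H \<rho>\<rparr>\<^esub> inv\<^bsub>\<Gamma>\<lparr>carrier := hom_normalizer \<Gamma> G H \<rho>\<rparr>\<^esub> x \<in> H"
      if "x \<in> carrier (\<Gamma>\<lparr>carrier := hom_normalizer \<Gamma> G H \<rho>\<rparr>)" "h \<in> H" for x h
      using that \<Gamma>.normalizer_conj_closed[OF H.subset]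
      by (simp add: \<Gamma>.m_inv_consistent[OF S]) (simp add: hom_normalizer_def)
  qed
qed

text \<open>
  The cosets \<open>v u\<^sup>-\<^sup>1 H\<close> and \<open>v w\<^sup>-\<^sup>1 H\<close> agree iff \<open>u w\<^sup>-\<^sup>1 \<in> H\<close>, a condition free of \<open>v\<close>.
\<close>

lemma base_coset_twist:
  assumes "(u, g) \<in> carrier twists"
  shows "base_coset \<Gamma> G H \<rho> (twist (u, g)) = H #>\<^bsub>\<Gamma>\<^esub> u"
proof -
  have ug: "u \<in> carrier \<Gamma>" "g \<in> carrier G" using twists_carrier[OF assms] by auto
  have "w \<in> base_coset \<Gamma> G H \<rho> (twist (u, g)) \<longleftrightarrow> w \<in> H #>\<^bsub>\<Gamma>\<^esub> u" if w: "w \<in> carrier \<Gamma>" for w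
  proof -
    have "(v \<otimes>\<^bsub>\<Gamma>\<^esub> inv\<^bsub>\<Gamma>\<^esub> u) <#\<^bsub>\<Gamma>\<^esub> H = (v \<otimes>\<^bsub>\<Gamma>\<^esub> inv\<^bsub>\<Gamma>\<^esub> w) <#\<^bsub>\<Gamma>\<^esub> H \<longleftrightarrow> u \<otimes>\<^bsub>\<Gamma>\<^esub> inv\<^bsub>\<Gamma>\<^esub> w \<in> H"
      if v: "v \<in> carrier \<Gamma>" for v
    proof -
      have "inv\<^bsub>\<Gamma>\<^esub> (v \<otimes>\<^bsub>\<Gamma>\<^esub> inv\<^bsub>\<Gamma>\<^esub> u) \<otimes>\<^bsub>\<Gamma>\<^esub> (v \<otimes>\<^bsub>\<Gamma>\<^esub> inv\<^bsub>\<Gamma>\<^esub> w) = u \<otimes>\<^bsub>\<Gamma>\<^esub> inv\<^bsub>\<Gamma>\<^esub> w"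
        using ug v w by (simp add: \<Gamma>.inv_mult_group \<Gamma>.m_assoc) (simp add: \<Gamma>.m_assoc[symmetric])
      then show ?thesis using ug v w by (simp add: lcos_eq_iff)
    qed
    moreover have "u \<otimes>\<^bsub>\<Gamma>\<^esub> inv\<^bsub>\<Gamma>\<^esub> w \<in> H \<longleftrightarrow> w \<in> H #>\<^bsub>\<Gamma>\<^esub> u"
    proof
      assume h: "u \<otimes>\<^bsub>\<Gamma>\<^esub> inv\<^bsub>\<Gamma>\<^esub> w \<in> H"
      have "w = inv\<^bsub>\<Gamma>\<^esub> (u \<otimes>\<^bsub>\<Gamma>\<^esub> inv\<^bsub>\<Gamma>\<^esub> w) \<otimes>\<^bsub>\<Gamma>\<^esub> u"
        using ug w by (simp add: \<Gamma>.inv_mult_group \<Gamma>.m_assoc)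
      then show "w \<in> H #>\<^bsub>\<Gamma>\<^esub> u" using H.m_inv_closed[OF h] by (auto simp: r_coset_def)
    next
      assume "w \<in> H #>\<^bsub>\<Gamma>\<^esub> u"
      then obtain h where h: "h \<in> H" "w = h \<otimes>\<^bsub>\<Gamma>\<^esub> u" by (auto simp: r_coset_def)
      then have "u \<otimes>\<^bsub>\<Gamma>\<^esub> inv\<^bsub>\<Gamma>\<^esub> w = inv\<^bsub>\<Gamma>\<^esub> h"
        using ug by (simp add: \<Gamma>.inv_mult_group \<Gamma>.m_assoc[symmetric])
      then show "u \<otimes>\<^bsub>\<Gamma>\<^esub> inv\<^bsub>\<Gamma>\<^esub> w \<in> H" using h by simp
    qed
    ultimately show ?thesis
      using ug w G.one_closed \<Gamma>.one_closed by (auto simp: base_coset_def twist_cls[OF assms] cls_simps)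
  qed
  moreover have "H #>\<^bsub>\<Gamma>\<^esub> u \<subseteq> carrier \<Gamma>" by (rule \<Gamma>.r_coset_subset_G[OF H.subset ug(1)])
  ultimately show ?thesis by (auto simp: base_coset_def)
qed

lemma centralizer_iff_twist: "(\<one>\<^bsub>\<Gamma>\<^esub>, c) \<in> carrier twists \<longleftrightarrow> c \<in> centralizer G (\<rho> ` H)"
proof -
  have "\<rho> h = c \<otimes>\<^bsub>G\<^esub> \<rho> h \<otimes>\<^bsub>G\<^esub> inv\<^bsub>G\<^esub> c \<longleftrightarrow> c \<otimes>\<^bsub>G\<^esub> \<rho> h = \<rho> h \<otimes>\<^bsub>G\<^esub> c"
    if "c \<in> carrier G" "h \<in> H" for h
    using that hom_closed G.inv_solve_right[of "\<rho> h" "c \<otimes>\<^bsub>G\<^esub> \<rho> h" c] by auto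
  moreover have "\<one>\<^bsub>\<Gamma>\<^esub> \<in> normalizer \<Gamma> H"
    by (simp add: \<Gamma>.normalizer_iff[OF H.subset] \<Gamma>.lcos_mult_one[OF H.subset] \<Gamma>.coset_mult_one[OF H.subset])
  ultimately show ?thesis
    using H.mem_carrier by (auto simp: twists_iff centralizer_def)
qed

text \<open>
  If \<open>u \<in> H\<close>, multiplying \<open>(u, g)\<close> by \<open>(u\<^sup>-\<^sup>1, \<rho>(u\<^sup>-\<^sup>1))\<close>, which induces the identity, replaces \<open>u\<close> by \<open>1\<close>
  and \<open>g\<close> by an element of the centralizer. This identifies the kernel in the first sequence.
\<close>

lemma base_coset_twist_one_iff:
  assumes "(u, g) \<in> carrier twists"
  shows "base_coset \<Gamma> G H \<rho> (twist (u, g)) = H \<longleftrightarrow>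
    twist (u, g) \<in> (\<lambda>c. twist (\<one>\<^bsub>\<Gamma>\<^esub>, c)) ` centralizer G (\<rho> ` H)"
proof
  have ug: "u \<in> carrier \<Gamma>" "g \<in> carrier G" using twists_carrier[OF assms] by auto
  {
    assume "base_coset \<Gamma> G H \<rho> (twist (u, g)) = H"
    then have "u \<in> H"
      using base_coset_twist[OF assms] \<Gamma>.coset_join1 ug H.subgroup_axioms by simp
    then have h: "inv\<^bsub>\<Gamma>\<^esub> u \<in> H" by simp
    let ?c = "\<rho> (inv\<^bsub>\<Gamma>\<^esub> u) \<otimes>\<^bsub>G\<^esub> g"
    have eq: "(inv\<^bsub>\<Gamma>\<^esub> u, \<rho> (inv\<^bsub>\<Gamma>\<^esub> u)) \<otimes>\<^bsub>twists\<^esub> (u, g) = (\<one>\<^bsub>\<Gamma>\<^esub>, ?c)"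
      using ug by (simp add: mult_twists)
    have "(\<one>\<^bsub>\<Gamma>\<^esub>, ?c) \<in> carrier twists"
      using monoid.m_closed[OF group.is_monoid[OF group_twists] graph_in_twists[OF h] assms] eq by simp
    moreover have "twist (\<one>\<^bsub>\<Gamma>\<^esub>, ?c) = twist (u, g)"
      using Group.hom_mult[OF twist_hom graph_in_twists[OF h] assms]
        twist_eq_one_iff[OF graph_in_twists[OF h]] h eq
        monoid.l_one[OF group.is_monoid[OF ind.group_bundle_Aut] twist_in_Auts[OF assms]] by simp
    ultimately show "twist (u, g) \<in> (\<lambda>c. twist (\<one>\<^bsub>\<Gamma>\<^esub>, c)) ` centralizer G (\<rho> ` H)"
      using centralizer_iff_twist by (intro image_eqI[of _ _ ?c]) auto
  }
  assume "twist (u, g) \<in> (\<lambda>c. twist (\<one>\<^bsub>\<Gamma>\<^esub>, c)) ` centralizer G (\<rho> ` H)"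
  then show "base_coset \<Gamma> G H \<rho> (twist (u, g)) = H"
    using base_coset_twist centralizer_iff_twist \<Gamma>.coset_mult_one[OF H.subset] by force
qed

lemma Auts_cases:
  assumes "\<phi> \<in> carrier Auts"
  obtains u g where "(u, g) \<in> carrier twists" "\<phi> = twist (u, g)"
  using assms unfolding twist_surj[symmetric] by auto

theorem exact_hom_normalizer:
  "short_exact (G\<lparr>carrier := centralizer G (\<rho> ` H)\<rparr>) Auts (\<Gamma>\<lparr>carrier := hom_normalizer \<Gamma> G H \<rho>\<rparr> Mod H)
    (\<lambda>c. twist (\<one>\<^bsub>\<Gamma>\<^esub>, c)) (base_coset \<Gamma> G H \<rho>)"
  unfolding short_exact_def
proof (intro conjI)
  let ?N = "\<Gamma>\<lparr>carrier := hom_normalizer \<Gamma> G H \<rho>\<rparr>" and ?C = "centralizer G (\<rho> ` H)"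
  interpret N: normal H ?N by (rule normal_in_hom_normalizer)
  show "group Auts" by (rule ind.group_bundle_Aut)
  show "group (?N Mod H)" by (rule N.factorgroup_is_group)
  have C: "(\<one>\<^bsub>\<Gamma>\<^esub>, c) \<in> carrier twists" if "c \<in> ?C" for c
    using that by (simp add: centralizer_iff_twist)
  have "subgroup ?C G"
  proof (rule G.subgroupI)
    show "?C \<subseteq> carrier G" by (auto simp: centralizer_def)
    show "?C \<noteq> {}"
      using monoid.one_closed[OF group.is_monoid[OF group_twists]] centralizer_iff_twist[of "\<one>\<^bsub>G\<^esub>"]
      by (auto simp: twist_group_def)
    show "a \<otimes>\<^bsub>G\<^esub> b \<in> ?C" if "a \<in> ?C" "b \<in> ?C" for a b
      using monoid.m_closed[OF group.is_monoid[OF group_twists] C[OF that(1)] C[OF that(2)]]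
      by (simp add: mult_twists centralizer_iff_twist)
    show "inv\<^bsub>G\<^esub> a \<in> ?C" if "a \<in> ?C" for a
    proof -
      have "a \<in> carrier G" using that by (simp add: centralizer_def)
      then have "(\<one>\<^bsub>\<Gamma>\<^esub>, inv\<^bsub>G\<^esub> a) \<in> carrier twists"
        using subgroup.m_inv_closed[OF subgroup_twists C[OF that]]
        by (simp add: inv_DirProd \<Gamma>.is_group G.is_group)
      then show ?thesis by (simp add: centralizer_iff_twist)
    qed
  qed
  then show "group (G\<lparr>carrier := ?C\<rparr>)"
    by (rule subgroup.subgroup_is_group[OF _ G.is_group])
  show "(\<lambda>c. twist (\<one>\<^bsub>\<Gamma>\<^esub>, c)) \<in> mon (G\<lparr>carrier := ?C\<rparr>) Auts"
  proof -
    have "twist (\<one>\<^bsub>\<Gamma>\<^esub>, a \<otimes>\<^bsub>G\<^esub> b) = twist (\<one>\<^bsub>\<Gamma>\<^esub>, a) \<otimes>\<^bsub>Auts\<^esub> twist (\<one>\<^bsub>\<Gamma>\<^esub>, b)" if "a \<in> ?C" "b \<in> ?C" for a b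
      using Group.hom_mult[OF twist_hom C[OF that(1)] C[OF that(2)]] by (simp add: mult_twists)
    moreover have "a = b" if ab: "a \<in> ?C" "b \<in> ?C" "twist (\<one>\<^bsub>\<Gamma>\<^esub>, a) = twist (\<one>\<^bsub>\<Gamma>\<^esub>, b)" for a b
    proof -
      have abc: "a \<in> carrier G" "b \<in> carrier G" using ab by (auto simp: centralizer_def)
      have "cls \<one>\<^bsub>\<Gamma>\<^esub> a = cls \<one>\<^bsub>\<Gamma>\<^esub> b"
        using twist_cls[OF C[OF ab(1)] \<Gamma>.one_closed G.one_closed] abc
          twist_cls[OF C[OF ab(2)] \<Gamma>.one_closed G.one_closed] ab(3) by simp
      then obtain h where h: "h \<in> H" "\<one>\<^bsub>\<Gamma>\<^esub> = \<one>\<^bsub>\<Gamma>\<^esub> \<otimes>\<^bsub>\<Gamma>\<^esub> h" "b = inv\<^bsub>G\<^esub> (\<rho> h) \<otimes>\<^bsub>G\<^esub> a"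
        using cls_eq_iff[OF \<Gamma>.one_closed abc(1) \<Gamma>.one_closed abc(2)] by blast
      then have "h = \<one>\<^bsub>\<Gamma>\<^esub>" by simp
      then show "a = b" using h(3) abc by (simp add: hom_one)
    qed
    ultimately show ?thesis
      using C twist_in_Auts by (auto simp: mon_def hom_def inj_on_def)
  qed
  show "base_coset \<Gamma> G H \<rho> \<in> epi Auts (?N Mod H)"
  proof -
    have fst_N: "u \<in> hom_normalizer \<Gamma> G H \<rho> \<longleftrightarrow> (\<exists>g. (u, g) \<in> carrier twists)" for u
      unfolding hom_normalizer_def twists_iff by blast
    have coset: "H #>\<^bsub>\<Gamma>\<^esub> u = H #>\<^bsub>?N\<^esub> u" for u by (simp add: r_coset_def)
    have "base_coset \<Gamma> G H \<rho> ` carrier Auts = carrier (?N Mod H)"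
    proof -
      have "base_coset \<Gamma> G H \<rho> ` carrier Auts = (\<lambda>p. H #>\<^bsub>\<Gamma>\<^esub> fst p) ` carrier twists"
        unfolding twist_surj[symmetric] image_image by (rule image_cong) (auto simp: base_coset_twist)
      also have "\<dots> = (\<lambda>u. H #>\<^bsub>\<Gamma>\<^esub> u) ` hom_normalizer \<Gamma> G H \<rho>"
        unfolding hom_normalizer_eq image_image ..
      also have "\<dots> = (\<Union>u\<in>hom_normalizer \<Gamma> G H \<rho>. {H #>\<^bsub>\<Gamma>\<^esub> u})"
        by (rule UNION_singleton_eq_range[symmetric])
      also have "\<dots> = carrier (?N Mod H)"
        by (simp add: FactGroup_def RCOSETS_def r_coset_def)
      finally show ?thesis .
    qed
    moreover have "base_coset \<Gamma> G H \<rho> (\<phi> \<otimes>\<^bsub>Auts\<^esub> \<chi>) =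
        base_coset \<Gamma> G H \<rho> \<phi> \<otimes>\<^bsub>?N Mod H\<^esub> base_coset \<Gamma> G H \<rho> \<chi>"
      if \<phi>: "\<phi> \<in> carrier Auts" and \<chi>: "\<chi> \<in> carrier Auts" for \<phi> \<chi>
    proof -
      obtain u g where ug: "(u, g) \<in> carrier twists" "\<phi> = twist (u, g)" using \<phi> by (rule Auts_cases)
      obtain w l where wl: "(w, l) \<in> carrier twists" "\<chi> = twist (w, l)" using \<chi> by (rule Auts_cases)
      have uw: "u \<in> carrier ?N" "w \<in> carrier ?N" using ug wl fst_N by auto
      have "\<phi> \<otimes>\<^bsub>Auts\<^esub> \<chi> = twist (u \<otimes>\<^bsub>\<Gamma>\<^esub> w, g \<otimes>\<^bsub>G\<^esub> l)"
        using Group.hom_mult[OF twist_hom ug(1) wl(1)] ug wl by (simp add: mult_twists)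
      moreover have "(u \<otimes>\<^bsub>\<Gamma>\<^esub> w, g \<otimes>\<^bsub>G\<^esub> l) \<in> carrier twists"
        using monoid.m_closed[OF group.is_monoid[OF group_twists] ug(1) wl(1)] by (simp add: mult_twists)
      moreover have "(H #>\<^bsub>\<Gamma>\<^esub> u) \<otimes>\<^bsub>?N Mod H\<^esub> (H #>\<^bsub>\<Gamma>\<^esub> w) = H #>\<^bsub>\<Gamma>\<^esub> (u \<otimes>\<^bsub>\<Gamma>\<^esub> w)"
        using N.rcos_sum[OF uw] unfolding coset[symmetric] by (simp add: FactGroup_def)
      ultimately show ?thesis
        using ug wl by (simp add: base_coset_twist)
    qed
    ultimately show ?thesis
      unfolding epi_def hom_def by blast
  qed
  show "(\<lambda>c. twist (\<one>\<^bsub>\<Gamma>\<^esub>, c)) ` carrier (G\<lparr>carrier := ?C\<rparr>) = kernel Auts (?N Mod H) (base_coset \<Gamma> G H \<rho>)"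
  proof -
    have "\<phi> \<in> (\<lambda>c. twist (\<one>\<^bsub>\<Gamma>\<^esub>, c)) ` ?C \<longleftrightarrow> base_coset \<Gamma> G H \<rho> \<phi> = H" if "\<phi> \<in> carrier Auts" for \<phi>
      using that by (rule Auts_cases) (simp add: base_coset_twist_one_iff)
    then show ?thesis
      using C twist_in_Auts by (auto simp: kernel_def FactGroup_def)
  qed
qed

lemma vertical_automorphisms:
  "(\<lambda>c. twist (\<one>\<^bsub>\<Gamma>\<^esub>, c)) ` centralizer G (\<rho> ` H) =
    {\<phi> \<in> carrier Auts. \<forall>C\<in>total_space P\<rho>. proj P\<rho> (\<phi> C) = proj P\<rho> C}" (is "?L = ?R")
proof -
  have L: "?L \<subseteq> carrier Auts"
    using centralizer_iff_twist twist_in_Auts by blast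
  have "\<phi> \<in> ?L \<longleftrightarrow> (\<forall>C\<in>total_space P\<rho>. proj P\<rho> (\<phi> C) = proj P\<rho> C)" if \<phi>: "\<phi> \<in> carrier Auts" for \<phi>
  proof -
    obtain u g where ug: "(u, g) \<in> carrier twists" "\<phi> = twist (u, g)" using \<phi> by (rule Auts_cases)
    have ugc: "u \<in> carrier \<Gamma>" "g \<in> carrier G" using twists_carrier[OF ug(1)] by auto
    have "\<phi> \<in> ?L \<longleftrightarrow> H #>\<^bsub>\<Gamma>\<^esub> u = H"
      using base_coset_twist_one_iff[OF ug(1)] base_coset_twist[OF ug(1)] ug(2) by simp
    also have "\<dots> \<longleftrightarrow> \<one>\<^bsub>\<Gamma>\<^esub> \<in> base_coset \<Gamma> G H \<rho> \<phi>"
      using \<Gamma>.repr_independence[OF _ ugc(1) H.subgroup_axioms, of "\<one>\<^bsub>\<Gamma>\<^esub>"] \<Gamma>.coset_mult_one[OF H.subset]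
      by (auto simp: ug(2) base_coset_twist[OF ug(1)])
    also have "\<dots> \<longleftrightarrow> (\<forall>C\<in>total_space P\<rho>. proj P\<rho> (\<phi> C) = proj P\<rho> C)"
    proof
      assume a: "\<one>\<^bsub>\<Gamma>\<^esub> \<in> base_coset \<Gamma> G H \<rho> \<phi>"
      show "\<forall>C\<in>total_space P\<rho>. proj P\<rho> (\<phi> C) = proj P\<rho> C"
      proof
        fix C assume "C \<in> total_space P\<rho>"
        then obtain v k where vk: "v \<in> carrier \<Gamma>" "k \<in> carrier G" "C = cls v k" by (rule cls_cases)
        then show "proj P\<rho> (\<phi> C) = proj P\<rho> C" using a by (simp add: base_coset_def cls_simps)
      qed
    next
      assume "\<forall>C\<in>total_space P\<rho>. proj P\<rho> (\<phi> C) = proj P\<rho> C"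
      then show "\<one>\<^bsub>\<Gamma>\<^esub> \<in> base_coset \<Gamma> G H \<rho> \<phi>"
        by (simp add: base_coset_def cls_closed cls_simps)
    qed
    finally show ?thesis .
  qed
  then show ?thesis using L by blast
qed

end

section \<open>Automorphisms permuting blocks\<close>

text \<open>
  A bundle cut into blocks \<open>\<psi> i k ` Q i\<close>, where the \<open>r i\<close> blocks with the same first index are copies
  of one bundle and every automorphism of the total bundle permutes them. Where the
  index set consists of all conjugacy classes, it may be infinite, with almost all \<open>r i\<close> equal to \<open>0\<close>;
  those contribute trivial wreath products.
\<close>

locale bundle_blocks = P: equivariant_bundle \<Gamma> G P
  for \<Gamma> :: "'u monoid" and G :: "'g monoid" and P :: "('p, 'z, 'u, 'g) gbundle" +
  fixes I :: "'i set" and Q :: "'i \<Rightarrow> ('q, 'y, 'u, 'g) gbundle" and r :: "'i \<Rightarrow> nat"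
    and \<psi> :: "'i \<Rightarrow> nat \<Rightarrow> 'q \<Rightarrow> 'p"
  assumes Q: "i \<in> I \<Longrightarrow> equivariant_bundle \<Gamma> G (Q i)"
    and nonempty: "i \<in> I \<Longrightarrow> total_space (Q i) \<noteq> {}"
    and inj: "\<lbrakk>i \<in> I; k \<in> {1..r i}; q \<in> total_space (Q i);
        i' \<in> I; k' \<in> {1..r i'}; q' \<in> total_space (Q i'); \<psi> i k q = \<psi> i' k' q'\<rbrakk> \<Longrightarrow> i = i' \<and> k = k' \<and> q = q'"
    and total: "total_space P = (\<Union>i\<in>I. \<Union>k\<in>{1..r i}. \<psi> i k ` total_space (Q i))"
    and lact: "\<lbrakk>i \<in> I; k \<in> {1..r i}; q \<in> total_space (Q i); u \<in> carrier \<Gamma>\<rbrakk> \<Longrightarrow>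
        \<psi> i k (lact (Q i) u q) = lact P u (\<psi> i k q)"
    and ract: "\<lbrakk>i \<in> I; k \<in> {1..r i}; q \<in> total_space (Q i); g \<in> carrier G\<rbrakk> \<Longrightarrow>
        \<psi> i k (ract (Q i) q g) = ract P (\<psi> i k q) g"
    and blocks: "\<lbrakk>\<alpha> \<in> bundle_iso \<Gamma> G P P; i \<in> I; k \<in> {1..r i}\<rbrakk> \<Longrightarrow>
        \<exists>l\<in>{1..r i}. \<alpha> ` \<psi> i k ` total_space (Q i) = \<psi> i l ` total_space (Q i)"
begin

abbreviation W where "W \<equiv> product_group I (\<lambda>i. wreath (bundle_Aut \<Gamma> G (Q i)) (r i))"

lemma total_cases:
  assumes "x \<in> total_space P"
  obtains i k q where "i \<in> I" "k \<in> {1..r i}" "q \<in> total_space (Q i)" "x = \<psi> i k q"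
  using assms unfolding total by blast

lemma \<psi>_closed: "i \<in> I \<Longrightarrow> k \<in> {1..r i} \<Longrightarrow> q \<in> total_space (Q i) \<Longrightarrow> \<psi> i k q \<in> total_space P"
  unfolding total by blast

lemma group_W: "group W"
  by (intro product_group group_wreath equivariant_bundle.group_bundle_Aut Q)

lemma W_parts:
  assumes "w \<in> carrier W" "i \<in> I"
  shows "snd (w i) permutes {1..r i}" and "fst (w i) \<in> {1..r i} \<rightarrow>\<^sub>E carrier (bundle_Aut \<Gamma> G (Q i))"
    and "k \<in> {1..r i} \<Longrightarrow> snd (w i) k \<in> {1..r i}"
    and "k \<in> {1..r i} \<Longrightarrow> fst (w i) k \<in> bundle_iso \<Gamma> G (Q i) (Q i)"
    and "k \<in> {1..r i} \<Longrightarrow> fst (w i) k \<in> carrier (bundle_Aut \<Gamma> G (Q i))"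
    and "k \<in> {1..r i} \<Longrightarrow> q \<in> total_space (Q i) \<Longrightarrow> fst (w i) k q \<in> total_space (Q i)"
proof -
  have "w i \<in> carrier (wreath (bundle_Aut \<Gamma> G (Q i)) (r i))"
    using assms by auto
  then have *: "snd (w i) permutes {1..r i} \<and> fst (w i) \<in> {1..r i} \<rightarrow>\<^sub>E carrier (bundle_Aut \<Gamma> G (Q i))"
    by (cases "w i") (simp add: carrier_wreath)
  show p: "snd (w i) permutes {1..r i}" and f: "fst (w i) \<in> {1..r i} \<rightarrow>\<^sub>E carrier (bundle_Aut \<Gamma> G (Q i))"
    using * by auto
  show "k \<in> {1..r i} \<Longrightarrow> snd (w i) k \<in> {1..r i}"
    using permutes_in_image[OF p] by blast
  show c: "fst (w i) k \<in> carrier (bundle_Aut \<Gamma> G (Q i))" if "k \<in> {1..r i}" for k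
    using f that by (rule PiE_mem)
  show iso: "fst (w i) k \<in> bundle_iso \<Gamma> G (Q i) (Q i)" if "k \<in> {1..r i}" for k
    using c[OF that] by (simp add: carrier_bundle_Aut)
  show "fst (w i) k q \<in> total_space (Q i)" if "k \<in> {1..r i}" "q \<in> total_space (Q i)" for k q
    by (rule bundle_isoD(2)[OF iso[OF that(1)] that(2)])
qed

text \<open>
  Through the bijection \<open>(i, k, q) \<mapsto> \<psi> i k q\<close>, a family \<open>w\<close> of elements \<open>(f, s)\<close> of wreath products
  acts by \<open>(i, k, q) \<mapsto> (i, s k, f (s k) q)\<close>, the same formula by which the wreath product with \<open>G\<close>
  acts on \<open>{1..n} \<times> G\<close>. The description operator reads off the coordinates of a point.
\<close>

definition glue :: "('i \<Rightarrow> (nat \<Rightarrow> 'q \<Rightarrow> 'q) \<times> (nat \<Rightarrow> nat)) \<Rightarrow> 'p \<Rightarrow> 'p"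
  where "glue w = (\<lambda>x\<in>total_space P. case SOME (i, k, q). i \<in> I \<and> k \<in> {1..r i} \<and> q \<in> total_space (Q i) \<and> x = \<psi> i k q
    of (i, k, q) \<Rightarrow> \<psi> i (snd (w i) k) (fst (w i) (snd (w i) k) q))"

lemma glue_\<psi>:
  assumes "i \<in> I" "k \<in> {1..r i}" "q \<in> total_space (Q i)"
  shows "glue w (\<psi> i k q) = \<psi> i (snd (w i) k) (fst (w i) (snd (w i) k) q)"
proof -
  have "(SOME (i', k', q'). i' \<in> I \<and> k' \<in> {1..r i'} \<and> q' \<in> total_space (Q i') \<and> \<psi> i k q = \<psi> i' k' q') = (i, k, q)"
    by (rule some_equality) (use assms inj[OF assms] in \<open>auto simp del: atLeastAtMost_iff\<close>)
  then show ?thesis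
    using assms \<psi>_closed by (simp add: glue_def del: atLeastAtMost_iff)
qed

lemma glue_closed: "w \<in> carrier W \<Longrightarrow> x \<in> total_space P \<Longrightarrow> glue w x \<in> total_space P"
  by (erule total_cases) (simp only: glue_\<psi>, intro \<psi>_closed W_parts)

lemma glue_one: "x \<in> total_space P \<Longrightarrow> glue \<one>\<^bsub>W\<^esub> x = x"
  by (erule total_cases) (simp add: glue_\<psi> one_wreath one_bundle_Aut del: atLeastAtMost_iff)

text \<open>
  The twist \<open>f' \<circ> s\<^sup>-\<^sup>1\<close> in the product of the wreath product is what the index shift produces: the
  block at \<open>s (s' k)\<close> is reached through the block at \<open>s' k = s\<^sup>-\<^sup>1 (s (s' k))\<close>.
\<close>

lemma glue_mult:
  assumes w: "w \<in> carrier W" and w': "w' \<in> carrier W" and "x \<in> total_space P"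
  shows "glue (w \<otimes>\<^bsub>W\<^esub> w') x = glue w (glue w' x)"
  using assms(3)
proof (rule total_cases)
  fix i k q assume i: "i \<in> I" and k: "k \<in> {1..r i}" and q: "q \<in> total_space (Q i)" and x: "x = \<psi> i k q"
  obtain f s where e: "w i = (f, s)" by fastforce
  obtain f' s' where e': "w' i = (f', s')" by fastforce
  note p = W_parts[OF w i, unfolded e fst_conv snd_conv]
  note p' = W_parts[OF w' i, unfolded e' fst_conv snd_conv]
  let ?l = "s' k" and ?m = "s (s' k)"
  have l: "?l \<in> {1..r i}" by (rule p'(3)[OF k])
  have m: "?m \<in> {1..r i}" by (rule p(3)[OF l])
  have inv: "inv' s ?m = ?l" by (rule permutes_inverses(2)[OF p(1)])
  have ww: "(w \<otimes>\<^bsub>W\<^esub> w') i = (\<lambda>k\<in>{1..r i}. f k \<otimes>\<^bsub>bundle_Aut \<Gamma> G (Q i)\<^esub> f' (inv' s k), s \<circ> s')"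
    using i by (simp add: e e' mult_wreath[OF p(1)])
  have "glue (w \<otimes>\<^bsub>W\<^esub> w') x = \<psi> i ?m ((f ?m \<otimes>\<^bsub>bundle_Aut \<Gamma> G (Q i)\<^esub> f' ?l) q)"
    unfolding x glue_\<psi>[OF i k q] ww using m inv by (simp del: atLeastAtMost_iff)
  also have "\<dots> = \<psi> i ?m (f ?m (f' ?l q))"
    using q by (simp add: mult_bundle_Aut[OF p(5)[OF m] p'(5)[OF l]])
  also have "\<dots> = glue w (glue w' x)"
    using p'(6)[OF l q] by (simp add: x glue_\<psi>[OF i k q] e e' glue_\<psi>[OF i l])
  finally show ?thesis .
qed

lemma glue_in_Aut:
  assumes w: "w \<in> carrier W"
  shows "glue w \<in> carrier (bundle_Aut \<Gamma> G P)"
proof -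
  let ?v = "inv\<^bsub>W\<^esub> w"
  have v: "?v \<in> carrier W" by (rule group.inv_closed[OF group_W w])
  have inv: "glue ?v (glue w x) = x" "glue w (glue ?v x) = x" if "x \<in> total_space P" for x
    using glue_mult[OF v w that] glue_mult[OF w v that]
    unfolding group.l_inv[OF group_W w] group.r_inv[OF group_W w] glue_one[OF that] by metis+
  have "bij_betw (glue w) (total_space P) (total_space P)"
    by (rule bij_betw_byWitness[where f' = "glue ?v"])
      (use inv in \<open>blast intro: glue_closed w v\<close>)+
  moreover have "glue w (lact P u x) = lact P u (glue w x)" if "x \<in> total_space P" "u \<in> carrier \<Gamma>" for x u
    using that(1)
  proof (rule total_cases)
    fix i k q assume i: "i \<in> I" and k: "k \<in> {1..r i}" and q: "q \<in> total_space (Q i)" and x: "x = \<psi> i k q"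
    note s = W_parts(3)[OF w i k]
    show ?thesis
      using equivariant_bundle.lact_closed[OF Q[OF i] q that(2)] bundle_isoD(3)[OF W_parts(4)[OF w i s] q that(2)]
        W_parts(6)[OF w i s q]
      by (simp add: x lact[OF i k q that(2), symmetric] glue_\<psi>[OF i k] q lact[OF i s _ that(2), symmetric])
  qed
  moreover have "glue w (ract P x g) = ract P (glue w x) g" if "x \<in> total_space P" "g \<in> carrier G" for x g
    using that(1)
  proof (rule total_cases)
    fix i k q assume i: "i \<in> I" and k: "k \<in> {1..r i}" and q: "q \<in> total_space (Q i)" and x: "x = \<psi> i k q"
    note s = W_parts(3)[OF w i k]
    show ?thesis
      using equivariant_bundle.ract_closed[OF Q[OF i] q that(2)] bundle_isoD(4)[OF W_parts(4)[OF w i s] q that(2)]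
        W_parts(6)[OF w i s q]
      by (simp add: x ract[OF i k q that(2), symmetric] glue_\<psi>[OF i k] q ract[OF i s _ that(2), symmetric])
  qed
  moreover have "glue w \<in> extensional (total_space P)" by (simp add: glue_def)
  ultimately show ?thesis by (simp add: carrier_bundle_Aut bundle_iso_def)
qed

lemma glue_hom: "glue \<in> hom W (bundle_Aut \<Gamma> G P)"
proof (rule homI)
  show "glue w \<in> carrier (bundle_Aut \<Gamma> G P)" if "w \<in> carrier W" for w
    by (rule glue_in_Aut[OF that])
  fix w w' assume w: "w \<in> carrier W" and w': "w' \<in> carrier W"
  show "glue (w \<otimes>\<^bsub>W\<^esub> w') = glue w \<otimes>\<^bsub>bundle_Aut \<Gamma> G P\<^esub> glue w'"
    unfolding mult_bundle_Aut[OF glue_in_Aut[OF w] glue_in_Aut[OF w']]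
  proof (rule extensionalityI[of _ "total_space P"])
    show "glue (w \<otimes>\<^bsub>W\<^esub> w') x = (\<lambda>x\<in>total_space P. glue w (glue w' x)) x" if "x \<in> total_space P" for x
      using glue_mult[OF w w' that] that by simp
  qed (simp_all add: glue_def)
qed

lemma glue_inj: "inj_on glue (carrier W)"
proof (rule inj_onI)
  fix w w' assume w: "w \<in> carrier W" and w': "w' \<in> carrier W" and eq: "glue w = glue w'"
  have "w i = w' i" if i: "i \<in> I" for i
  proof -
    note p = W_parts[OF w i] and p' = W_parts[OF w' i]
    have key: "snd (w i) k = snd (w' i) k \<and> fst (w i) (snd (w i) k) q = fst (w' i) (snd (w' i) k) q"
      if k: "k \<in> {1..r i}" and q: "q \<in> total_space (Q i)" for k q
    proof -
      have "\<psi> i (snd (w i) k) (fst (w i) (snd (w i) k) q) = \<psi> i (snd (w' i) k) (fst (w' i) (snd (w' i) k) q)"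
        using fun_cong[OF eq, of "\<psi> i k q"] by (simp only: glue_\<psi>[OF i k q])
      from inj[OF i p(3)[OF k] p(6)[OF p(3)[OF k] q] i p'(3)[OF k] p'(6)[OF p'(3)[OF k] q] this]
      show ?thesis by blast
    qed
    obtain q0 where q0: "q0 \<in> total_space (Q i)" using nonempty[OF i] by blast
    have s: "snd (w i) = snd (w' i)"
    proof
      fix k show "snd (w i) k = snd (w' i) k"
        using key[OF _ q0, of k] permutes_not_in[OF p(1), of k] permutes_not_in[OF p'(1), of k]
        by (cases "k \<in> {1..r i}") (simp_all del: atLeastAtMost_iff)
    qed
    have "fst (w i) l = fst (w' i) l" if l: "l \<in> {1..r i}" for l
    proof (rule extensionalityI[of _ "total_space (Q i)"])
      show "fst (w i) l \<in> extensional (total_space (Q i))" "fst (w' i) l \<in> extensional (total_space (Q i))"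
        using p(5)[OF l] p'(5)[OF l] by (simp_all add: carrier_bundle_Aut)
      have "l \<in> snd (w i) ` {1..r i}" unfolding permutes_image[OF p(1)] by (rule l)
      then obtain k where k: "k \<in> {1..r i}" "snd (w i) k = l" by blast
      show "fst (w i) l q = fst (w' i) l q" if "q \<in> total_space (Q i)" for q
        using key[OF k(1) that] s k(2) by simp
    qed
    then have "fst (w i) = fst (w' i)"
      by (rule PiE_ext[OF p(2) p'(2)])
    then show ?thesis using s by (rule prod_eqI)
  qed
  then show "w = w'"
    using w w' by (intro PiE_ext[of w I "\<lambda>i. carrier (wreath (bundle_Aut \<Gamma> G (Q i)) (r i))"]) auto
qed

text \<open>
  The automorphism induces a self-map of the finite set of copies of \<open>Q i\<close>; it is injective because
  the automorphism is and the blocks are disjoint.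
\<close>

lemma block_permutation:
  assumes \<alpha>: "\<alpha> \<in> bundle_iso \<Gamma> G P P" and i: "i \<in> I"
  obtains s where "s permutes {1..r i}"
    "\<And>k. k \<in> {1..r i} \<Longrightarrow> \<alpha> ` \<psi> i k ` total_space (Q i) = \<psi> i (s k) ` total_space (Q i)"
proof -
  obtain t where t: "\<And>k. k \<in> {1..r i} \<Longrightarrow> t k \<in> {1..r i}"
    "\<And>k. k \<in> {1..r i} \<Longrightarrow> \<alpha> ` \<psi> i k ` total_space (Q i) = \<psi> i (t k) ` total_space (Q i)"
    using blocks[OF \<alpha> i] by metis
  have \<alpha>_inj: "inj_on \<alpha> (total_space P)" using bundle_isoD(1)[OF \<alpha>] by (rule bij_betw_imp_inj_on)
  obtain q0 where q0: "q0 \<in> total_space (Q i)" using nonempty[OF i] by blast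
  have "inj_on t {1..r i}"
  proof (rule inj_onI)
    fix k l assume k: "k \<in> {1..r i}" and l: "l \<in> {1..r i}" and eq: "t k = t l"
    have "\<alpha> (\<psi> i k q0) \<in> \<alpha> ` \<psi> i l ` total_space (Q i)"
      unfolding t(2)[OF l] eq[symmetric] t(2)[OF k, symmetric] by (intro imageI q0)
    then obtain q where q: "q \<in> total_space (Q i)" "\<alpha> (\<psi> i k q0) = \<alpha> (\<psi> i l q)" by blast
    then have "\<psi> i k q0 = \<psi> i l q"
      using inj_onD[OF \<alpha>_inj] \<psi>_closed i k l q0 by blast
    then show "k = l" using inj[OF i k q0 i l q(1)] by blast
  qed
  moreover have "t ` {1..r i} \<subseteq> {1..r i}" using t(1) by blast
  ultimately have "bij_betw t {1..r i} {1..r i}"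
    by (simp add: bij_betw_def endo_inj_surj)
  \<comment> \<open>permutations in the wreath product fix all numbers outside the range\<close>
  moreover let ?s = "\<lambda>k. if k \<in> {1..r i} then t k else k"
  have "bij_betw ?s {1..r i} {1..r i} \<longleftrightarrow> bij_betw t {1..r i} {1..r i}"
    by (rule bij_betw_cong) (rule if_P)
  ultimately have "?s permutes {1..r i}"
    by (intro bij_imp_permutes) (blast, rule if_not_P)
  then show thesis
  proof (rule that)
    show "\<alpha> ` \<psi> i k ` total_space (Q i) = \<psi> i (?s k) ` total_space (Q i)" if "k \<in> {1..r i}" for k
      unfolding if_P[OF that] by (rule t(2)[OF that])
  qed
qed

text \<open>
  With \<open>s\<close> the permutation of blocks, \<open>a i k\<close> is the automorphism of \<open>Q i\<close> through which \<open>\<alpha>\<close> maps the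
  block \<open>k\<close> to the block \<open>s k\<close>. As \<open>f\<close> is indexed by the target block, \<open>f l = a i (s\<^sup>-\<^sup>1 l)\<close>.
\<close>

lemma glue_surj:
  assumes \<alpha>: "\<alpha> \<in> carrier (bundle_Aut \<Gamma> G P)"
  shows "\<alpha> \<in> glue ` carrier W"
proof -
  have iso: "\<alpha> \<in> bundle_iso \<Gamma> G P P" and ext: "\<alpha> \<in> extensional (total_space P)"
    using \<alpha> by (auto simp: carrier_bundle_Aut)
  have \<alpha>_inj: "inj_on \<alpha> (total_space P)" using bundle_isoD(1)[OF iso] by (rule bij_betw_imp_inj_on)
  have "\<exists>s. s permutes {1..r i} \<and>
      (\<forall>k\<in>{1..r i}. \<alpha> ` \<psi> i k ` total_space (Q i) = \<psi> i (s k) ` total_space (Q i))" if "i \<in> I" for i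
    using block_permutation[OF iso that] by metis
  then obtain s where s: "\<And>i. i \<in> I \<Longrightarrow> s i permutes {1..r i}"
    and im: "\<And>i k. i \<in> I \<Longrightarrow> k \<in> {1..r i} \<Longrightarrow>
      \<alpha> ` \<psi> i k ` total_space (Q i) = \<psi> i (s i k) ` total_space (Q i)"
    by metis
  define a where "a i k = (\<lambda>q\<in>total_space (Q i).
    SOME q'. q' \<in> total_space (Q i) \<and> \<alpha> (\<psi> i k q) = \<psi> i (s i k) q')" for i k
  have a: "a i k q \<in> total_space (Q i) \<and> \<alpha> (\<psi> i k q) = \<psi> i (s i k) (a i k q)"
    if i: "i \<in> I" and k: "k \<in> {1..r i}" and q: "q \<in> total_space (Q i)" for i k q
  proof -
    have "\<exists>q'. q' \<in> total_space (Q i) \<and> \<alpha> (\<psi> i k q) = \<psi> i (s i k) q'"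
      using im[OF i k] q by blast
    from someI_ex[OF this] show ?thesis using q by (simp add: a_def)
  qed
  have s_closed: "s i k \<in> {1..r i}" if "i \<in> I" "k \<in> {1..r i}" for i k
    using permutes_in_image[OF s[OF that(1)]] that(2) by blast
  have a_Aut: "a i k \<in> carrier (bundle_Aut \<Gamma> G (Q i))" if i: "i \<in> I" and k: "k \<in> {1..r i}" for i k
  proof -
    note sk = s_closed[OF i k]
    have cancel: "q = q'" if "q \<in> total_space (Q i)" "q' \<in> total_space (Q i)" "\<psi> i (s i k) q = \<psi> i (s i k) q'" for q q'
      using inj[OF i sk that(1) i sk that(2,3)] by blast
    have "inj_on (a i k) (total_space (Q i))"
    proof (rule inj_onI)
      fix q q' assume q: "q \<in> total_space (Q i)" and q': "q' \<in> total_space (Q i)" and "a i k q = a i k q'"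
      then have "\<alpha> (\<psi> i k q) = \<alpha> (\<psi> i k q')" using a[OF i k q] a[OF i k q'] by simp
      then have "\<psi> i k q = \<psi> i k q'" using inj_onD[OF \<alpha>_inj] \<psi>_closed i k q q' by blast
      then show "q = q'" using inj[OF i k q i k q'] by blast
    qed
    moreover have "a i k ` total_space (Q i) = total_space (Q i)"
    proof
      show "a i k ` total_space (Q i) \<subseteq> total_space (Q i)" using a[OF i k] by blast
      show "total_space (Q i) \<subseteq> a i k ` total_space (Q i)"
      proof
        fix q' assume q': "q' \<in> total_space (Q i)"
        then have "\<psi> i (s i k) q' \<in> \<alpha> ` \<psi> i k ` total_space (Q i)" using im[OF i k] by blast
        then obtain q where q: "q \<in> total_space (Q i)" "\<psi> i (s i k) q' = \<alpha> (\<psi> i k q)" by blast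
        then have "q' = a i k q" using a[OF i k q(1)] cancel[OF q'] by simp
        then show "q' \<in> a i k ` total_space (Q i)" using q by blast
      qed
    qed
    moreover have "a i k (lact (Q i) u q) = lact (Q i) u (a i k q)"
      if q: "q \<in> total_space (Q i)" and u: "u \<in> carrier \<Gamma>" for q u
    proof -
      note uq = equivariant_bundle.lact_closed[OF Q[OF i]]
      have aq: "a i k q \<in> total_space (Q i)" using a[OF i k q] by blast
      have "\<psi> i (s i k) (a i k (lact (Q i) u q)) = \<alpha> (\<psi> i k (lact (Q i) u q))"
        using a[OF i k uq[OF q u]] by simp
      also have "\<dots> = lact P u (\<alpha> (\<psi> i k q))"
        using bundle_isoD(3)[OF iso \<psi>_closed[OF i k q] u] by (simp add: lact[OF i k q u])
      also have "\<dots> = \<psi> i (s i k) (lact (Q i) u (a i k q))"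
        using a[OF i k q] by (simp add: lact[OF i sk aq u])
      finally show ?thesis
        using a[OF i k uq[OF q u]] uq[OF aq u] by (intro cancel) auto
    qed
    moreover have "a i k (ract (Q i) q g) = ract (Q i) (a i k q) g"
      if q: "q \<in> total_space (Q i)" and g: "g \<in> carrier G" for q g
    proof -
      note gq = equivariant_bundle.ract_closed[OF Q[OF i]]
      have aq: "a i k q \<in> total_space (Q i)" using a[OF i k q] by blast
      have "\<psi> i (s i k) (a i k (ract (Q i) q g)) = \<alpha> (\<psi> i k (ract (Q i) q g))"
        using a[OF i k gq[OF q g]] by simp
      also have "\<dots> = ract P (\<alpha> (\<psi> i k q)) g"
        using bundle_isoD(4)[OF iso \<psi>_closed[OF i k q] g] by (simp add: ract[OF i k q g])
      also have "\<dots> = \<psi> i (s i k) (ract (Q i) (a i k q) g)"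
        using a[OF i k q] by (simp add: ract[OF i sk aq g])
      finally show ?thesis
        using a[OF i k gq[OF q g]] gq[OF aq g] by (intro cancel) auto
    qed
    ultimately show ?thesis
      by (simp add: carrier_bundle_Aut bundle_iso_def bij_betw_def) (simp add: a_def)
  qed
  define w where "w = (\<lambda>i\<in>I. (\<lambda>l\<in>{1..r i}. a i (inv' (s i) l), s i))"
  have w: "w \<in> carrier W"
    using s a_Aut inv_permutes_mem[OF s] by (auto simp: w_def carrier_wreath simp del: atLeastAtMost_iff)
  have "\<alpha> = glue w"
  proof (rule extensionalityI[OF ext])
    show "glue w \<in> extensional (total_space P)" by (simp add: glue_def)
    show "\<alpha> x = glue w x" if "x \<in> total_space P" for x
      using that
    proof (rule total_cases)
      fix i k q assume i: "i \<in> I" and k: "k \<in> {1..r i}" and q: "q \<in> total_space (Q i)" and x: "x = \<psi> i k q"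
      show ?thesis
        using a[OF i k q] i s_closed[OF i k] permutes_inverses(2)[OF s[OF i]]
        by (simp add: x glue_\<psi>[OF i k q] w_def del: atLeastAtMost_iff)
    qed
  qed
  then show ?thesis using w by blast
qed

theorem Aut_iso: "bundle_Aut \<Gamma> G P \<cong> W"
proof -
  have "glue ` carrier W = carrier (bundle_Aut \<Gamma> G P)"
    using glue_surj glue_in_Aut by blast
  then have "glue \<in> iso W (bundle_Aut \<Gamma> G P)"
    using glue_hom glue_inj unfolding iso_def bij_betw_def by blast
  then show ?thesis
    by (rule group.iso_sym[OF group_W is_isoI])
qed

end

section \<open>Components and conjugacy classes\<close>

text \<open>
  The composition law is imposed at the one point \<open>x\<close>, so that the lemma applies to maps, like
  conjugation of sets, that form an action only on a part of their domain.
\<close>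

lemma orbit_eq:
  assumes "group \<Gamma>" and "u \<in> carrier \<Gamma>"
    and mult: "\<And>u v. u \<in> carrier \<Gamma> \<Longrightarrow> v \<in> carrier \<Gamma> \<Longrightarrow> a (u \<otimes>\<^bsub>\<Gamma>\<^esub> v) x = a u (a v x)"
  shows "orbit \<Gamma> a (a u x) = orbit \<Gamma> a x"
proof -
  interpret group \<Gamma> by fact
  show ?thesis
  proof
    show "orbit \<Gamma> a (a u x) \<subseteq> orbit \<Gamma> a x"
      using assms(2) by (auto simp: orbit_def simp flip: mult)
    show "orbit \<Gamma> a x \<subseteq> orbit \<Gamma> a (a u x)"
    proof
      fix y assume "y \<in> orbit \<Gamma> a x"
      then obtain v where v: "v \<in> carrier \<Gamma>" "y = a v x" by (auto simp: orbit_def)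
      have "a v x = a (v \<otimes>\<^bsub>\<Gamma>\<^esub> inv\<^bsub>\<Gamma>\<^esub> u \<otimes>\<^bsub>\<Gamma>\<^esub> u) x"
        using v assms(2) by (simp add: m_assoc)
      also have "\<dots> = a (v \<otimes>\<^bsub>\<Gamma>\<^esub> inv\<^bsub>\<Gamma>\<^esub> u) (a u x)"
        using v assms(2) by (intro mult) auto
      finally show "y \<in> orbit \<Gamma> a (a u x)"
        using v assms(2) by (auto simp: orbit_def)
    qed
  qed
qed

abbreviation hom_conj ::
    "'u monoid \<Rightarrow> 'g monoid \<Rightarrow> 'u set \<Rightarrow> 'u \<times> 'g \<Rightarrow> ('u \<Rightarrow> 'g) \<Rightarrow> 'u \<Rightarrow> 'g"
  where "hom_conj \<Gamma> G H \<equiv> (\<lambda>(u, g) \<rho>. \<lambda>h\<in>H.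
    g \<otimes>\<^bsub>G\<^esub> \<rho> (inv\<^bsub>\<Gamma>\<^esub> u \<otimes>\<^bsub>\<Gamma>\<^esub> h \<otimes>\<^bsub>\<Gamma>\<^esub> u) \<otimes>\<^bsub>G\<^esub> inv\<^bsub>G\<^esub> g)"

lemma Homs_closed: "\<rho> \<in> Homs \<Gamma> G H \<Longrightarrow> h \<in> H \<Longrightarrow> \<rho> h \<in> carrier G"
  by (auto simp: Homs_def hom_def)

text \<open>
  Each class is the orbit of any of its members, in particular of a chosen representative.
\<close>

lemma subgroup_class_eq_orbit:
  assumes "group \<Gamma>" "c \<in> subgroup_classes \<Gamma>" "H \<in> c"
  shows "subgroup H \<Gamma>"
    and "c = orbit \<Gamma> (\<lambda>u H. (u <#\<^bsub>\<Gamma>\<^esub> H) #>\<^bsub>\<Gamma>\<^esub> inv\<^bsub>\<Gamma>\<^esub> u) H"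
proof -
  interpret group \<Gamma> by fact
  let ?a = "\<lambda>u H. (u <#\<^bsub>\<Gamma>\<^esub> H) #>\<^bsub>\<Gamma>\<^esub> inv\<^bsub>\<Gamma>\<^esub> u"
  obtain K where K: "subgroup K \<Gamma>" "c = orbit \<Gamma> ?a K"
    using assms(2) by (auto simp: subgroup_classes_def orbits_def finite_index_subgroups_def)
  then obtain w where w: "w \<in> carrier \<Gamma>" "H = ?a w K"
    using assms(3) by (auto simp: orbit_def)
  show "subgroup H \<Gamma>"
    unfolding w(2) by (rule subgroup_conjugation_is_surj2[OF w(1) K(1)])
  have "orbit \<Gamma> ?a (?a w K) = orbit \<Gamma> ?a K"
    by (rule orbit_eq[OF assms(1) w(1)])
      (simp add: conj_set_conj_set subgroup.subset[OF K(1)])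
  then show "c = orbit \<Gamma> ?a H" using K w by simp
qed

lemma hom_class_eq_orbit:
  assumes "group \<Gamma>" "group G" "subgroup H \<Gamma>" "d \<in> hom_classes \<Gamma> G H" "\<rho> \<in> d"
  shows "\<rho> \<in> Homs \<Gamma> G H"
    and "d = orbit (\<Gamma>\<lparr>carrier := normalizer \<Gamma> H\<rparr> \<times>\<times> G) (hom_conj \<Gamma> G H) \<rho>"
proof -
  interpret \<Gamma>: group \<Gamma> by fact
  interpret G: group G by fact
  interpret H: subgroup H \<Gamma> by fact
  let ?N = "normalizer \<Gamma> H"
  let ?K = "\<Gamma>\<lparr>carrier := ?N\<rparr> \<times>\<times> G"
  have N: "subgroup ?N \<Gamma>" by (rule \<Gamma>.normalizer_imp_subgroup[OF H.subset])
  have K: "group ?K"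
    by (rule DirProd_group[OF subgroup.subgroup_is_group[OF N \<Gamma>.is_group] G.is_group])
  obtain \<rho>0 where \<rho>0: "\<rho>0 \<in> Homs \<Gamma> G H" "d = orbit ?K (hom_conj \<Gamma> G H) \<rho>0"
    using assms(4) by (auto simp: hom_classes_def orbits_def)
  then interpret subgroup_hom \<Gamma> G H \<rho>0
    by unfold_locales (auto simp: Homs_def)
  have Nc: "inv\<^bsub>\<Gamma>\<^esub> u \<otimes>\<^bsub>\<Gamma>\<^esub> h \<otimes>\<^bsub>\<Gamma>\<^esub> u \<in> H" if "u \<in> ?N" "h \<in> H" for u h
    using \<Gamma>.normalizer_conj_closed[OF H.subset \<Gamma>.normalizer_inv[OF H.subset that(1)] that(2)]
      subgroup.mem_carrier[OF N that(1)] by simp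
  obtain p where p: "p \<in> carrier ?K" "\<rho> = hom_conj \<Gamma> G H p \<rho>0"
    using assms(5) \<rho>0(2) unfolding orbit_def by blast
  obtain u g where e: "p = (u, g)" by fastforce
  have u: "u \<in> ?N" and g: "g \<in> carrier G" using p e by auto
  have uc: "u \<in> carrier \<Gamma>" by (rule subgroup.mem_carrier[OF N u])
  show "\<rho> \<in> Homs \<Gamma> G H"
  proof -
    have "\<rho> \<in> hom (\<Gamma>\<lparr>carrier := H\<rparr>) G"
    proof (rule homI)
      show "\<rho> h \<in> carrier G" if "h \<in> carrier (\<Gamma>\<lparr>carrier := H\<rparr>)" for h
        using that Nc[OF u] hom_closed g by (simp add: p e)
      fix h k assume "h \<in> carrier (\<Gamma>\<lparr>carrier := H\<rparr>)" "k \<in> carrier (\<Gamma>\<lparr>carrier := H\<rparr>)"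
      then have h: "h \<in> H" and k: "k \<in> H" by auto
      let ?h = "inv\<^bsub>\<Gamma>\<^esub> u \<otimes>\<^bsub>\<Gamma>\<^esub> h \<otimes>\<^bsub>\<Gamma>\<^esub> u" and ?k = "inv\<^bsub>\<Gamma>\<^esub> u \<otimes>\<^bsub>\<Gamma>\<^esub> k \<otimes>\<^bsub>\<Gamma>\<^esub> u"
      have "inv\<^bsub>\<Gamma>\<^esub> u \<otimes>\<^bsub>\<Gamma>\<^esub> (h \<otimes>\<^bsub>\<Gamma>\<^esub> k) \<otimes>\<^bsub>\<Gamma>\<^esub> u = ?h \<otimes>\<^bsub>\<Gamma>\<^esub> ?k"
        using uc h k by (simp add: \<Gamma>.m_assoc) (simp add: \<Gamma>.m_assoc[symmetric])
      then have "\<rho>0 (inv\<^bsub>\<Gamma>\<^esub> u \<otimes>\<^bsub>\<Gamma>\<^esub> (h \<otimes>\<^bsub>\<Gamma>\<^esub> k) \<otimes>\<^bsub>\<Gamma>\<^esub> u) = \<rho>0 ?h \<otimes>\<^bsub>G\<^esub> \<rho>0 ?k"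
        using hom_mult[OF Nc[OF u h] Nc[OF u k]] by simp
      moreover have "g \<otimes>\<^bsub>G\<^esub> (a \<otimes>\<^bsub>G\<^esub> b) \<otimes>\<^bsub>G\<^esub> inv\<^bsub>G\<^esub> g = g \<otimes>\<^bsub>G\<^esub> a \<otimes>\<^bsub>G\<^esub> inv\<^bsub>G\<^esub> g \<otimes>\<^bsub>G\<^esub> (g \<otimes>\<^bsub>G\<^esub> b \<otimes>\<^bsub>G\<^esub> inv\<^bsub>G\<^esub> g)"
        if "a \<in> carrier G" "b \<in> carrier G" for a b
        using g that by (simp add: G.m_assoc) (simp add: G.m_assoc[symmetric])
      ultimately show "\<rho> (h \<otimes>\<^bsub>\<Gamma>\<lparr>carrier := H\<rparr>\<^esub> k) = \<rho> h \<otimes>\<^bsub>G\<^esub> \<rho> k"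
        using h k hom_closed[OF Nc[OF u h]] hom_closed[OF Nc[OF u k]] by (simp add: p e)
    qed
    then show ?thesis by (simp add: Homs_def p e)
  qed
  have "orbit ?K (hom_conj \<Gamma> G H) (hom_conj \<Gamma> G H p \<rho>0) = orbit ?K (hom_conj \<Gamma> G H) \<rho>0"
  proof (rule orbit_eq[OF K p(1)])
    fix p q assume "p \<in> carrier ?K" "q \<in> carrier ?K"
    then obtain u g v k where e: "p = (u, g)" "q = (v, k)" and u: "u \<in> ?N" and v: "v \<in> ?N"
      and g: "g \<in> carrier G" and k: "k \<in> carrier G" by auto
    have uv: "u \<in> carrier \<Gamma>" "v \<in> carrier \<Gamma>" using u v subgroup.mem_carrier[OF N] by auto
    have "g \<otimes>\<^bsub>G\<^esub> k \<otimes>\<^bsub>G\<^esub> \<rho>0 (inv\<^bsub>\<Gamma>\<^esub> (u \<otimes>\<^bsub>\<Gamma>\<^esub> v) \<otimes>\<^bsub>\<Gamma>\<^esub> h \<otimes>\<^bsub>\<Gamma>\<^esub> (u \<otimes>\<^bsub>\<Gamma>\<^esub> v)) \<otimes>\<^bsub>G\<^esub> inv\<^bsub>G\<^esub> (g \<otimes>\<^bsub>G\<^esub> k) =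
        g \<otimes>\<^bsub>G\<^esub> (k \<otimes>\<^bsub>G\<^esub> \<rho>0 (inv\<^bsub>\<Gamma>\<^esub> v \<otimes>\<^bsub>\<Gamma>\<^esub> (inv\<^bsub>\<Gamma>\<^esub> u \<otimes>\<^bsub>\<Gamma>\<^esub> h \<otimes>\<^bsub>\<Gamma>\<^esub> u) \<otimes>\<^bsub>\<Gamma>\<^esub> v) \<otimes>\<^bsub>G\<^esub> inv\<^bsub>G\<^esub> k) \<otimes>\<^bsub>G\<^esub> inv\<^bsub>G\<^esub> g"
      if h: "h \<in> H" for h
    proof -
      have "inv\<^bsub>\<Gamma>\<^esub> (u \<otimes>\<^bsub>\<Gamma>\<^esub> v) \<otimes>\<^bsub>\<Gamma>\<^esub> h \<otimes>\<^bsub>\<Gamma>\<^esub> (u \<otimes>\<^bsub>\<Gamma>\<^esub> v) =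
          inv\<^bsub>\<Gamma>\<^esub> v \<otimes>\<^bsub>\<Gamma>\<^esub> (inv\<^bsub>\<Gamma>\<^esub> u \<otimes>\<^bsub>\<Gamma>\<^esub> h \<otimes>\<^bsub>\<Gamma>\<^esub> u) \<otimes>\<^bsub>\<Gamma>\<^esub> v"
        using uv h by (simp add: \<Gamma>.inv_mult_group \<Gamma>.m_assoc)
      then show ?thesis
        using g k hom_closed[OF Nc[OF v Nc[OF u h]]] by (simp add: G.inv_mult_group G.m_assoc)
    qed
    then show "hom_conj \<Gamma> G H (p \<otimes>\<^bsub>?K\<^esub> q) \<rho>0 = hom_conj \<Gamma> G H p (hom_conj \<Gamma> G H q \<rho>0)"
      using Nc[OF u] by (simp add: e cong: restrict_cong)
  qed
  then show "d = orbit ?K (hom_conj \<Gamma> G H) \<rho>" using \<rho>0 p by simp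
qed

context equivariant_bundle
begin

lemma frame_cong:
  assumes fr: "frame \<Gamma> P H \<rho> x" and eq: "\<And>h. h \<in> H \<Longrightarrow> \<rho>' h = \<rho> h"
  shows "frame \<Gamma> P H \<rho>' x"
  unfolding frame_def
proof (intro conjI ballI)
  show "lact P h x = ract P x (\<rho>' h)" if "h \<in> H" for h
    using frameD(3)[OF fr that] eq[OF that] by simp
qed (rule frameD[OF fr])+

lemma frame_hom_conj:
  assumes "frame \<Gamma> P H \<rho> x" "\<And>h. h \<in> H \<Longrightarrow> \<rho> h \<in> carrier G" "H \<subseteq> carrier \<Gamma>"
    and u: "u \<in> normalizer \<Gamma> H" and g: "g \<in> carrier G"
  shows "frame \<Gamma> P H (hom_conj \<Gamma> G H (u, g) \<rho>) (ract P (lact P u x) (inv\<^bsub>G\<^esub> g))"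
proof -
  interpret \<Gamma>: group \<Gamma> by (rule group_Gamma)
  interpret G: group G by (rule group_G)
  have uc: "u \<in> carrier \<Gamma>" "(u <#\<^bsub>\<Gamma>\<^esub> H) #>\<^bsub>\<Gamma>\<^esub> inv\<^bsub>\<Gamma>\<^esub> u = H"
    using u \<Gamma>.normalizer_iff[OF assms(3)] by auto
  show ?thesis
    using frame_move[OF assms(1,2) uc(1) G.inv_closed[OF g], unfolded uc(2)]
    by (rule frame_cong) (use g in auto)
qed

lemma orbit_base:
  assumes "Z \<in> orbits \<Gamma> (base_space P) (bact P)" "z \<in> Z"
  shows "z \<in> base_space P" "Z = orbit \<Gamma> (bact P) z"
proof -
  obtain y u where y: "y \<in> base_space P" "Z = orbit \<Gamma> (bact P) y" "u \<in> carrier \<Gamma>" "z = bact P u y"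
    using assms by (auto simp: orbits_def orbit_def)
  then show "z \<in> base_space P" by (simp add: bact_closed)
  show "Z = orbit \<Gamma> (bact P) z"
    unfolding y(2,4) by (rule orbit_eq[OF group_Gamma y(3), symmetric]) (rule bact_mult[OF y(1)])
qed

lemma orbit_self: "z \<in> base_space P \<Longrightarrow> z \<in> orbit \<Gamma> (bact P) z"
  using bact_one group.is_monoid[OF group_Gamma, THEN monoid.one_closed] unfolding orbit_def by force

lemma orbit_in_orbits: "z \<in> base_space P \<Longrightarrow> orbit \<Gamma> (bact P) z \<in> orbits \<Gamma> (base_space P) (bact P)"
  by (auto simp: orbits_def)

text \<open>
  The orbits of \<open>\<Gamma>\<close> on the base correspond to the orbits of \<open>\<Gamma> \<times> G\<close> on the total space.
\<close>

lemma same_orbit_iff: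
  assumes "x \<in> total_space P" "y \<in> total_space P"
  shows "proj P y \<in> orbit \<Gamma> (bact P) (proj P x) \<longleftrightarrow>
    (\<exists>u\<in>carrier \<Gamma>. \<exists>g\<in>carrier G. y = ract P (lact P u x) g)"
proof -
  have "proj P y = bact P u (proj P x) \<longleftrightarrow> (\<exists>g\<in>carrier G. y = ract P (lact P u x) g)"
    if "u \<in> carrier \<Gamma>" for u
    using fibre_iff[of "lact P u x" y] assms that by (auto simp: lact_closed proj_equivariant)
  then show ?thesis unfolding orbit_def by blast
qed

lemma total_restrict: "total_space (bundle_restrict P Z) = {x \<in> total_space P. proj P x \<in> Z}"
  and lact_restrict: "lact (bundle_restrict P Z) = lact P"
  and ract_restrict: "ract (bundle_restrict P Z) = ract P"
  by (simp_all add: bundle_restrict_def)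

lemma restrict_closed:
  assumes "Z \<in> orbits \<Gamma> (base_space P) (bact P)" "x \<in> total_space (bundle_restrict P Z)"
  shows "u \<in> carrier \<Gamma> \<Longrightarrow> lact P u x \<in> total_space (bundle_restrict P Z)"
    and "g \<in> carrier G \<Longrightarrow> ract P x g \<in> total_space (bundle_restrict P Z)"
proof -
  have x: "x \<in> total_space P" "proj P x \<in> Z" using assms(2) by (auto simp: total_restrict)
  show "ract P x g \<in> total_space (bundle_restrict P Z)" if "g \<in> carrier G"
    using x that by (simp add: total_restrict ract_closed proj_ract)
  have "bact P u (proj P x) \<in> Z" if "u \<in> carrier \<Gamma>"
    using orbit_base(2)[OF assms(1) x(2)] that unfolding orbit_def by blast
  then show "lact P u x \<in> total_space (bundle_restrict P Z)" if "u \<in> carrier \<Gamma>"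
    using x that by (simp add: total_restrict lact_closed proj_equivariant)
qed

text \<open>
  A frame in a component spreads to an isomorphism from \<open>P\<^sub>\<rho>\<close>; conversely, an isomorphism carries
  the canonical frame \<open>[1, 1]\<close> into the component. The isomorphism type of a component can hence be
  read off from its points.
\<close>

lemma component_iff_frame:
  assumes "subgroup_hom \<Gamma> G H \<rho>" and Z: "Z \<in> orbits \<Gamma> (base_space P) (bact P)"
  shows "bundle_isomorphic \<Gamma> G (bundle_restrict P Z) (ind_bundle \<Gamma> G H \<rho>) \<longleftrightarrow>
    (\<exists>x. frame \<Gamma> P H \<rho> x \<and> proj P x \<in> Z)"
proof -
  interpret subgroup_hom \<Gamma> G H \<rho> by fact
  let ?C = "bundle_restrict P Z"
  show ?thesis
  proof
    assume "bundle_isomorphic \<Gamma> G ?C P\<rho>"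
    then obtain \<phi> where \<phi>: "\<phi> \<in> bundle_iso \<Gamma> G ?C P\<rho>" by (auto simp: bundle_isomorphic_def)
    let ?\<psi> = "inv_into (total_space ?C) \<phi>"
    have \<psi>: "?\<psi> \<in> bundle_iso \<Gamma> G P\<rho> ?C"
      by (rule bundle_iso_inv[OF \<phi>]) (simp_all add: lact_restrict ract_restrict restrict_closed[OF Z])
    have "?\<psi> y \<in> total_space ?C" if "y \<in> total_space P\<rho>" for y
      by (rule bundle_isoD(2)[OF \<psi> that])
    then have cl: "?\<psi> y \<in> total_space P \<and> proj P (?\<psi> y) \<in> Z" if "y \<in> total_space P\<rho>" for y
      using that unfolding total_restrict by blast
    have "frame \<Gamma> P H \<rho> (?\<psi> (cls \<one>\<^bsub>\<Gamma>\<^esub> \<one>\<^bsub>G\<^esub>))"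
    proof (rule ind.frame_transport[OF equivariant_bundle_axioms frame_one hom_closed])
      show "inj_on ?\<psi> (total_space P\<rho>)" by (rule bij_betw_imp_inj_on[OF bundle_isoD(1)[OF \<psi>]])
    qed (use cl bundle_isoD(3,4)[OF \<psi>] in \<open>simp_all add: lact_restrict ract_restrict\<close>)
    then show "\<exists>x. frame \<Gamma> P H \<rho> x \<and> proj P x \<in> Z"
      using cl[OF cls_closed[OF \<Gamma>.one_closed G.one_closed]] by blast
  next
    assume "\<exists>x. frame \<Gamma> P H \<rho> x \<and> proj P x \<in> Z"
    then obtain x where x: "frame \<Gamma> P H \<rho> x" "proj P x \<in> Z" by blast
    obtain \<psi> where \<psi>: "\<psi> \<in> bundle_iso \<Gamma> G P\<rho> ?C"
      using frame_iso[OF equivariant_bundle_axioms x(1)] unfolding orbit_base(2)[OF Z x(2), symmetric] by blast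
    have "inv_into (total_space P\<rho>) \<psi> \<in> bundle_iso \<Gamma> G ?C P\<rho>"
      by (rule bundle_iso_inv[OF \<psi>]) (simp_all add: ind.lact_closed ind.ract_closed)
    then show "bundle_isomorphic \<Gamma> G ?C P\<rho>" unfolding bundle_isomorphic_def by blast
  qed
qed

text \<open>
  The coset \<open>v H\<close> consists of the elements that send the base point to its image under \<open>v\<close>, so
  that cosets are counted by points of the base.
\<close>

lemma stabilizer_finite_index:
  assumes "finite (base_space P)" "x \<in> total_space P" "H = {u \<in> carrier \<Gamma>. proj P (lact P u x) = proj P x}"
  shows "H \<in> finite_index_subgroups \<Gamma>"
proof -
  interpret \<Gamma>: group \<Gamma> by (rule group_Gamma)
  obtain \<rho> where "subgroup H \<Gamma>" "\<rho> \<in> hom (\<Gamma>\<lparr>carrier := H\<rparr>) G"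
    using frame_exists[OF assms(2,3)] by blast
  then interpret subgroup_hom \<Gamma> G H \<rho>
    by (simp add: subgroup_hom_def subgroup_hom_axioms_def group_Gamma group_G)
  let ?z = "proj P x"
  have z: "?z \<in> base_space P" by (rule proj_closed[OF assms(2)])
  have inH: "u \<in> H \<longleftrightarrow> bact P u ?z = ?z" if "u \<in> carrier \<Gamma>" for u
    using that assms(2) unfolding assms(3) by (simp add: proj_equivariant)
  have eq: "v <#\<^bsub>\<Gamma>\<^esub> H = {w \<in> carrier \<Gamma>. bact P w ?z = bact P v ?z}" if v: "v \<in> carrier \<Gamma>" for v
  proof -
    have "w \<in> v <#\<^bsub>\<Gamma>\<^esub> H \<longleftrightarrow> bact P w ?z = bact P v ?z" if w: "w \<in> carrier \<Gamma>" for w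
    proof -
      have "w \<in> v <#\<^bsub>\<Gamma>\<^esub> H \<longleftrightarrow> v <#\<^bsub>\<Gamma>\<^esub> H = w <#\<^bsub>\<Gamma>\<^esub> H"
        using \<Gamma>.l_repr_independence[OF _ v H.subgroup_axioms] \<Gamma>.lcos_self[OF w H.subgroup_axioms] by blast
      also have "\<dots> \<longleftrightarrow> bact P (inv\<^bsub>\<Gamma>\<^esub> v) (bact P w ?z) = ?z"
        using v w z by (simp add: lcos_eq_iff inH bact_mult)
      also have "\<dots> \<longleftrightarrow> bact P w ?z = bact P v ?z"
        using v w z bact_mult[of "bact P w ?z" v "inv\<^bsub>\<Gamma>\<^esub> v"] bact_mult[of ?z "inv\<^bsub>\<Gamma>\<^esub> v" v] bact_closed bact_one
        by auto
      finally show ?thesis .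
    qed
    moreover have "v <#\<^bsub>\<Gamma>\<^esub> H \<subseteq> carrier \<Gamma>" by (rule \<Gamma>.l_coset_subset_G[OF H.subset v])
    ultimately show ?thesis by blast
  qed
  have "lcosets\<^bsub>\<Gamma>\<^esub> H \<subseteq> (\<lambda>y. {w \<in> carrier \<Gamma>. bact P w ?z = y}) ` base_space P"
    using eq z by (auto simp: LCOSETS_def bact_closed)
  then have "finite (lcosets\<^bsub>\<Gamma>\<^esub> H)" by (rule finite_surj[OF assms(1)])
  then show ?thesis by (simp add: finite_index_subgroups_def H.subgroup_axioms)
qed

end

locale class_representatives =
  fixes \<Gamma> :: "'u monoid" and G :: "'g monoid"
    and rep_H :: "'u set set \<Rightarrow> 'u set" and rep_\<rho> :: "'u set \<Rightarrow> ('u \<Rightarrow> 'g) set \<Rightarrow> 'u \<Rightarrow> 'g"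
  assumes group_\<Gamma>: "group \<Gamma>" and group_G: "group G"
    and rep_H: "c \<in> subgroup_classes \<Gamma> \<Longrightarrow> rep_H c \<in> c"
    and rep_\<rho>: "c \<in> subgroup_classes \<Gamma> \<Longrightarrow> d \<in> hom_classes \<Gamma> G (rep_H c) \<Longrightarrow> rep_\<rho> (rep_H c) d \<in> d"
begin

definition class_pairs where "class_pairs = (SIGMA c:subgroup_classes \<Gamma>. hom_classes \<Gamma> G (rep_H c))"

definition sub_of where "sub_of i = rep_H (fst i)"

definition hom_of where "hom_of i = rep_\<rho> (sub_of i) (snd i)"

abbreviation model where "model i \<equiv> ind_bundle \<Gamma> G (sub_of i) (hom_of i)"

lemma class_pairs_rep:
  assumes "i \<in> class_pairs"
  shows "fst i = orbit \<Gamma> (\<lambda>u H. (u <#\<^bsub>\<Gamma>\<^esub> H) #>\<^bsub>\<Gamma>\<^esub> inv\<^bsub>\<Gamma>\<^esub> u) (sub_of i)"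
    and "snd i = orbit (\<Gamma>\<lparr>carrier := normalizer \<Gamma> (sub_of i)\<rparr> \<times>\<times> G) (hom_conj \<Gamma> G (sub_of i)) (hom_of i)"
    and "hom_of i \<in> Homs \<Gamma> G (sub_of i)"
    and "subgroup_hom \<Gamma> G (sub_of i) (hom_of i)"
proof -
  have c: "fst i \<in> subgroup_classes \<Gamma>" and d: "snd i \<in> hom_classes \<Gamma> G (sub_of i)"
    using assms by (auto simp: class_pairs_def sub_of_def)
  note s = subgroup_class_eq_orbit[OF group_\<Gamma> c rep_H[OF c], folded sub_of_def]
  note h = hom_class_eq_orbit[OF group_\<Gamma> group_G s(1) d rep_\<rho>[OF c d[unfolded sub_of_def], folded sub_of_def, folded hom_of_def]]
  show "fst i = orbit \<Gamma> (\<lambda>u H. (u <#\<^bsub>\<Gamma>\<^esub> H) #>\<^bsub>\<Gamma>\<^esub> inv\<^bsub>\<Gamma>\<^esub> u) (sub_of i)" by (rule s(2))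
  show "snd i = orbit (\<Gamma>\<lparr>carrier := normalizer \<Gamma> (sub_of i)\<rparr> \<times>\<times> G) (hom_conj \<Gamma> G (sub_of i)) (hom_of i)"
    by (rule h(2))
  show h1: "hom_of i \<in> Homs \<Gamma> G (sub_of i)" by (rule h(1))
  show "subgroup_hom \<Gamma> G (sub_of i) (hom_of i)"
    using h1 s(1) group_\<Gamma> group_G by (simp add: subgroup_hom_def subgroup_hom_axioms_def Homs_def)
qed

text \<open>
  Start at \<open>x\<close>, whose isotropy group \<open>H0\<close> has finite index. Some \<open>w\<close> conjugates \<open>H0\<close> to the representative
  \<open>H\<close> of its class, and \<open>w x\<close> has isotropy group \<open>H\<close>. Its homomorphism is then brought to the
  representative of its class by an element of \<open>N(H) \<times> G\<close>, which leaves \<open>H\<close> fixed.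
\<close>

lemma class_frame_exists:
  assumes "equivariant_bundle \<Gamma> G P" "finite (base_space P)" "x \<in> total_space P"
  obtains i y where "i \<in> class_pairs" "frame \<Gamma> P (sub_of i) (hom_of i) y" "proj P y \<in> orbit \<Gamma> (bact P) (proj P x)"
proof -
  interpret equivariant_bundle \<Gamma> G P by fact
  interpret \<Gamma>: group \<Gamma> by (rule group_\<Gamma>)
  interpret G: group G by (rule group_G)
  let ?a = "\<lambda>u H. (u <#\<^bsub>\<Gamma>\<^esub> H) #>\<^bsub>\<Gamma>\<^esub> inv\<^bsub>\<Gamma>\<^esub> u"
  define H0 where "H0 = {u \<in> carrier \<Gamma>. proj P (lact P u x) = proj P x}"
  obtain \<rho>0 where \<rho>0: "subgroup H0 \<Gamma>" "\<rho>0 \<in> hom (\<Gamma>\<lparr>carrier := H0\<rparr>) G" "frame \<Gamma> P H0 \<rho>0 x"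
    by (rule frame_exists[OF assms(3) H0_def])
  define c where "c = orbit \<Gamma> ?a H0"
  have c: "c \<in> subgroup_classes \<Gamma>"
    using stabilizer_finite_index[OF assms(2,3) H0_def] by (auto simp: c_def subgroup_classes_def orbits_def)
  define H where "H = rep_H c"
  obtain w where w: "w \<in> carrier \<Gamma>" "H = ?a w H0"
    using rep_H[OF c] unfolding H_def c_def orbit_def by blast
  \<comment> \<open>the trivial factor gives the point the form that \<open>frame_move\<close> expects\<close>
  define x1 where "x1 = ract P (lact P w x) \<one>\<^bsub>G\<^esub>"
  have x1: "x1 \<in> total_space P" using assms(3) w by (simp add: x1_def lact_closed ract_closed)
  have \<rho>0_closed: "\<rho>0 h \<in> carrier G" if "h \<in> H0" for h using \<rho>0(2) that by (auto simp: hom_def)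
  have H1: "H = {u \<in> carrier \<Gamma>. proj P (lact P u x1) = proj P x1}"
    unfolding w(2) x1_def by (rule frameD(2)[OF frame_move[OF \<rho>0(3) \<rho>0_closed w(1) G.one_closed]])
  obtain \<rho>1 where \<rho>1: "subgroup H \<Gamma>" "\<rho>1 \<in> hom (\<Gamma>\<lparr>carrier := H\<rparr>) G" "frame \<Gamma> P H \<rho>1 x1"
    by (rule frame_exists[OF x1 H1])
  \<comment> \<open>members of a class of homomorphisms are extensional\<close>
  let ?\<rho>1 = "restrict \<rho>1 H"
  have hom1: "?\<rho>1 \<in> Homs \<Gamma> G H"
    using \<rho>1 subgroup.m_closed[OF \<rho>1(1)] by (simp add: Homs_def hom_def Pi_def)
  have fr1: "frame \<Gamma> P H ?\<rho>1 x1" by (rule frame_cong[OF \<rho>1(3)]) simp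
  let ?K = "\<Gamma>\<lparr>carrier := normalizer \<Gamma> H\<rparr> \<times>\<times> G"
  define d where "d = orbit ?K (hom_conj \<Gamma> G H) ?\<rho>1"
  have d: "d \<in> hom_classes \<Gamma> G H"
    using hom1 by (auto simp: d_def hom_classes_def orbits_def)
  have "rep_\<rho> H d \<in> d" using rep_\<rho>[OF c] d unfolding H_def by blast
  then obtain p where p: "p \<in> carrier ?K" "rep_\<rho> H d = hom_conj \<Gamma> G H p ?\<rho>1"
    unfolding d_def orbit_def by blast
  obtain u g where e: "p = (u, g)" by fastforce
  have u: "u \<in> normalizer \<Gamma> H" and g: "g \<in> carrier G" using p e by auto
  have uc: "u \<in> carrier \<Gamma>" using u \<Gamma>.normalizer_iff[OF subgroup.subset[OF \<rho>1(1)]] by blast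
  let ?y = "ract P (lact P u x1) (inv\<^bsub>G\<^esub> g)"
  have ic: "(c, d) \<in> class_pairs" using c d by (simp add: class_pairs_def H_def)
  have eqs: "sub_of (c, d) = H" "hom_of (c, d) = rep_\<rho> H d" by (simp_all add: sub_of_def hom_of_def H_def)
  have fr: "frame \<Gamma> P (sub_of (c, d)) (hom_of (c, d)) ?y"
    unfolding eqs p(2) e
    by (rule frame_hom_conj[OF fr1 Homs_closed[OF hom1] subgroup.subset[OF \<rho>1(1)] u g])
  have "proj P ?y = bact P (u \<otimes>\<^bsub>\<Gamma>\<^esub> w) (proj P x)"
    using assms(3) uc w(1) g by (simp add: x1_def proj_ract lact_closed ract_closed proj_equivariant bact_mult proj_closed)
  then have "proj P ?y \<in> orbit \<Gamma> (bact P) (proj P x)"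
    using uc w(1) unfolding orbit_def by blast
  then show thesis by (rule that[OF ic fr])
qed

text \<open>
  Two frames over one orbit differ by some \<open>(u, g)\<close>, so their types are conjugate. Conjugate
  representatives of subgroups coincide; then \<open>u\<close> normalizes the subgroup, and the two
  homomorphisms are in one \<open>N(H) \<times> G\<close>-class.
\<close>

lemma class_frame_unique:
  assumes "equivariant_bundle \<Gamma> G P" and i: "i \<in> class_pairs" and j: "j \<in> class_pairs"
    and fi: "frame \<Gamma> P (sub_of i) (hom_of i) x" and fj: "frame \<Gamma> P (sub_of j) (hom_of j) y"
    and "proj P y \<in> orbit \<Gamma> (bact P) (proj P x)"
  shows "i = j"
proof -
  interpret equivariant_bundle \<Gamma> G P by fact
  interpret \<Gamma>: group \<Gamma> by (rule group_\<Gamma>)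
  interpret G: group G by (rule group_G)
  interpret i: subgroup_hom \<Gamma> G "sub_of i" "hom_of i" by (rule class_pairs_rep(4)[OF i])
  interpret j: subgroup_hom \<Gamma> G "sub_of j" "hom_of j" by (rule class_pairs_rep(4)[OF j])
  let ?a = "\<lambda>u H. (u <#\<^bsub>\<Gamma>\<^esub> H) #>\<^bsub>\<Gamma>\<^esub> inv\<^bsub>\<Gamma>\<^esub> u"
  obtain u g where u: "u \<in> carrier \<Gamma>" and g: "g \<in> carrier G" and y: "y = ract P (lact P u x) g"
    using assms(6) same_orbit_iff[OF frameD(1)[OF fi] frameD(1)[OF fj]] by blast
  have Hj: "sub_of j = ?a u (sub_of i)"
    by (rule trans[OF frameD(2)[OF fj]])
      (unfold y, rule frameD(2)[OF frame_move[OF fi i.hom_closed u g], symmetric])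
  have "orbit \<Gamma> ?a (?a u (sub_of i)) = orbit \<Gamma> ?a (sub_of i)"
    by (rule orbit_eq[OF group_\<Gamma> u]) (simp add: \<Gamma>.conj_set_conj_set i.H.subset)
  then have fst: "fst i = fst j"
    unfolding class_pairs_rep(1)[OF i] class_pairs_rep(1)[OF j] Hj by (rule sym)
  then have HH: "sub_of j = sub_of i" by (simp add: sub_of_def)
  have uN: "u \<in> normalizer \<Gamma> (sub_of i)"
    using \<Gamma>.normalizer_iff[OF i.H.subset] u Hj HH by simp
  let ?\<rho>' = "hom_conj \<Gamma> G (sub_of i) (u, inv\<^bsub>G\<^esub> g) (hom_of i)"
  let ?K = "\<Gamma>\<lparr>carrier := normalizer \<Gamma> (sub_of i)\<rparr> \<times>\<times> G"
  have K: "(u, inv\<^bsub>G\<^esub> g) \<in> carrier ?K" using uN g by simp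
  have "?\<rho>' \<in> snd i"
    unfolding class_pairs_rep(2)[OF i] orbit_def using K by blast
  moreover have di: "snd i \<in> hom_classes \<Gamma> G (sub_of i)" using i by (auto simp: class_pairs_def sub_of_def)
  ultimately have \<rho>': "?\<rho>' \<in> Homs \<Gamma> G (sub_of i)" "snd i = orbit ?K (hom_conj \<Gamma> G (sub_of i)) ?\<rho>'"
    using hom_class_eq_orbit[OF group_\<Gamma> group_G i.H.subgroup_axioms] by blast+
  have fr: "frame \<Gamma> P (sub_of i) ?\<rho>' y"
    using frame_hom_conj[OF fi i.hom_closed i.H.subset uN G.inv_closed[OF g]] g by (simp add: y)
  have "hom_of j h = ?\<rho>' h" if "h \<in> sub_of i" for h
    by (rule frame_unique(2)[OF fr fj[unfolded HH] Homs_closed[OF \<rho>'(1)] j.hom_closed[unfolded HH] that])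
  then have "hom_of j = ?\<rho>'"
    using \<rho>'(1) class_pairs_rep(3)[OF j] unfolding HH Homs_def by (intro extensionalityI[of _ "sub_of i"]) auto
  then have "snd i = snd j"
    using \<rho>'(2) class_pairs_rep(2)[OF j] unfolding HH by simp
  then show ?thesis using fst by (rule prod_eqI[rotated])
qed

end

section \<open>Automorphism groups of bundles over finite bases\<close>

context class_representatives
begin

text \<open>
  Each component contains a frame of exactly one representative type, and there are finitely many
  components. So the components of type \<open>i\<close>, numbered from \<open>1\<close> to their count, form a system of blocks
  modelled on \<open>P\<^sub>\<rho>\<close>. An automorphism permutes the components and preserves the types of frames,
  hence permutes the blocks of each type.
\<close>

theorem Aut_decomposition:
  assumes "equivariant_bundle \<Gamma> G P" and fin: "finite (base_space P)"
  shows "bundle_Aut \<Gamma> G P \<cong> product_group class_pairs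
    (\<lambda>i. wreath (bundle_Aut \<Gamma> G (model i)) (component_count \<Gamma> G P (model i)))"
proof -
  interpret P: equivariant_bundle \<Gamma> G P by fact
  interpret G: group G by (rule group_G)
  interpret \<Gamma>: group \<Gamma> by (rule group_\<Gamma>)
  let ?comp = "irreducible_components \<Gamma> P"
  let ?Z = "orbits \<Gamma> (base_space P) (bact P)"
  let ?r = "\<lambda>i. component_count \<Gamma> G P (model i)"
  define M where "M i = {C \<in> ?comp. bundle_isomorphic \<Gamma> G C (model i)}" for i
  have comp_cases: "\<exists>Z\<in>?Z. C = bundle_restrict P Z" if "C \<in> ?comp" for C
    using that by (auto simp: irreducible_components_def)
  have comp_eq: "C = C'"
    if C: "C \<in> ?comp" "C' \<in> ?comp" and x: "x \<in> total_space C" and y: "y \<in> total_space C'"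
      and xy: "proj P y \<in> orbit \<Gamma> (bact P) (proj P x)" for C C' x y
  proof -
    obtain Z Z' where Z: "Z \<in> ?Z" "C = bundle_restrict P Z" and Z': "Z' \<in> ?Z" "C' = bundle_restrict P Z'"
      using comp_cases C by metis
    have xZ: "proj P x \<in> Z" using x Z P.total_restrict by blast
    have yZ: "proj P y \<in> Z'" using y Z' P.total_restrict by blast
    have "proj P y \<in> Z" using xy P.orbit_base(2)[OF Z(1) xZ] by simp
    then have "Z = Z'" using P.orbit_base(2)[OF Z(1)] P.orbit_base(2)[OF Z'(1) yZ] by simp
    then show ?thesis using Z Z' by simp
  qed
  have comp_of: "bundle_restrict P (orbit \<Gamma> (bact P) (proj P x)) \<in> ?comp \<and>
      x \<in> total_space (bundle_restrict P (orbit \<Gamma> (bact P) (proj P x)))" if x: "x \<in> total_space P" for x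
    using P.orbit_in_orbits[OF P.proj_closed[OF x]] P.orbit_self[OF P.proj_closed[OF x]] x
    by (simp add: irreducible_components_def P.total_restrict)
  have M_iff: "C \<in> M i \<longleftrightarrow> (\<exists>x\<in>total_space C. frame \<Gamma> P (sub_of i) (hom_of i) x)"
    if C: "C \<in> ?comp" and i: "i \<in> class_pairs" for C i
  proof -
    obtain Z where Z: "Z \<in> ?Z" "C = bundle_restrict P Z" using comp_cases[OF C] by blast
    have "C \<in> M i \<longleftrightarrow> bundle_isomorphic \<Gamma> G C (model i)" using C by (simp add: M_def)
    also have "\<dots> \<longleftrightarrow> (\<exists>x. frame \<Gamma> P (sub_of i) (hom_of i) x \<and> proj P x \<in> Z)"
      unfolding Z(2) by (rule P.component_iff_frame[OF class_pairs_rep(4)[OF i] Z(1)])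
    also have "\<dots> \<longleftrightarrow> (\<exists>x\<in>total_space C. frame \<Gamma> P (sub_of i) (hom_of i) x)"
      unfolding Z(2) P.total_restrict by (blast dest: frameD(1))
    finally show ?thesis .
  qed
  have "finite ?comp"
    using fin by (simp add: irreducible_components_def orbits_def setcompr_eq_image)
  then have "finite (M i)" for i by (simp add: M_def)
  then have "\<exists>h. bij_betw h {1..?r i} (M i)" for i
    unfolding component_count_def M_def by (rule ex_bij_betw_nat_finite_1)
  then obtain h where h: "\<And>i. bij_betw (h i) {1..?r i} (M i)" by metis
  have h_surj: thesis if C: "C \<in> M i" and k: "\<And>k. k \<in> {1..?r i} \<Longrightarrow> h i k = C \<Longrightarrow> thesis" for i C thesis
  proof -
    have "C \<in> h i ` {1..?r i}" unfolding bij_betw_imp_surj_on[OF h] by (rule C)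
    then show thesis by (rule imageE) (rule k, auto)
  qed
  have hM: "h i k \<in> M i" if "k \<in> {1..?r i}" for i k
    using bij_betwE[OF h] that by blast
  have hcomp: "h i k \<in> ?comp" if "k \<in> {1..?r i}" for i k
    using hM[OF that] by (simp add: M_def)
  have ex_iso: "\<exists>\<psi>. \<psi> \<in> bundle_iso \<Gamma> G (model i) (h i k)" if k: "k \<in> {1..?r i}" for i k
  proof -
    obtain Z where Z: "Z \<in> ?Z" "h i k = bundle_restrict P Z" using comp_cases[OF hcomp[OF k]] by blast
    obtain \<phi> where \<phi>: "\<phi> \<in> bundle_iso \<Gamma> G (h i k) (model i)"
      using hM[OF k] by (auto simp: M_def bundle_isomorphic_def)
    have "inv_into (total_space (h i k)) \<phi> \<in> bundle_iso \<Gamma> G (model i) (h i k)"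
      by (rule bundle_iso_inv[OF \<phi>])
        (simp_all add: Z(2) P.lact_restrict P.ract_restrict P.restrict_closed[OF Z(1)])
    then show ?thesis by blast
  qed
  define \<psi> where "\<psi> i k = (SOME \<psi>. \<psi> \<in> bundle_iso \<Gamma> G (model i) (h i k))" for i k
  have \<psi>: "\<psi> i k \<in> bundle_iso \<Gamma> G (model i) (h i k)" if k: "k \<in> {1..?r i}" for i k
    unfolding \<psi>_def by (rule someI_ex[OF ex_iso[OF k]])
  have im: "\<psi> i k ` total_space (model i) = total_space (h i k)" if "k \<in> {1..?r i}" for i k
    using bundle_isoD(1)[OF \<psi>[OF that]] by (rule bij_betw_imp_surj_on)
  have acts: "total_space (h i k) \<subseteq> total_space P" "lact (h i k) = lact P" "ract (h i k) = ract P"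
    if k: "k \<in> {1..?r i}" for i k
    using comp_cases[OF hcomp[OF k]] by (auto simp: P.total_restrict P.lact_restrict P.ract_restrict)
  have self: "proj P x \<in> orbit \<Gamma> (bact P) (proj P x)" if "x \<in> total_space P" for x
    by (rule P.orbit_self[OF P.proj_closed[OF that]])
  have class_eq: "i = j" if i: "i \<in> class_pairs" and j: "j \<in> class_pairs" and C: "C \<in> M i" "C \<in> M j" for i j C
  proof -
    have Cc: "C \<in> ?comp" using C by (simp add: M_def)
    obtain Z where Z: "Z \<in> ?Z" "C = bundle_restrict P Z" using comp_cases[OF Cc] by blast
    obtain x where x: "x \<in> total_space C" "frame \<Gamma> P (sub_of i) (hom_of i) x" using M_iff[OF Cc i] C by blast
    obtain y where y: "y \<in> total_space C" "frame \<Gamma> P (sub_of j) (hom_of j) y" using M_iff[OF Cc j] C by blast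
    have xZ: "proj P x \<in> Z" and yZ: "proj P y \<in> Z" using x y unfolding Z(2) P.total_restrict by auto
    show ?thesis
      using class_frame_unique[OF assms(1) i j x(2) y(2)] yZ P.orbit_base(2)[OF Z(1) xZ] by simp
  qed
  interpret B: bundle_blocks \<Gamma> G P class_pairs model ?r \<psi>
  proof (intro bundle_blocks.intro bundle_blocks_axioms.intro)
    show "equivariant_bundle \<Gamma> G P" by (rule assms(1))
  next
    fix i assume i: "i \<in> class_pairs"
    interpret subgroup_hom \<Gamma> G "sub_of i" "hom_of i" by (rule class_pairs_rep(4)[OF i])
    show "equivariant_bundle \<Gamma> G (model i)" by (rule ind.equivariant_bundle_axioms)
    show "total_space (model i) \<noteq> {}" using cls_closed[OF \<Gamma>.one_closed G.one_closed] by blast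
  next
    fix i k q i' k' q'
    assume i: "i \<in> class_pairs" and k: "k \<in> {1..?r i}" and q: "q \<in> total_space (model i)"
      and i': "i' \<in> class_pairs" and k': "k' \<in> {1..?r i'}" and q': "q' \<in> total_space (model i')"
      and eq: "\<psi> i k q = \<psi> i' k' q'"
    have x: "\<psi> i k q \<in> total_space (h i k)" "\<psi> i k q \<in> total_space (h i' k')"
      using bundle_isoD(2)[OF \<psi>[OF k] q] bundle_isoD(2)[OF \<psi>[OF k'] q'] eq by simp_all
    then have C: "h i k = h i' k'"
      by (rule comp_eq[OF hcomp[OF k] hcomp[OF k']]) (use self x acts(1)[OF k] in blast)
    then have ii: "i = i'" using class_eq[OF i i'] hM[OF k] hM[OF k'] by simp
    then have kk: "k = k'"
      using inj_onD[OF bij_betw_imp_inj_on[OF h[of i]], of k k'] C k k' by blast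
    have "q = q'"
      using inj_onD[OF bij_betw_imp_inj_on[OF bundle_isoD(1)[OF \<psi>[OF k]]], of q q'] eq q q' ii kk by blast
    then show "i = i' \<and> k = k' \<and> q = q'" using ii kk by blast
  next
    show "total_space P = (\<Union>i\<in>class_pairs. \<Union>k\<in>{1..?r i}. \<psi> i k ` total_space (model i))"
    proof
      show "(\<Union>i\<in>class_pairs. \<Union>k\<in>{1..?r i}. \<psi> i k ` total_space (model i)) \<subseteq> total_space P"
        using im acts(1) by blast
      show "total_space P \<subseteq> (\<Union>i\<in>class_pairs. \<Union>k\<in>{1..?r i}. \<psi> i k ` total_space (model i))"
      proof
        fix x assume x: "x \<in> total_space P"
        let ?C = "bundle_restrict P (orbit \<Gamma> (bact P) (proj P x))"
        obtain i y where i: "i \<in> class_pairs" and y: "frame \<Gamma> P (sub_of i) (hom_of i) y"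
          "proj P y \<in> orbit \<Gamma> (bact P) (proj P x)"
          by (rule class_frame_exists[OF assms x])
        have "y \<in> total_space ?C" using y frameD(1)[OF y(1)] by (simp add: P.total_restrict)
        then have "?C \<in> M i" using M_iff[OF _ i] comp_of[OF x] y(1) by blast
        then obtain k where k: "k \<in> {1..?r i}" "h i k = ?C" by (rule h_surj)
        have "x \<in> \<psi> i k ` total_space (model i)" using im[OF k(1)] k(2) comp_of[OF x] by simp
        then show "x \<in> (\<Union>i\<in>class_pairs. \<Union>k\<in>{1..?r i}. \<psi> i k ` total_space (model i))"
          using i k(1) by blast
      qed
    qed
  next
    fix i k q u assume "k \<in> {1..?r i}" "q \<in> total_space (model i)" "u \<in> carrier \<Gamma>"
    then show "\<psi> i k (lact (model i) u q) = lact P u (\<psi> i k q)"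
      using bundle_isoD(3)[OF \<psi>] acts(2) by metis
  next
    fix i k q g assume "k \<in> {1..?r i}" "q \<in> total_space (model i)" "g \<in> carrier G"
    then show "\<psi> i k (ract (model i) q g) = ract P (\<psi> i k q) g"
      using bundle_isoD(4)[OF \<psi>] acts(3) by metis
  next
    fix \<alpha> i k assume \<alpha>: "\<alpha> \<in> bundle_iso \<Gamma> G P P" and i: "i \<in> class_pairs" and k: "k \<in> {1..?r i}"
    obtain Z where Z: "Z \<in> ?Z" "h i k = bundle_restrict P Z" using comp_cases[OF hcomp[OF k]] by blast
    obtain x where x: "x \<in> total_space (h i k)" "frame \<Gamma> P (sub_of i) (hom_of i) x"
      using M_iff[OF hcomp[OF k] i] hM[OF k] by blast
    have xP: "x \<in> total_space P" by (rule frameD(1)[OF x(2)])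
    note D = bundle_isoD[OF \<alpha>]
    interpret i: subgroup_hom \<Gamma> G "sub_of i" "hom_of i" by (rule class_pairs_rep(4)[OF i])
    have fr: "frame \<Gamma> P (sub_of i) (hom_of i) (\<alpha> x)"
      by (rule P.frame_transport[OF assms(1) x(2) i.hom_closed D(2) bij_betw_imp_inj_on[OF D(1)] D(3,4)])
    let ?C = "bundle_restrict P (orbit \<Gamma> (bact P) (proj P (\<alpha> x)))"
    have \<alpha>xP: "\<alpha> x \<in> total_space P" by (rule D(2)[OF xP])
    have "?C \<in> M i" using M_iff[OF _ i] comp_of[OF \<alpha>xP] fr by blast
    then obtain l where l: "l \<in> {1..?r i}" "h i l = ?C" by (rule h_surj)
    \<comment> \<open>the component of a point is its \<open>\<Gamma> \<times> G\<close>-orbit, hence its image under \<open>\<alpha>\<close> is such an orbit\<close>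
    let ?S = "\<lambda>y. (\<lambda>p. ract P (lact P (fst p) y) (snd p)) ` (carrier \<Gamma> \<times> carrier G)"
    have sweep: "total_space (bundle_restrict P (orbit \<Gamma> (bact P) (proj P y))) = ?S y"
      if y: "y \<in> total_space P" for y
    proof -
      have "z \<in> total_space (bundle_restrict P (orbit \<Gamma> (bact P) (proj P y))) \<longleftrightarrow> z \<in> ?S y" for z
      proof -
        have "z \<in> ?S y \<longleftrightarrow> (\<exists>u\<in>carrier \<Gamma>. \<exists>g\<in>carrier G. z = ract P (lact P u y) g)"
          by force
        moreover have "z \<in> total_space P" if "\<exists>u\<in>carrier \<Gamma>. \<exists>g\<in>carrier G. z = ract P (lact P u y) g"
          using that y by (auto simp: P.ract_closed P.lact_closed)
        ultimately show ?thesis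
          using P.same_orbit_iff[OF y, of z] unfolding P.total_restrict mem_Collect_eq by argo
      qed
      then show ?thesis by (rule Set.set_eqI)
    qed
    have "Z = orbit \<Gamma> (bact P) (proj P x)"
      using x(1) P.orbit_base(2)[OF Z(1)] unfolding Z(2) P.total_restrict by blast
    then have hx: "total_space (h i k) = ?S x"
      using sweep[OF xP] Z(2) by simp
    have "\<alpha> (ract P (lact P u x) g) = ract P (lact P u (\<alpha> x)) g" if "u \<in> carrier \<Gamma>" "g \<in> carrier G" for u g
      using D(3)[OF xP that(1)] D(4)[OF P.lact_closed[OF xP that(1)] that(2)] by simp
    then have "\<alpha> ` total_space (h i k) = ?S (\<alpha> x)"
      unfolding hx image_image by (intro image_cong) auto
    also have "\<dots> = total_space (h i l)" unfolding l(2) sweep[OF \<alpha>xP] ..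
    finally show "\<exists>l\<in>{1..?r i}. \<alpha> ` \<psi> i k ` total_space (model i) = \<psi> i l ` total_space (model i)"
      using l(1) unfolding im[OF k] by (intro bexI[of _ l]) (simp_all only: im)
  qed
  show ?thesis by (rule B.Aut_iso)
qed

end

section \<open>The centralizer as an automorphism group\<close>

text \<open>
  The values at \<open>(l, 1)\<close> are \<open>(s l, f (s l))\<close>, from which \<open>s\<close> and \<open>f\<close> can be recovered.
\<close>

lemma wreath_act_faithful:
  assumes "group G" and x: "x \<in> carrier (wreath G n)" and y: "y \<in> carrier (wreath G n)"
    and eq: "\<And>p. p \<in> {1..n} \<times> carrier G \<Longrightarrow> wreath_act G x p = wreath_act G y p"
  shows "x = y"
proof -
  interpret group G by fact
  obtain f s where e: "x = (f, s)" by fastforce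
  obtain f' s' where e': "y = (f', s')" by fastforce
  have c: "f \<in> {1..n} \<rightarrow>\<^sub>E carrier G" "s permutes {1..n}"
    using x by (auto simp: e carrier_wreath)
  have c': "f' \<in> {1..n} \<rightarrow>\<^sub>E carrier G" "s' permutes {1..n}"
    using y by (auto simp: e' carrier_wreath)
  have key: "s l = s' l \<and> f (s l) = f' (s' l)" if l: "l \<in> {1..n}" for l
  proof -
    have "s l \<in> {1..n}" "s' l \<in> {1..n}" using l permutes_in_image[OF c(2)] permutes_in_image[OF c'(2)] by blast+
    then have "f (s l) \<in> carrier G" "f' (s' l) \<in> carrier G" using c(1) c'(1) by (auto simp del: atLeastAtMost_iff)
    then show ?thesis using eq[of "(l, \<one>\<^bsub>G\<^esub>)"] l by (auto simp: wreath_act_def e e')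
  qed
  have s: "s = s'"
  proof
    fix l show "s l = s' l"
      using key[of l] permutes_not_in[OF c(2), of l] permutes_not_in[OF c'(2), of l] by (cases "l \<in> {1..n}") auto
  qed
  have "f k = f' k" if k: "k \<in> {1..n}" for k
  proof -
    have "k \<in> s ` {1..n}" unfolding permutes_image[OF c(2)] by (rule k)
    then show ?thesis using key s by auto
  qed
  then have "f = f'" by (rule PiE_ext[OF c(1) c'(1)])
  then show ?thesis using s e e' by simp
qed

text \<open>
  Write \<open>\<alpha> (l, 1) = (t l, a l)\<close>. By \<open>G\<close>-equivariance \<open>\<alpha>\<close> is determined by \<open>t\<close> and \<open>a\<close>, and injectivity of
  \<open>\<alpha>\<close> forces \<open>t\<close> to be injective: if \<open>t l = t m\<close>, then \<open>\<alpha> (l, 1) = \<alpha> (m, g)\<close> for \<open>g = (a m)\<^sup>-\<^sup>1 (a l)\<close>.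
\<close>

lemma wreath_act_surj:
  assumes "group G" and bij: "bij_betw \<alpha> ({1..n} \<times> carrier G) ({1..n} \<times> carrier G)"
    and ract: "\<And>l g h. l \<in> {1..n} \<Longrightarrow> g \<in> carrier G \<Longrightarrow> h \<in> carrier G \<Longrightarrow>
      \<alpha> (l, g \<otimes>\<^bsub>G\<^esub> h) = (fst (\<alpha> (l, g)), snd (\<alpha> (l, g)) \<otimes>\<^bsub>G\<^esub> h)"
  obtains x where "x \<in> carrier (wreath G n)" "\<And>p. p \<in> {1..n} \<times> carrier G \<Longrightarrow> wreath_act G x p = \<alpha> p"
proof -
  interpret group G by fact
  define t where "t l = fst (\<alpha> (l, \<one>\<^bsub>G\<^esub>))" for l
  define a where "a l = snd (\<alpha> (l, \<one>\<^bsub>G\<^esub>))" for l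
  have closed: "t l \<in> {1..n}" "a l \<in> carrier G" if "l \<in> {1..n}" for l
    using bij_betwE[OF bij, rule_format, of "(l, \<one>\<^bsub>G\<^esub>)"] that by (auto simp: t_def a_def mem_Times_iff)
  have \<alpha>: "\<alpha> (l, g) = (t l, a l \<otimes>\<^bsub>G\<^esub> g)" if "l \<in> {1..n}" "g \<in> carrier G" for l g
    using ract[OF that(1) one_closed that(2)] that by (simp add: t_def a_def)
  have "inj_on t {1..n}"
  proof (rule inj_onI)
    fix l m assume l: "l \<in> {1..n}" and m: "m \<in> {1..n}" and eq: "t l = t m"
    let ?g = "inv\<^bsub>G\<^esub> (a m) \<otimes>\<^bsub>G\<^esub> a l"
    have g: "?g \<in> carrier G" using closed l m by simp
    have "\<alpha> (l, \<one>\<^bsub>G\<^esub>) = \<alpha> (m, ?g)"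
      using \<alpha>[OF l one_closed] \<alpha>[OF m g] eq closed l m by (simp add: m_assoc[symmetric] del: atLeastAtMost_iff)
    then have "(l, \<one>\<^bsub>G\<^esub>) = (m, ?g)"
      using inj_onD[OF bij_betw_imp_inj_on[OF bij]] l m g by blast
    then show "l = m" by simp
  qed
  moreover have "t ` {1..n} \<subseteq> {1..n}" using closed by blast
  ultimately have "bij_betw t {1..n} {1..n}"
    by (simp add: bij_betw_def endo_inj_surj)
  moreover let ?s = "\<lambda>l. if l \<in> {1..n} then t l else l"
  have "bij_betw ?s {1..n} {1..n} \<longleftrightarrow> bij_betw t {1..n} {1..n}"
    by (rule bij_betw_cong) (rule if_P)
  ultimately have s: "?s permutes {1..n}"
    by (intro bij_imp_permutes) (blast, rule if_not_P)
  let ?f = "\<lambda>k\<in>{1..n}. a (inv' ?s k)"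
  show thesis
  proof (rule that[of "(?f, ?s)"])
    show "(?f, ?s) \<in> carrier (wreath G n)"
      unfolding carrier_wreath restrict_PiE_iff
      using s by (intro conjI ballI closed(2) inv_permutes_mem[OF s])
    show "wreath_act G (?f, ?s) p = \<alpha> p" if p: "p \<in> {1..n} \<times> carrier G" for p
    proof -
      obtain l g where e: "p = (l, g)" and l: "l \<in> {1..n}" and g: "g \<in> carrier G" using p by blast
      have sl: "?s l = t l" using l by simp
      have "inv' ?s (t l) = l" using permutes_inverses(2)[OF s, of l] unfolding sl .
      then have "?f (t l) = a l" using closed(1)[OF l] by simp
      then show ?thesis unfolding e \<alpha>[OF l g] wreath_act_def prod.case sl by simp
    qed
  qed
qed

text \<open>
  The wreath product is the group of all \<open>G\<close>-equivariant bijections of \<open>{1..n} \<times> G\<close>; commuting with the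
  image of \<open>\<theta>\<close> means being \<open>\<Gamma>\<close>-equivariant.
\<close>

theorem centralizer_iso_Aut:
  assumes "group \<Gamma>" "group G" and \<theta>: "\<theta> \<in> hom \<Gamma> (wreath G n)"
  shows "(wreath G n)\<lparr>carrier := centralizer (wreath G n) (\<theta> ` carrier \<Gamma>)\<rparr> \<cong>
    bundle_Aut \<Gamma> G (assoc_bundle G n \<theta>)"
proof -
  interpret G: group G by fact
  interpret W: group "wreath G n" by (rule group_wreath) fact
  let ?P = "assoc_bundle G n \<theta>" and ?T = "{1..n} \<times> carrier G"
  let ?C = "centralizer (wreath G n) (\<theta> ` carrier \<Gamma>)"
  interpret P: equivariant_bundle \<Gamma> G ?P by (rule equivariant_bundle_assoc[OF assms])
  have P: "total_space ?P = ?T" "lact ?P = (\<lambda>u. wreath_act G (\<theta> u))"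
    "ract ?P = (\<lambda>(l, g) g'. (l, g \<otimes>\<^bsub>G\<^esub> g'))"
    by (simp_all add: assoc_bundle_def)
  have \<theta>c: "\<theta> u \<in> carrier (wreath G n)" if "u \<in> carrier \<Gamma>" for u using \<theta> that by (auto simp: hom_def)
  note closed = wreath_act_closed[OF \<open>group G\<close>] and mult = wreath_act_mult[OF \<open>group G\<close>]
  have one: "wreath_act G \<one>\<^bsub>wreath G n\<^esub> p = p" if "p \<in> ?T" for p
    using that by (auto simp: one_wreath wreath_act_def)
  define \<Phi> where "\<Phi> x = restrict (wreath_act G x) ?T" for x
  have C: "x \<in> ?C \<longleftrightarrow> \<Phi> x \<in> carrier (bundle_Aut \<Gamma> G ?P)" if x: "x \<in> carrier (wreath G n)" for x
  proof -
    let ?y = "inv\<^bsub>wreath G n\<^esub> x"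
    have y: "?y \<in> carrier (wreath G n)" by (rule W.inv_closed[OF x])
    have inv: "wreath_act G ?y (wreath_act G x p) = p" "wreath_act G x (wreath_act G ?y p) = p"
      if p: "p \<in> ?T" for p
      using mult[OF y x p] mult[OF x y p] one[OF p] unfolding W.l_inv[OF x] W.r_inv[OF x] by simp_all
    have bij: "bij_betw (wreath_act G x) ?T ?T"
      by (rule bij_betw_byWitness[where f' = "wreath_act G ?y"])
        (use inv in \<open>blast intro: closed[OF x] closed[OF y]\<close>)+
    have ract: "wreath_act G x (ract ?P p g) = ract ?P (wreath_act G x p) g" if "p \<in> ?T" "g \<in> carrier G" for p g
    proof -
      obtain l k where e: "p = (l, k)" by fastforce
      obtain f s where fs: "x = (f, s)" by fastforce
      have "f (s l) \<in> carrier G"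
        using closed[OF x, of "(l, \<one>\<^bsub>G\<^esub>)"] x that permutes_in_image[of s "{1..n}" l]
        by (auto simp: e fs carrier_wreath)
      then show ?thesis using that by (simp add: e fs P wreath_act_def G.m_assoc)
    qed
    have "x \<in> ?C \<longleftrightarrow> (\<forall>u\<in>carrier \<Gamma>. x \<otimes>\<^bsub>wreath G n\<^esub> \<theta> u = \<theta> u \<otimes>\<^bsub>wreath G n\<^esub> x)"
      using x by (auto simp: centralizer_def)
    also have "\<dots> \<longleftrightarrow> (\<forall>u\<in>carrier \<Gamma>. \<forall>p\<in>?T. wreath_act G x (wreath_act G (\<theta> u) p) = wreath_act G (\<theta> u) (wreath_act G x p))"
    proof (rule ball_cong[OF refl])
      fix u assume u: "u \<in> carrier \<Gamma>"
      note m = mult[OF x \<theta>c[OF u]] mult[OF \<theta>c[OF u] x]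
      show "x \<otimes>\<^bsub>wreath G n\<^esub> \<theta> u = \<theta> u \<otimes>\<^bsub>wreath G n\<^esub> x \<longleftrightarrow>
          (\<forall>p\<in>?T. wreath_act G x (wreath_act G (\<theta> u) p) = wreath_act G (\<theta> u) (wreath_act G x p))"
        using m wreath_act_faithful[OF \<open>group G\<close> W.m_closed[OF x \<theta>c[OF u]] W.m_closed[OF \<theta>c[OF u] x]]
        by metis
    qed
    also have "\<dots> \<longleftrightarrow> wreath_act G x \<in> bundle_iso \<Gamma> G ?P ?P"
      using bij ract by (auto simp: bundle_iso_def P)
    also have "\<dots> \<longleftrightarrow> \<Phi> x \<in> bundle_iso \<Gamma> G ?P ?P"
      using bundle_iso_cong[of "wreath_act G x" \<Gamma> G ?P ?P "\<Phi> x"] bundle_iso_cong[of "\<Phi> x" \<Gamma> G ?P ?P "wreath_act G x"]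
        P.lact_closed P.ract_closed unfolding \<Phi>_def P(1) by auto
    finally show ?thesis by (simp add: carrier_bundle_Aut \<Phi>_def P(1))
  qed
  have Cc: "x \<in> carrier (wreath G n)" if "x \<in> ?C" for x using that by (simp add: centralizer_def)
  have "\<Phi> (x \<otimes>\<^bsub>wreath G n\<^esub> y) = \<Phi> x \<otimes>\<^bsub>bundle_Aut \<Gamma> G ?P\<^esub> \<Phi> y" if x: "x \<in> ?C" and y: "y \<in> ?C" for x y
  proof -
    have "\<Phi> x \<in> carrier (bundle_Aut \<Gamma> G ?P)" "\<Phi> y \<in> carrier (bundle_Aut \<Gamma> G ?P)" using x y C Cc by blast+
    then show ?thesis
      using closed[OF Cc[OF y]] mult[OF Cc[OF x] Cc[OF y]]
      by (simp add: mult_bundle_Aut P(1)) (simp add: \<Phi>_def cong: restrict_cong)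
  qed
  moreover have "\<Phi> x \<in> carrier (bundle_Aut \<Gamma> G ?P)" if "x \<in> ?C" for x
    using C[OF Cc[OF that]] that by blast
  ultimately have "\<Phi> \<in> hom ((wreath G n)\<lparr>carrier := ?C\<rparr>) (bundle_Aut \<Gamma> G ?P)"
    by (intro homI) simp_all
  moreover have "inj_on \<Phi> ?C"
  proof (rule inj_onI)
    fix x y assume x: "x \<in> ?C" and y: "y \<in> ?C" and eq: "\<Phi> x = \<Phi> y"
    show "x = y"
    proof (rule wreath_act_faithful[OF \<open>group G\<close> Cc[OF x] Cc[OF y]])
      show "wreath_act G x p = wreath_act G y p" if p: "p \<in> ?T" for p
        using fun_cong[OF eq, of p] unfolding \<Phi>_def restrict_apply if_P[OF p] .
    qed
  qed
  moreover have "\<Phi> ` ?C = carrier (bundle_Aut \<Gamma> G ?P)"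
  proof
    show "\<Phi> ` ?C \<subseteq> carrier (bundle_Aut \<Gamma> G ?P)" using C Cc by blast
    show "carrier (bundle_Aut \<Gamma> G ?P) \<subseteq> \<Phi> ` ?C"
    proof
      fix \<alpha> assume \<alpha>: "\<alpha> \<in> carrier (bundle_Aut \<Gamma> G ?P)"
      then have iso: "\<alpha> \<in> bundle_iso \<Gamma> G ?P ?P" and ext: "\<alpha> \<in> extensional ?T"
        by (auto simp: carrier_bundle_Aut P(1))
      have "\<alpha> (l, g \<otimes>\<^bsub>G\<^esub> h) = (fst (\<alpha> (l, g)), snd (\<alpha> (l, g)) \<otimes>\<^bsub>G\<^esub> h)"
        if "l \<in> {1..n}" "g \<in> carrier G" "h \<in> carrier G" for l g h
        using bundle_isoD(4)[OF iso, of "(l, g)" h] that by (simp add: P case_prod_beta)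
      from wreath_act_surj[OF \<open>group G\<close> bundle_isoD(1)[OF iso, unfolded P(1)] this]
      obtain x where x: "x \<in> carrier (wreath G n)" "\<And>p. p \<in> ?T \<Longrightarrow> wreath_act G x p = \<alpha> p" by blast
      have "\<alpha> = \<Phi> x"
        by (rule extensionalityI[OF ext]) (simp_all add: \<Phi>_def x(2))
      then show "\<alpha> \<in> \<Phi> ` ?C" using C[OF x(1)] \<alpha> by blast
    qed
  qed
  ultimately have "\<Phi> \<in> iso ((wreath G n)\<lparr>carrier := ?C\<rparr>) (bundle_Aut \<Gamma> G ?P)"
    by (simp add: iso_def bij_betw_def)
  then show ?thesis by (rule is_isoI)
qed

lemma product_group_Sigma:
  "product_group (Sigma I J) A \<cong> product_group I (\<lambda>c. product_group (J c) (\<lambda>d. A (c, d)))"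
proof -
  let ?L = "product_group (Sigma I J) A" and ?R = "product_group I (\<lambda>c. product_group (J c) (\<lambda>d. A (c, d)))"
  define \<Phi> where "\<Phi> F = (\<lambda>c\<in>I. \<lambda>d\<in>J c. F (c, d))" for F :: "'a \<times> 'b \<Rightarrow> 'c"
  define \<Psi> where "\<Psi> w = (\<lambda>p\<in>Sigma I J. w (fst p) (snd p))" for w :: "'a \<Rightarrow> 'b \<Rightarrow> 'c"
  have \<Phi>_in: "\<Phi> F \<in> carrier ?R" if "F \<in> carrier ?L" for F
    using that by (auto simp: \<Phi>_def PiE_iff)
  have \<Psi>_in: "\<Psi> w \<in> carrier ?L" if "w \<in> carrier ?R" for w
    using that by (auto simp: \<Psi>_def PiE_iff)
  have "\<Psi> (\<Phi> F) = F" if "F \<in> carrier ?L" for F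
    using that by (auto simp: \<Phi>_def \<Psi>_def PiE_iff extensional_def fun_eq_iff)
  moreover have "\<Phi> (\<Psi> w) = w" if "w \<in> carrier ?R" for w
    using that by (auto simp: \<Phi>_def \<Psi>_def PiE_iff extensional_def fun_eq_iff)
  ultimately have "bij_betw \<Phi> (carrier ?L) (carrier ?R)"
    using \<Phi>_in \<Psi>_in by (intro bij_betw_byWitness[where f' = \<Psi>]) blast+
  moreover have "\<Phi> \<in> hom ?L ?R"
    by (rule homI[OF \<Phi>_in]) (auto simp: \<Phi>_def fun_eq_iff)
  ultimately show ?thesis
    by (intro is_isoI[of \<Phi>]) (simp add: iso_def)
qed

section \<open>Centralizers of homomorphisms to wreath products\<close>

theorem theoremF:
  fixes \<Gamma> :: "'u monoid" and G :: "'g monoid" and n :: nat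
    and \<theta> :: "'u \<Rightarrow> (nat \<Rightarrow> 'g) \<times> (nat \<Rightarrow> nat)"
    and rep_H :: "'u set set \<Rightarrow> 'u set"
    and rep_\<rho> :: "'u set \<Rightarrow> ('u \<Rightarrow> 'g) set \<Rightarrow> 'u \<Rightarrow> 'g"
  assumes "group \<Gamma>" and "group G" and "n \<ge> 1"
    and "\<theta> \<in> hom \<Gamma> (wreath G n)"
    and "\<And>c. c \<in> subgroup_classes \<Gamma> \<Longrightarrow> rep_H c \<in> c"
    and "\<And>c d. c \<in> subgroup_classes \<Gamma> \<Longrightarrow> d \<in> hom_classes \<Gamma> G (rep_H c) \<Longrightarrow>
           rep_\<rho> (rep_H c) d \<in> d"
  shows "(wreath G n)\<lparr>carrier := centralizer (wreath G n) (\<theta> ` carrier \<Gamma>)\<rparr> \<cong>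
      product_group (subgroup_classes \<Gamma>) (\<lambda>c. let H = rep_H c in
        product_group (hom_classes \<Gamma> G H) (\<lambda>d. let \<rho> = rep_\<rho> H d in
          wreath (bundle_Aut \<Gamma> G (ind_bundle \<Gamma> G H \<rho>))
            (component_count \<Gamma> G (assoc_bundle G n \<theta>) (ind_bundle \<Gamma> G H \<rho>)))) \<and>
    (\<forall>H\<in>finite_index_subgroups \<Gamma>. \<forall>\<rho>\<in>hom (\<Gamma>\<lparr>carrier := H\<rparr>) G.
      short_exact
        (G\<lparr>carrier := centralizer G (\<rho> ` H)\<rparr>)
        (bundle_Aut \<Gamma> G (ind_bundle \<Gamma> G H \<rho>))
        (\<Gamma>\<lparr>carrier := hom_normalizer \<Gamma> G H \<rho>\<rparr> Mod H)
        (\<lambda>c. twist_aut \<Gamma> G H \<rho> (\<one>\<^bsub>\<Gamma>\<^esub>, c))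
        (base_coset \<Gamma> G H \<rho>) \<and>
      (\<lambda>c. twist_aut \<Gamma> G H \<rho> (\<one>\<^bsub>\<Gamma>\<^esub>, c)) ` centralizer G (\<rho> ` H) =
        {\<phi> \<in> carrier (bundle_Aut \<Gamma> G (ind_bundle \<Gamma> G H \<rho>)).
          \<forall>C\<in>total_space (ind_bundle \<Gamma> G H \<rho>).
            proj (ind_bundle \<Gamma> G H \<rho>) (\<phi> C) = proj (ind_bundle \<Gamma> G H \<rho>) C} \<and>
      short_exact
        (\<Gamma>\<lparr>carrier := H\<rparr>)
        (twist_group \<Gamma> G H \<rho>)
        (bundle_Aut \<Gamma> G (ind_bundle \<Gamma> G H \<rho>))
        (\<lambda>h. (h, \<rho> h))
        (twist_aut \<Gamma> G H \<rho>))"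
proof (intro conjI ballI)
  interpret class_representatives \<Gamma> G rep_H rep_\<rho>
    by (rule class_representatives.intro) (use assms in blast)+
  let ?P = "assoc_bundle G n \<theta>"
  let ?A = "\<lambda>i. wreath (bundle_Aut \<Gamma> G (model i)) (component_count \<Gamma> G ?P (model i))"
  have "finite (base_space ?P)" by (simp add: assoc_bundle_def)
  from iso_trans[OF centralizer_iso_Aut[OF assms(1,2,4)]
      Aut_decomposition[OF equivariant_bundle_assoc[OF assms(1,2,4)] this, unfolded class_pairs_def]]
  have "(wreath G n)\<lparr>carrier := centralizer (wreath G n) (\<theta> ` carrier \<Gamma>)\<rparr> \<cong>
      product_group (SIGMA c:subgroup_classes \<Gamma>. hom_classes \<Gamma> G (rep_H c)) ?A" .
  from iso_trans[OF this product_group_Sigma]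
  show "(wreath G n)\<lparr>carrier := centralizer (wreath G n) (\<theta> ` carrier \<Gamma>)\<rparr> \<cong>
      product_group (subgroup_classes \<Gamma>) (\<lambda>c. let H = rep_H c in
        product_group (hom_classes \<Gamma> G H) (\<lambda>d. let \<rho> = rep_\<rho> H d in
          wreath (bundle_Aut \<Gamma> G (ind_bundle \<Gamma> G H \<rho>))
            (component_count \<Gamma> G ?P (ind_bundle \<Gamma> G H \<rho>))))"
    by (simp add: Let_def sub_of_def hom_of_def)
next
  fix H \<rho> assume "H \<in> finite_index_subgroups \<Gamma>" "\<rho> \<in> hom (\<Gamma>\<lparr>carrier := H\<rparr>) G"
  then interpret subgroup_hom \<Gamma> G H \<rho>
    using assms(1,2) by (simp add: subgroup_hom_def subgroup_hom_axioms_def finite_index_subgroups_def)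
  show "short_exact (G\<lparr>carrier := centralizer G (\<rho> ` H)\<rparr>) (bundle_Aut \<Gamma> G (ind_bundle \<Gamma> G H \<rho>))
      (\<Gamma>\<lparr>carrier := hom_normalizer \<Gamma> G H \<rho>\<rparr> Mod H) (\<lambda>c. twist_aut \<Gamma> G H \<rho> (\<one>\<^bsub>\<Gamma>\<^esub>, c))
      (base_coset \<Gamma> G H \<rho>)"
    by (rule exact_hom_normalizer)
  show "(\<lambda>c. twist_aut \<Gamma> G H \<rho> (\<one>\<^bsub>\<Gamma>\<^esub>, c)) ` centralizer G (\<rho> ` H) =
      {\<phi> \<in> carrier (bundle_Aut \<Gamma> G (ind_bundle \<Gamma> G H \<rho>)).
        \<forall>C\<in>total_space (ind_bundle \<Gamma> G H \<rho>).
          proj (ind_bundle \<Gamma> G H \<rho>) (\<phi> C) = proj (ind_bundle \<Gamma> G H \<rho>) C}"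
    by (rule vertical_automorphisms)
  show "short_exact (\<Gamma>\<lparr>carrier := H\<rparr>) (twist_group \<Gamma> G H \<rho>) (bundle_Aut \<Gamma> G (ind_bundle \<Gamma> G H \<rho>))
      (\<lambda>h. (h, \<rho> h)) (twist_aut \<Gamma> G H \<rho>)"
    by (rule exact_twists)
qed

end
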